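(* Let $d\in\mathbb{N}$ and let $(G,v_0)$ be an infinite, connected, rooted $d$-bounded graph of sub-exponential growth rate, and let $H$ be a Schrödinger operator on $\ell^2(G)$. Then $$\sigma_{\mathrm{ess}}(H)\subseteq\bigcup_{H'\in\mathcal{R}(H)}\sigma_\infty(H').$$
   Context: Graphs. A graph $G$ has a countable vertex set $V(G)$ and a set $E(G)$ of undirected edges, with no loops; $u\sim v$ means $(u,v)\in E(G)$, and $\deg(v)=\sharp\{u: u\sim v\}$. $(G,v_0)$ is a rooted $d$-bounded graph if $v_0\in V(G)$ is a fixed vertex (root) and $\deg(v)\le d$ for all $v$. $\mathrm{dist}$ is the combinatorial graph distance, $B_r(v)=\{u:\mathrm{dist}(u,v)\le r\}$; $B_r(v)$ also denotes the induced subgraph on this vertex set. $\ell^2(G)=\ell^2(V(G))$, $\ell^\infty(G)=\ell^\infty(V(G))$ (complex-valued functions). Sub-exponential growth rate. $(G,v_0)$ is of sub-exponential growth rate if for each $\gamma>1$ there is $C=C_{\gamma,v_0}>0$ with $\sharp B_r(v_0)<C\gamma^r$ for every $r\in\mathbb{N}$. Schrödinger operators. A Schrödinger operator on a graph $G$ (connected, with uniformly bounded degree) is an operator of the form $(H\psi)(v)=\sum_{u\sim v}(\psi(u)-\psi(v))+W(v)\psi(v)$ with $W:V(G)\to\mathbb{R}$ bounded. It is bounded and self-adjoint on $\ell^2(G)$; the formula also defines $H\psi$ for every $\psi:V(G)\to\mathbb{C}$. The discrete spectrum $\sigma_{\mathrm{disc}}(H)$ is the set of isolated eigenvalues of finite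 multiplicity, and $\sigma_{\mathrm{ess}}(H)=\sigma(H)\setminus\sigma_{\mathrm{disc}}(H)$. A generalized eigenfunction of $H$ with eigenvalue $\lambda$ is a function $\psi:V(G)\to\mathbb{C}$, $\psi\not\equiv0$, with $(H\psi)(v)=\lambda\psi(v)$ for all $v$. $\sigma_\infty(H)$ is the set of all $\lambda$ for which there is a bounded generalized eigenfunction $\psi\in\ell^\infty(G)$ with eigenvalue $\lambda$. Convergence. $P_{v,r}$ is multiplication by the characteristic function of $B_r(v)$, viewed as a map to $\ell^2(B_r(v))$ (embedded in $\ell^2(G)$ by extension by zero), and $H_{v,r}=P_{v,r}HP_{v,r}$ on $\ell^2(B_r(v))$. For a bijection $\eta:A\to B$ of finite sets, $\mathcal{I}_\eta:\ell^2(A)\to\ell^2(B)$ is the isomorphism with $\mathcal{I}_\eta(\delta_a)=\delta_{\eta(a)}$. A family of maps $f_r:B_r(v)\to B_r(v')$, $r\in\{0,1,2,\dots\}$, is coherent if $f_s|_{B_r(v)}=f_r$ for all $s>r$ (in particular $f_r(v)=v'$). Let $H_n$ be Schrödinger operators on connected rooted $d$-bounded graphs $(G_n,v_n)$ and $H'$ a Schrödinger operator on a connected rooted graph $(G',v_0')$. Then $\{(H_n,G_n,v_n)\}_n$ converges to $(H',G',v_0')$ if: (C1) for each $n$ there are coherent maps $f_{n,r}:B_r(v_n)\to B_r(v_0')$ such that for every $r$ there is $N_r$ such that $f_{n,r}$ is a graph isomorphism for all $n\ge N_r$; and (C2) for each $r$, $\lim_{n\to\infty}\|\mathcal{I}_{f_{n,r}}P_{v_n,r}H_nP_{v_n,r}\mathcal{I}_{f_{n,r}}^{-1}-H'_{v_0',r}\|=0$.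 $\mathcal{R}$-limits. A Schrödinger operator $H'$ on a graph $G'$ is an $\mathcal{R}$-limit of a Schrödinger operator $H$ on $G$ if there are a vertex $v_0'\in V(G')$ and a sequence $v_n\in V(G)$ with $\mathrm{dist}(v_0,v_n)\to\infty$ monotonically such that $\{(H,G,v_n)\}_n$ converges to $(H',G',v_0')$. $\mathcal{R}(H)$ is the set of all $\mathcal{R}$-limits of $H$. *)

theory Defs
  imports "HOL-Analysis.Analysis"
begin

section \<open>Graphs\<close>

record 'v ugraph =
  verts :: "'v set"
  edges :: "'v set set"

definition graph :: "'v ugraph \<Rightarrow> bool" where
  "graph G \<longleftrightarrow> countable (verts G) \<and>
     (\<forall>e \<in> edges G. \<exists>u\<in>verts G. \<exists>v\<in>verts G. u \<noteq> v \<and> e = {u, v})"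

definition adj :: "'v ugraph \<Rightarrow> 'v \<Rightarrow> 'v \<Rightarrow> bool" where
  "adj G u v \<longleftrightarrow> {u, v} \<in> edges G"

definition nbrs :: "'v ugraph \<Rightarrow> 'v \<Rightarrow> 'v set" where
  "nbrs G v = {u. adj G u v}"

text \<open>Finiteness is required separately because the cardinality of an infinite set is 0.\<close>

definition degree_le :: "nat \<Rightarrow> 'v ugraph \<Rightarrow> bool" where
  "degree_le d G \<longleftrightarrow> (\<forall>v\<in>verts G. finite (nbrs G v) \<and> card (nbrs G v) \<le> d)"

definition rooted_bounded_graph :: "nat \<Rightarrow> 'v ugraph \<Rightarrow> 'v \<Rightarrow> bool" where
  "rooted_bounded_graph d G v\<^sub>0 \<longleftrightarrow> graph G \<and> v\<^sub>0 \<in> verts G \<and> degree_le d G"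

definition connected_graph :: "'v ugraph \<Rightarrow> bool" where
  "connected_graph G \<longleftrightarrow> (\<forall>u\<in>verts G. \<forall>v\<in>verts G. (adj G)\<^sup>*\<^sup>* u v)"

text \<open>The distance is the least length of a walk; it is only meaningful (and only used) for
  vertices of a connected graph.\<close>

definition gdist :: "'v ugraph \<Rightarrow> 'v \<Rightarrow> 'v \<Rightarrow> nat" where
  "gdist G u v = (LEAST n. (adj G ^^ n) u v)"

definition gball :: "'v ugraph \<Rightarrow> 'v \<Rightarrow> nat \<Rightarrow> 'v set" where
  "gball G v r = {u \<in> verts G. gdist G u v \<le> r}"

definition induced :: "'v ugraph \<Rightarrow> 'v set \<Rightarrow> 'v ugraph" where
  "induced G S = \<lparr>verts = verts G \<inter> S, edges = {e \<in> edges G. e \<subseteq> S}\<rparr>"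

definition graph_iso :: "('v \<Rightarrow> 'w) \<Rightarrow> 'v ugraph \<Rightarrow> 'w ugraph \<Rightarrow> bool" where
  "graph_iso f G G' \<longleftrightarrow> bij_betw f (verts G) (verts G') \<and>
     (\<forall>u\<in>verts G. \<forall>v\<in>verts G. adj G u v \<longleftrightarrow> adj G' (f u) (f v))"

definition subexponential_growth :: "'v ugraph \<Rightarrow> 'v \<Rightarrow> bool" where
  "subexponential_growth G v\<^sub>0 \<longleftrightarrow>
     (\<forall>\<gamma>::real. \<gamma> > 1 \<longrightarrow> (\<exists>C>0. \<forall>r. real (card (gball G v\<^sub>0 r)) < C * \<gamma> ^ r))"


section \<open>Function spaces and operators\<close>

text \<open>A function on a vertex set \<open>V\<close> is represented by its extension by zero to the whole
  vertex type. So \<open>\<ell>\<^sup>2(S)\<close> is literally contained in \<open>\<ell>\<^sup>2(V)\<close> for \<open>S \<subseteq> V\<close>.\<close>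

definition functions_on :: "'v set \<Rightarrow> ('v \<Rightarrow> complex) set" where
  "functions_on V = {\<psi>. \<forall>v. v \<notin> V \<longrightarrow> \<psi> v = 0}"

definition ell2 :: "'v set \<Rightarrow> ('v \<Rightarrow> complex) set" where
  "ell2 V = {\<psi> \<in> functions_on V. (\<lambda>v. (cmod (\<psi> v))\<^sup>2) summable_on V}"

definition ell2_norm :: "'v set \<Rightarrow> ('v \<Rightarrow> complex) \<Rightarrow> real" where
  "ell2_norm V \<psi> = sqrt (\<Sum>\<^sub>\<infinity>v\<in>V. (cmod (\<psi> v))\<^sup>2)"

definition ell_infty :: "'v set \<Rightarrow> ('v \<Rightarrow> complex) set" where
  "ell_infty V = {\<psi> \<in> functions_on V. bounded (\<psi> ` V)}"

type_synonym 'v operator = "('v \<Rightarrow> complex) \<Rightarrow> ('v \<Rightarrow> complex)"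

definition bounded_operator :: "'v set \<Rightarrow> 'v operator \<Rightarrow> bool" where
  "bounded_operator V T \<longleftrightarrow>
     (\<forall>\<psi>\<in>ell2 V. T \<psi> \<in> ell2 V) \<and>
     (\<forall>\<phi>\<in>ell2 V. \<forall>\<psi>\<in>ell2 V. T (\<lambda>v. \<phi> v + \<psi> v) = (\<lambda>v. T \<phi> v + T \<psi> v)) \<and>
     (\<forall>c. \<forall>\<psi>\<in>ell2 V. T (\<lambda>v. c * \<psi> v) = (\<lambda>v. c * T \<psi> v)) \<and>
     (\<exists>K. \<forall>\<psi>\<in>ell2 V. ell2_norm V (T \<psi>) \<le> K * ell2_norm V \<psi>)"

definition op_norm :: "'v set \<Rightarrow> 'v operator \<Rightarrow> real" where
  "op_norm V T = Sup {ell2_norm V (T \<psi>) | \<psi>. \<psi> \<in> ell2 V \<and> ell2_norm V \<psi> \<le> 1}"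

definition resolvent_set :: "'v set \<Rightarrow> 'v operator \<Rightarrow> complex set" where
  "resolvent_set V H = {z. \<exists>R. bounded_operator V R \<and>
     (\<forall>\<psi>\<in>ell2 V. R (\<lambda>v. H \<psi> v - z * \<psi> v) = \<psi>) \<and>
     (\<forall>\<psi>\<in>ell2 V. (\<lambda>v. H (R \<psi>) v - z * R \<psi> v) = \<psi>)}"

definition spectrum :: "'v set \<Rightarrow> 'v operator \<Rightarrow> complex set" where
  "spectrum V H = - resolvent_set V H"

definition eigenspace :: "'v set \<Rightarrow> 'v operator \<Rightarrow> complex \<Rightarrow> ('v \<Rightarrow> complex) set" where
  "eigenspace V H z = {\<psi> \<in> ell2 V. H \<psi> = (\<lambda>v. z * \<psi> v)}"

definition eigenvalue :: "'v set \<Rightarrow> 'v operator \<Rightarrow> complex \<Rightarrow> bool" where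
  "eigenvalue V H z \<longleftrightarrow> (\<exists>\<psi>\<in>eigenspace V H z. \<psi> \<noteq> (\<lambda>v. 0))"

definition finite_dim :: "('v \<Rightarrow> complex) set \<Rightarrow> bool" where
  "finite_dim E \<longleftrightarrow>
     (\<exists>B. finite B \<and> B \<subseteq> E \<and> (\<forall>\<psi>\<in>E. \<exists>c. \<psi> = (\<lambda>v. \<Sum>b\<in>B. c b * b v)))"

definition discrete_spectrum :: "'v set \<Rightarrow> 'v operator \<Rightarrow> complex set" where
  "discrete_spectrum V H =
     {z. eigenvalue V H z \<and> z isolated_in spectrum V H \<and> finite_dim (eigenspace V H z)}"

definition essential_spectrum :: "'v set \<Rightarrow> 'v operator \<Rightarrow> complex set" where
  "essential_spectrum V H = spectrum V H - discrete_spectrum V H"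

definition generalized_eigenfunction ::
  "'v set \<Rightarrow> 'v operator \<Rightarrow> complex \<Rightarrow> ('v \<Rightarrow> complex) \<Rightarrow> bool" where
  "generalized_eigenfunction V H z \<psi> \<longleftrightarrow>
     \<psi> \<in> functions_on V \<and> \<psi> \<noteq> (\<lambda>v. 0) \<and> (\<forall>v\<in>V. H \<psi> v = z * \<psi> v)"

definition sigma_infty :: "'v set \<Rightarrow> 'v operator \<Rightarrow> complex set" where
  "sigma_infty V H = {z. \<exists>\<psi>\<in>ell_infty V. generalized_eigenfunction V H z \<psi>}"


section \<open>Schroedinger operators\<close>

definition schroedinger :: "'v ugraph \<Rightarrow> ('v \<Rightarrow> real) \<Rightarrow> 'v operator" where
  "schroedinger G W \<psi> v =
     (if v \<in> verts G
      then (\<Sum>u\<in>nbrs G v. \<psi> u - \<psi> v) + complex_of_real (W v) * \<psi> v else 0)"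

definition schroedinger_operator :: "'v ugraph \<Rightarrow> 'v operator \<Rightarrow> bool" where
  "schroedinger_operator G H \<longleftrightarrow>
     graph G \<and> connected_graph G \<and> (\<exists>d. degree_le d G) \<and>
     (\<exists>W. bounded (W ` verts G) \<and> H = schroedinger G W)"


section \<open>Convergence of rooted operators and limits at infinity\<close>

definition restrict_to :: "'v set \<Rightarrow> 'v operator" where
  "restrict_to S \<psi> = (\<lambda>v. if v \<in> S then \<psi> v else 0)"

definition ball_operator :: "'v operator \<Rightarrow> 'v ugraph \<Rightarrow> 'v \<Rightarrow> nat \<Rightarrow> 'v operator" where
  "ball_operator H G v r = restrict_to (gball G v r) \<circ> H \<circ> restrict_to (gball G v r)"

text \<open>\<open>transport A \<eta>\<close> is the linear map with \<open>\<delta>\<^sub>a \<mapsto> \<delta>\<^bsub>\<eta>(a)\<^esub>\<close> for \<open>a \<in> A\<close>.\<close>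

definition transport :: "'v set \<Rightarrow> ('v \<Rightarrow> 'w) \<Rightarrow> ('v \<Rightarrow> complex) \<Rightarrow> 'w \<Rightarrow> complex" where
  "transport A \<eta> \<psi> = (\<lambda>b. \<Sum>a\<in>A. \<psi> a * (if b = \<eta> a then 1 else 0))"

definition coherent ::
  "(nat \<Rightarrow> 'v \<Rightarrow> 'w) \<Rightarrow> 'v ugraph \<Rightarrow> 'v \<Rightarrow> 'w ugraph \<Rightarrow> 'w \<Rightarrow> bool" where
  "coherent f G v G' v' \<longleftrightarrow>
     (\<forall>r. f r \<in> gball G v r \<rightarrow> gball G' v' r) \<and>
     (\<forall>r s. r < s \<longrightarrow> (\<forall>u\<in>gball G v r. f s u = f r u))"

text \<open>In the last clause, the inverse of the transport along \<open>f n r\<close> is the transport along the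
  inverse map. This is correct when \<open>f n r\<close> is a bijection of the balls, hence for all
  \<open>n \<ge> N r\<close>; the remaining finitely many \<open>n\<close> do not affect the limit.\<close>

definition converges_to ::
  "(nat \<Rightarrow> 'v operator) \<Rightarrow> (nat \<Rightarrow> 'v ugraph) \<Rightarrow> (nat \<Rightarrow> 'v) \<Rightarrow>
   'w operator \<Rightarrow> 'w ugraph \<Rightarrow> 'w \<Rightarrow> bool" where
  "converges_to H G v H' G' v' \<longleftrightarrow>
     (\<exists>d. \<forall>n. rooted_bounded_graph d (G n) (v n)) \<and>
     (\<forall>n. schroedinger_operator (G n) (H n)) \<and>
     v' \<in> verts G' \<and> schroedinger_operator G' H' \<and>
     (\<exists>f. (\<forall>n. coherent (f n) (G n) (v n) G' v') \<and>
          (\<forall>r. \<exists>N. \<forall>n\<ge>N. graph_iso (f n r)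
             (induced (G n) (gball (G n) (v n) r)) (induced G' (gball G' v' r))) \<and>
          (\<forall>r. (\<lambda>n.
             let B = gball (G n) (v n) r; B' = gball G' v' r in
             op_norm B' (\<lambda>\<psi> b.
               transport B (f n r)
                 (ball_operator (H n) (G n) (v n) r
                   (transport B' (inv_into B (f n r)) \<psi>)) b
               - ball_operator H' G' v' r \<psi> b)) \<longlonglongrightarrow> 0))"

definition R_limit ::
  "'v ugraph \<Rightarrow> 'v \<Rightarrow> 'v operator \<Rightarrow> 'w ugraph \<Rightarrow> 'w operator \<Rightarrow> bool" where
  "R_limit G v\<^sub>0 H G' H' \<longleftrightarrow> schroedinger_operator G' H' \<and>
     (\<exists>v'\<in>verts G'. \<exists>v :: nat \<Rightarrow> 'v.
        (\<forall>n. v n \<in> verts G) \<and>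
        mono (\<lambda>n. gdist G v\<^sub>0 (v n)) \<and>
        filterlim (\<lambda>n. gdist G v\<^sub>0 (v n)) at_top sequentially \<and>
        converges_to (\<lambda>n. H) (\<lambda>n. G) v H' G' v')"

text \<open>The limit operators live on graphs of their own, so an element of the set of
  \<open>\<R>\<close>-limits is a pair of a graph and an operator on it. As graphs are countable, vertex sets
  \<open>\<subseteq> \<nat>\<close> represent all of them up to isomorphism.\<close>

definition R_limits :: "'v ugraph \<Rightarrow> 'v \<Rightarrow> 'v operator \<Rightarrow> (nat ugraph \<times> nat operator) set" where
  "R_limits G v\<^sub>0 H = {(G', H'). R_limit G v\<^sub>0 H G' H'}"

end

(*
  Suppose that lam is real and that no limit operator has a bounded generalized eigenfunction with
  eigenvalue lam. By compactness of the space of rooted graphs with potentials and functions, there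
  is a radius R such that far from the root every function phi that almost solves H phi = lam phi
  satisfies |phi(v)| <= 1/2 sup |phi|, where the supremum is over the ball of radius R around v.
  Hence bounded solutions near infinity decay exponentially, and because of the sub-exponential
  growth they are square-summable.

  Let F be a large finite ball and A = H - lam - i 1_F. A bounded solution of A phi = 0 is
  square-summable, so it vanishes on F (take imaginary parts) and then everywhere. By compactness A
  is bounded below in the supremum norm. As the growth is not uniform in the base point, the decay
  does not give bounds in l^2 directly; instead, the supremum bound says that the row sums of the
  Green function of A (with a small further imaginary shift) are bounded, the Green function is
  symmetric, and Schur's test yields ||phi|| <= C (||(H - lam) phi|| + ||1_F phi||) on l^2.
  This estimate excludes lam from the essential spectrum.
*)

theory Submission
  imports Defs "HOL-Complex_Analysis.Great_Picard"
begin

section \<open>Square-summable functions\<close>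

text \<open>Even if no limit operator sees lam, it may still be an isolated eigenvalue of H, so no
  lower bound for H - lam alone can be expected; hence the finite-rank perturbation. Being imaginary
  and of one sign, it turns the imaginary part of the quadratic form into the mass on F, and in the
  end it costs only the term \<open>restrict_to F\<close>, which compactness on a finite set can
  handle. A complex potential destroys self-adjointness but keeps the matrix symmetric, which is why
  the pairing is bilinear. The further shift makes i times the operator coercive, so that the Green
  function exists in l^2; it is small against the constant of the contraction in the supremum norm,
  so that it can be absorbed there and once more in the final estimate. In the local statement one
  integer k serves as distance from the root, as radius and as reciprocal precision. If the
  statement fails for every k, the counterexamples form the sequence from which a limit operator is
  extracted; if it holds for one k, the estimates start from there.\<close>

lemma ell2_functions_on: "\<phi> \<in> ell2 V \<Longrightarrow> \<phi> \<in> functions_on V"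
  by (simp add: ell2_def)

lemma ell2_norm_nonneg [simp]: "0 \<le> ell2_norm V \<phi>"
  by (simp add: ell2_norm_def infsum_nonneg)

lemma L2_set_le_ell2_norm:
  assumes "\<phi> \<in> ell2 V" "finite S" "S \<subseteq> V"
  shows "L2_set (\<lambda>v. cmod (\<phi> v)) S \<le> ell2_norm V \<phi>"
  unfolding L2_set_def ell2_norm_def
  by (rule real_sqrt_le_mono, rule finite_sum_le_infsum) (use assms in \<open>auto simp: ell2_def\<close>)

text \<open>Finite subsets test both membership and norm, so the inequalities in l^2 below reduce to
  inequalities for \<open>L2_set\<close>.\<close>

lemma ell2I:
  assumes "\<phi> \<in> functions_on V"
    and "\<And>S. finite S \<Longrightarrow> S \<subseteq> V \<Longrightarrow> L2_set (\<lambda>v. cmod (\<phi> v)) S \<le> K"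
  shows "\<phi> \<in> ell2 V" "ell2_norm V \<phi> \<le> K"
proof -
  have K: "0 \<le> K"
    using assms(2)[of "{}"] by simp
  have le: "(\<Sum>v\<in>S. (cmod (\<phi> v))\<^sup>2) \<le> K\<^sup>2" if "finite S" "S \<subseteq> V" for S
    using assms(2)[OF that] K unfolding L2_set_def
    by (metis real_sqrt_le_iff real_sqrt_abs abs_of_nonneg)
  have "(\<lambda>v. (cmod (\<phi> v))\<^sup>2) summable_on V"
    by (rule nonneg_bdd_above_summable_on) (auto intro!: bdd_aboveI2[where M="K\<^sup>2"] le)
  then show "\<phi> \<in> ell2 V"
    using assms(1) by (simp add: ell2_def)
  have "(\<Sum>\<^sub>\<infinity>v\<in>V. (cmod (\<phi> v))\<^sup>2) \<le> K\<^sup>2"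
    by (rule infsum_le_finite_sums) (use le \<open>_ summable_on V\<close> in auto)
  then show "ell2_norm V \<phi> \<le> K"
    unfolding ell2_norm_def using K by (metis real_sqrt_le_iff real_sqrt_abs abs_of_nonneg)
qed

lemma norm_le_ell2_norm:
  assumes "\<phi> \<in> ell2 V"
  shows "cmod (\<phi> v) \<le> ell2_norm V \<phi>"
proof (cases "v \<in> V")
  case True
  then show ?thesis
    using L2_set_le_ell2_norm[OF assms, of "{v}"] by simp
next
  case False
  then show ?thesis
    using ell2_functions_on[OF assms] by (simp add: functions_on_def)
qed

lemma ell2_norm_eq_0D:
  assumes "\<phi> \<in> ell2 V" "ell2_norm V \<phi> \<le> 0"
  shows "\<phi> = (\<lambda>v. 0)"
proof
  fix v
  show "\<phi> v = 0"
    using norm_le_ell2_norm[OF assms(1), of v] assms(2) by (metis norm_le_zero_iff order_trans)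
qed

lemma ell2_finite_support:
  assumes "finite S" "S \<subseteq> V" "\<And>v. v \<notin> S \<Longrightarrow> \<phi> v = 0"
  shows "\<phi> \<in> ell2 V" "ell2_norm V \<phi> = L2_set (\<lambda>v. cmod (\<phi> v)) S"
proof -
  have f: "\<phi> \<in> functions_on V"
    using assms by (auto simp: functions_on_def)
  have le: "L2_set (\<lambda>v. cmod (\<phi> v)) T \<le> L2_set (\<lambda>v. cmod (\<phi> v)) S" if "finite T" for T
    unfolding L2_set_def
  proof (rule real_sqrt_le_mono)
    have "(\<Sum>v\<in>T. (cmod (\<phi> v))\<^sup>2) = (\<Sum>v\<in>T \<inter> S. (cmod (\<phi> v))\<^sup>2)"
      by (rule sum.mono_neutral_right) (use that assms(3) in auto)
    also have "\<dots> \<le> (\<Sum>v\<in>S. (cmod (\<phi> v))\<^sup>2)"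
      by (rule sum_mono2) (use assms(1) in auto)
    finally show "(\<Sum>v\<in>T. (cmod (\<phi> v))\<^sup>2) \<le> (\<Sum>v\<in>S. (cmod (\<phi> v))\<^sup>2)" .
  qed
  show *: "\<phi> \<in> ell2 V"
    by (rule ell2I(1)[OF f le])
  show "ell2_norm V \<phi> = L2_set (\<lambda>v. cmod (\<phi> v)) S"
    using ell2I(2)[OF f le] L2_set_le_ell2_norm[OF * assms(1,2)] by auto
qed

lemma ell2_zero [simp]: "(\<lambda>v. 0) \<in> ell2 V" "ell2_norm V (\<lambda>v. 0) = 0"
  using ell2_finite_support[of "{}" V "\<lambda>v. 0"] by auto

lemma ell2_dominated:
  assumes "\<phi> \<in> ell2 V" "\<psi> \<in> functions_on V" "0 \<le> c"
    and "\<And>v. v \<in> V \<Longrightarrow> cmod (\<psi> v) \<le> c * cmod (\<phi> v)"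
  shows "\<psi> \<in> ell2 V" "ell2_norm V \<psi> \<le> c * ell2_norm V \<phi>"
proof -
  have "L2_set (\<lambda>v. cmod (\<psi> v)) S \<le> c * ell2_norm V \<phi>" if "finite S" "S \<subseteq> V" for S
  proof -
    have "L2_set (\<lambda>v. cmod (\<psi> v)) S \<le> L2_set (\<lambda>v. c * cmod (\<phi> v)) S"
      by (rule L2_set_mono) (use assms(4) that in auto)
    also have "\<dots> = c * L2_set (\<lambda>v. cmod (\<phi> v)) S"
      using L2_set_right_distrib[OF assms(3)] by metis
    also have "\<dots> \<le> c * ell2_norm V \<phi>"
      by (intro mult_left_mono L2_set_le_ell2_norm assms that)
    finally show ?thesis .
  qed
  then show "\<psi> \<in> ell2 V" "ell2_norm V \<psi> \<le> c * ell2_norm V \<phi>"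
    using ell2I[OF assms(2)] by blast+
qed

lemma ell2_add:
  assumes "\<phi> \<in> ell2 V" "\<psi> \<in> ell2 V"
  shows "(\<lambda>v. \<phi> v + \<psi> v) \<in> ell2 V"
    "ell2_norm V (\<lambda>v. \<phi> v + \<psi> v) \<le> ell2_norm V \<phi> + ell2_norm V \<psi>"
proof -
  have f: "(\<lambda>v. \<phi> v + \<psi> v) \<in> functions_on V"
    using assms[THEN ell2_functions_on] by (auto simp: functions_on_def)
  have "L2_set (\<lambda>v. cmod (\<phi> v + \<psi> v)) S \<le> ell2_norm V \<phi> + ell2_norm V \<psi>"
    if "finite S" "S \<subseteq> V" for S
  proof -
    have "L2_set (\<lambda>v. cmod (\<phi> v + \<psi> v)) S \<le> L2_set (\<lambda>v. cmod (\<phi> v) + cmod (\<psi> v)) S"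
      by (rule L2_set_mono) (auto intro: norm_triangle_ineq)
    also have "\<dots> \<le> L2_set (\<lambda>v. cmod (\<phi> v)) S + L2_set (\<lambda>v. cmod (\<psi> v)) S"
      by (rule L2_set_triangle_ineq)
    also have "\<dots> \<le> ell2_norm V \<phi> + ell2_norm V \<psi>"
      by (intro add_mono L2_set_le_ell2_norm assms that)
    finally show ?thesis .
  qed
  then show "(\<lambda>v. \<phi> v + \<psi> v) \<in> ell2 V"
    "ell2_norm V (\<lambda>v. \<phi> v + \<psi> v) \<le> ell2_norm V \<phi> + ell2_norm V \<psi>"
    using ell2I[OF f] by blast+
qed

lemma ell2_scale:
  assumes "\<phi> \<in> ell2 V"
  shows "(\<lambda>v. c * \<phi> v) \<in> ell2 V" "ell2_norm V (\<lambda>v. c * \<phi> v) = cmod c * ell2_norm V \<phi>"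
proof -
  have f: "(\<lambda>v. c * \<phi> v) \<in> functions_on V" if "\<phi> \<in> functions_on V" for c \<phi>
    using that by (auto simp: functions_on_def)
  have *: "(\<lambda>v. c * \<phi> v) \<in> ell2 V" "ell2_norm V (\<lambda>v. c * \<phi> v) \<le> cmod c * ell2_norm V \<phi>"
    if "\<phi> \<in> ell2 V" for c \<phi>
    using ell2_dominated[OF that f[OF ell2_functions_on[OF that]], of "cmod c"]
    by (simp_all add: norm_mult)
  show "(\<lambda>v. c * \<phi> v) \<in> ell2 V"
    by (rule *[OF assms])
  show "ell2_norm V (\<lambda>v. c * \<phi> v) = cmod c * ell2_norm V \<phi>"
  proof (cases "c = 0")
    case False
    \<comment> \<open>The reverse inequality is the bound already proved, applied to the scalar
      \<open>inverse c\<close>.\<close>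
    have "ell2_norm V (\<lambda>v. inverse c * (c * \<phi> v)) \<le> cmod (inverse c) * ell2_norm V (\<lambda>v. c * \<phi> v)"
      by (rule *(2)[OF *(1)[OF assms]])
    also have "(\<lambda>v. inverse c * (c * \<phi> v)) = \<phi>"
      using False by auto
    finally have "cmod c * ell2_norm V \<phi> \<le> ell2_norm V (\<lambda>v. c * \<phi> v)"
      using False by (simp add: norm_divide field_simps)
    with *(2)[OF assms] show ?thesis
      by (rule order_antisym[OF _ _])
  qed auto
qed

lemma ell2_diff:
  assumes "\<phi> \<in> ell2 V" "\<psi> \<in> ell2 V"
  shows "(\<lambda>v. \<phi> v - \<psi> v) \<in> ell2 V"
    "ell2_norm V (\<lambda>v. \<phi> v - \<psi> v) \<le> ell2_norm V \<phi> + ell2_norm V \<psi>"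
  using ell2_add[OF assms(1) ell2_scale(1)[OF assms(2), of "-1"]] ell2_scale(2)[OF assms(2), of "-1"]
  by simp_all

lemma ell2_norm_le_add:
  assumes "\<And>v. \<phi> v = \<psi> v + \<xi> v" "\<psi> \<in> ell2 V" "\<xi> \<in> ell2 V"
  shows "\<phi> \<in> ell2 V" "ell2_norm V \<phi> \<le> ell2_norm V \<psi> + ell2_norm V \<xi>"
proof -
  have "\<phi> = (\<lambda>v. \<psi> v + \<xi> v)"
    using assms(1) by auto
  then show "\<phi> \<in> ell2 V" "ell2_norm V \<phi> \<le> ell2_norm V \<psi> + ell2_norm V \<xi>"
    using ell2_add[OF assms(2,3)] by auto
qed

lemma ell2_cnj:
  assumes "\<phi> \<in> ell2 V"
  shows "(\<lambda>v. cnj (\<phi> v)) \<in> ell2 V" "ell2_norm V (\<lambda>v. cnj (\<phi> v)) = ell2_norm V \<phi>"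
  using assms by (auto simp: ell2_def ell2_norm_def functions_on_def)

lemma ell2_restrict:
  assumes "\<phi> \<in> ell2 V"
  shows "restrict_to S \<phi> \<in> ell2 V" "ell2_norm V (restrict_to S \<phi>) \<le> ell2_norm V \<phi>"
  using ell2_dominated[OF assms, of "restrict_to S \<phi>" 1] ell2_functions_on[OF assms]
  by (auto simp: restrict_to_def functions_on_def)

text \<open>Fatou's lemma, which replaces completeness in all limit arguments below.\<close>

lemma ell2_pointwise_limit:
  assumes "\<And>n. s n \<in> ell2 V" "\<And>n. ell2_norm V (s n) \<le> K"
    and lim: "\<And>v. (\<lambda>n. s n v) \<longlonglongrightarrow> \<phi> v"
  shows "\<phi> \<in> ell2 V" "ell2_norm V \<phi> \<le> K"
proof -
  have f: "\<phi> \<in> functions_on V"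
    unfolding functions_on_def
  proof safe
    fix v assume "v \<notin> V"
    then have "(\<lambda>n. s n v) = (\<lambda>n. 0)"
      using assms(1)[THEN ell2_functions_on] by (auto simp: functions_on_def)
    then show "\<phi> v = 0"
      using lim[of v] by (simp add: LIMSEQ_const_iff)
  qed
  have "L2_set (\<lambda>v. cmod (\<phi> v)) S \<le> K" if "finite S" "S \<subseteq> V" for S
  proof (rule LIMSEQ_le_const2)
    show "(\<lambda>n. L2_set (\<lambda>v. cmod (s n v)) S) \<longlonglongrightarrow> L2_set (\<lambda>v. cmod (\<phi> v)) S"
      unfolding L2_set_def by (intro tendsto_intros lim)
    show "\<exists>N. \<forall>n\<ge>N. L2_set (\<lambda>v. cmod (s n v)) S \<le> K"
      using L2_set_le_ell2_norm[OF assms(1) that] assms(2) order_trans by blast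
  qed
  then show "\<phi> \<in> ell2 V" "ell2_norm V \<phi> \<le> K"
    using ell2I[OF f] by blast+
qed

text \<open>This stands in for weak compactness of bounded sets: the diagonal argument
  \<open>function_convergent_subsequence\<close> works on the countable set V, and outside V all
  functions vanish.\<close>

lemma pointwise_convergent_subsequence:
  fixes s :: "nat \<Rightarrow> 'v \<Rightarrow> complex"
  assumes "countable V" "\<And>n. s n \<in> functions_on V" "\<And>n v. cmod (s n v) \<le> K"
  obtains r \<phi> where "strict_mono r" "\<phi> \<in> functions_on V" "\<And>v. (\<lambda>n. s (r n) v) \<longlonglongrightarrow> \<phi> v"
proof -
  obtain r where r: "strict_mono (r :: nat \<Rightarrow> nat)"
    and ex: "\<And>v. v \<in> V \<Longrightarrow> \<exists>l. (\<lambda>n. s (r n) v) \<longlonglongrightarrow> l"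
    using function_convergent_subsequence[of V s K] assms by blast
  from ex obtain l where l: "\<And>v. v \<in> V \<Longrightarrow> (\<lambda>n. s (r n) v) \<longlonglongrightarrow> l v"
    by metis
  have "(\<lambda>n. s (r n) v) \<longlonglongrightarrow> (if v \<in> V then l v else 0)" for v
    using l[of v] assms(2) by (auto simp: functions_on_def)
  then show thesis
    using that[OF r, of "\<lambda>v. if v \<in> V then l v else 0"] by (simp add: functions_on_def)
qed


section \<open>The bilinear pairing\<close>

text \<open>No conjugate occurs: a symmetric matrix with complex entries, such as H plus an
  imaginary potential, is symmetric for this form although it is not self-adjoint. The inner product
  is recovered by inserting \<open>cnj\<close> in the second argument.\<close>

definition pairing :: "'v set \<Rightarrow> ('v \<Rightarrow> complex) \<Rightarrow> ('v \<Rightarrow> complex) \<Rightarrow> complex" where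
  "pairing V \<phi> \<psi> = (\<Sum>\<^sub>\<infinity>v\<in>V. \<phi> v * \<psi> v)"

lemma pairing_sum_bound:
  assumes "\<phi> \<in> ell2 V" "\<psi> \<in> ell2 V" "finite S" "S \<subseteq> V"
  shows "(\<Sum>v\<in>S. cmod (\<phi> v * \<psi> v)) \<le> ell2_norm V \<phi> * ell2_norm V \<psi>"
proof -
  have "(\<Sum>v\<in>S. cmod (\<phi> v * \<psi> v)) \<le> L2_set (\<lambda>v. cmod (\<phi> v)) S * L2_set (\<lambda>v. cmod (\<psi> v)) S"
    using L2_set_mult_ineq[of "\<lambda>v. cmod (\<phi> v)" "\<lambda>v. cmod (\<psi> v)" S] by (simp add: norm_mult)
  also have "\<dots> \<le> ell2_norm V \<phi> * ell2_norm V \<psi>"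
    by (intro mult_mono L2_set_le_ell2_norm assms) auto
  finally show ?thesis .
qed

lemma pairing_abs_summable:
  assumes "\<phi> \<in> ell2 V" "\<psi> \<in> ell2 V"
  shows "(\<lambda>v. cmod (\<phi> v * \<psi> v)) summable_on V"
  unfolding Infinite_Sum.abs_summable_iff_bdd_above
  by (rule bdd_aboveI2[where M="ell2_norm V \<phi> * ell2_norm V \<psi>"])
     (use pairing_sum_bound[OF assms] in auto)

lemma pairing_summable:
  assumes "\<phi> \<in> ell2 V" "\<psi> \<in> ell2 V"
  shows "(\<lambda>v. \<phi> v * \<psi> v) summable_on V"
  by (rule abs_summable_summable[OF pairing_abs_summable[OF assms]])

lemma pairing_Cauchy_Schwarz:
  assumes "\<phi> \<in> ell2 V" "\<psi> \<in> ell2 V"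
  shows "cmod (pairing V \<phi> \<psi>) \<le> ell2_norm V \<phi> * ell2_norm V \<psi>"
proof -
  have "cmod (pairing V \<phi> \<psi>) \<le> (\<Sum>\<^sub>\<infinity>v\<in>V. cmod (\<phi> v * \<psi> v))"
    unfolding pairing_def using pairing_abs_summable[OF assms] by (rule norm_infsum_bound)
  also have "\<dots> \<le> ell2_norm V \<phi> * ell2_norm V \<psi>"
    by (rule infsum_le_finite_sums[OF pairing_abs_summable[OF assms] pairing_sum_bound[OF assms]])
  finally show ?thesis .
qed

lemma pairing_commute: "pairing V \<phi> \<psi> = pairing V \<psi> \<phi>"
  by (simp add: pairing_def mult.commute)

lemma pairing_add_left:
  assumes "\<phi> \<in> ell2 V" "\<xi> \<in> ell2 V" "\<psi> \<in> ell2 V"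
  shows "pairing V (\<lambda>v. \<phi> v + \<xi> v) \<psi> = pairing V \<phi> \<psi> + pairing V \<xi> \<psi>"
  unfolding pairing_def using assms by (simp add: ring_distribs infsum_add pairing_summable)

lemma pairing_scale_left: "pairing V (\<lambda>v. c * \<phi> v) \<psi> = c * pairing V \<phi> \<psi>"
  unfolding pairing_def by (simp add: mult.assoc infsum_cmult_right')

lemma pairing_diff_left:
  assumes "\<phi> \<in> ell2 V" "\<xi> \<in> ell2 V" "\<psi> \<in> ell2 V"
  shows "pairing V (\<lambda>v. \<phi> v - \<xi> v) \<psi> = pairing V \<phi> \<psi> - pairing V \<xi> \<psi>"
  using pairing_add_left[OF assms(1) ell2_scale(1)[OF assms(2), of "-1"] assms(3)]
    pairing_scale_left[of V "-1" \<xi> \<psi>] by simp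

lemma pairing_restrict_commute: "pairing V (restrict_to S \<phi>) \<psi> = pairing V \<phi> (restrict_to S \<psi>)"
  unfolding pairing_def restrict_to_def by (rule infsum_cong) auto

lemma pairing_cnj: "pairing V (\<lambda>v. cnj (\<phi> v)) (\<lambda>v. cnj (\<psi> v)) = cnj (pairing V \<phi> \<psi>)"
  unfolding pairing_def by (simp flip: infsum_cnj)

lemma pairing_self:
  assumes "\<phi> \<in> ell2 V"
  shows "pairing V \<phi> (\<lambda>v. cnj (\<phi> v)) = complex_of_real ((ell2_norm V \<phi>)\<^sup>2)"
proof -
  have "pairing V \<phi> (\<lambda>v. cnj (\<phi> v)) = (\<Sum>\<^sub>\<infinity>v\<in>V. complex_of_real ((cmod (\<phi> v))\<^sup>2))"
    unfolding pairing_def by (simp add: complex_norm_square del: of_real_power)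
  also have "\<dots> = complex_of_real (\<Sum>\<^sub>\<infinity>v\<in>V. (cmod (\<phi> v))\<^sup>2)"
    by (intro infsumI has_sum_of_real has_sum_infsum) (use assms in \<open>simp add: ell2_def\<close>)
  also have "(\<Sum>\<^sub>\<infinity>v\<in>V. (cmod (\<phi> v))\<^sup>2) = (ell2_norm V \<phi>)\<^sup>2"
    unfolding ell2_norm_def by (simp add: infsum_nonneg)
  finally show ?thesis .
qed

lemma pairing_restrict_self:
  assumes "\<phi> \<in> ell2 V"
  shows "pairing V (restrict_to S \<phi>) (\<lambda>v. cnj (\<phi> v)) = complex_of_real ((ell2_norm V (restrict_to S \<phi>))\<^sup>2)"
proof -
  have "pairing V (restrict_to S \<phi>) (\<lambda>v. cnj (\<phi> v))
      = pairing V (restrict_to S \<phi>) (\<lambda>v. cnj (restrict_to S \<phi> v))"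
    unfolding pairing_def restrict_to_def by (rule infsum_cong) auto
  then show ?thesis
    using pairing_self[OF ell2_restrict(1)[OF assms]] by simp
qed

section \<open>Solving linear equations\<close>

text \<open>The last clause holds for operators whose matrix has finite rows. It lets equations pass
  to pointwise limits, so that no weak topology on the function space is needed.\<close>

definition regular_operator :: "'v set \<Rightarrow> 'v operator \<Rightarrow> bool" where
  "regular_operator V T \<longleftrightarrow>
     (\<forall>a b \<phi> \<psi>. T (\<lambda>v. a * \<phi> v + b * \<psi> v) = (\<lambda>v. a * T \<phi> v + b * T \<psi> v)) \<and>
     (\<exists>K. \<forall>\<phi>\<in>ell2 V. T \<phi> \<in> ell2 V \<and> ell2_norm V (T \<phi>) \<le> K * ell2_norm V \<phi>) \<and>
     (\<forall>s \<phi>. (\<forall>v. (\<lambda>n. s n v) \<longlonglongrightarrow> \<phi> v) \<longrightarrow> (\<forall>v. (\<lambda>n::nat. T (s n) v) \<longlonglongrightarrow> T \<phi> v))"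

lemma regular_operator_linear:
  "regular_operator V T \<Longrightarrow> T (\<lambda>v. a * \<phi> v + b * \<psi> v) = (\<lambda>v. a * T \<phi> v + b * T \<psi> v)"
  by (simp add: regular_operator_def)

lemma regular_operator_diff:
  assumes "regular_operator V T"
  shows "T (\<lambda>v. \<phi> v - \<psi> v) = (\<lambda>v. T \<phi> v - T \<psi> v)"
  using regular_operator_linear[OF assms, of 1 \<phi> "-1" \<psi>] by simp

lemma regular_operator_scale:
  assumes "regular_operator V T"
  shows "T (\<lambda>v. a * \<phi> v) = (\<lambda>v. a * T \<phi> v)"
  using regular_operator_linear[OF assms, of a \<phi> 0 \<phi>] by simp

lemma regular_operator_zero:
  assumes "regular_operator V T"
  shows "T (\<lambda>v. 0) = (\<lambda>v. 0)"
  using regular_operator_scale[OF assms, of 0 "\<lambda>v. 0"] by simp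

lemma regular_operator_ell2: "regular_operator V T \<Longrightarrow> \<phi> \<in> ell2 V \<Longrightarrow> T \<phi> \<in> ell2 V"
  by (auto simp: regular_operator_def)

lemma regular_operator_bounded:
  assumes "regular_operator V T"
  obtains K where "K > 0" "\<And>\<phi>. \<phi> \<in> ell2 V \<Longrightarrow> ell2_norm V (T \<phi>) \<le> K * ell2_norm V \<phi>"
proof -
  obtain K where K: "\<And>\<phi>. \<phi> \<in> ell2 V \<Longrightarrow> ell2_norm V (T \<phi>) \<le> K * ell2_norm V \<phi>"
    using assms unfolding regular_operator_def by blast
  have "ell2_norm V (T \<phi>) \<le> max K 1 * ell2_norm V \<phi>" if "\<phi> \<in> ell2 V" for \<phi>
    using K[OF that] mult_right_mono[of K "max K 1" "ell2_norm V \<phi>"] by simp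
  then show thesis
    using that[of "max K 1"] by simp
qed

lemma regular_operator_tendsto:
  "regular_operator V T \<Longrightarrow> (\<And>v. (\<lambda>n. s n v) \<longlonglongrightarrow> \<phi> v) \<Longrightarrow> (\<lambda>n::nat. T (s n) v) \<longlonglongrightarrow> T \<phi> v"
  by (simp add: regular_operator_def)

lemma regular_operator_id: "regular_operator V (\<lambda>\<phi>. \<phi>)"
  unfolding regular_operator_def by (auto intro!: exI[of _ 1])

lemma regular_operator_restrict: "regular_operator V (restrict_to S)"
  unfolding regular_operator_def
proof (intro conjI exI[of _ 1] ballI allI impI)
  fix s :: "nat \<Rightarrow> 'a \<Rightarrow> complex" and \<phi> v
  assume "\<forall>v. (\<lambda>n. s n v) \<longlonglongrightarrow> \<phi> v"
  then show "(\<lambda>n. restrict_to S (s n) v) \<longlonglongrightarrow> restrict_to S \<phi> v"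
    by (simp add: restrict_to_def)
qed (auto simp: restrict_to_def[abs_def] ell2_restrict[unfolded restrict_to_def])

lemma regular_operator_combine:
  assumes T: "regular_operator V T" and S: "regular_operator V S"
  shows "regular_operator V (\<lambda>\<phi> v. a * T \<phi> v + b * S \<phi> v)"
  unfolding regular_operator_def
proof (intro conjI allI impI)
  show "(\<lambda>v. a * T (\<lambda>v. c * \<phi> v + e * \<psi> v) v + b * S (\<lambda>v. c * \<phi> v + e * \<psi> v) v) =
    (\<lambda>v. c * (a * T \<phi> v + b * S \<phi> v) + e * (a * T \<psi> v + b * S \<psi> v))" for c e \<phi> \<psi>
    by (simp add: regular_operator_linear[OF T] regular_operator_linear[OF S] algebra_simps)
  show "(\<lambda>n. a * T (s n) v + b * S (s n) v) \<longlonglongrightarrow> a * T \<phi> v + b * S \<phi> v"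
    if "\<forall>v. (\<lambda>n. s n v) \<longlonglongrightarrow> \<phi> v" for s \<phi> v
    by (intro tendsto_intros regular_operator_tendsto[OF T] regular_operator_tendsto[OF S])
       (use that in auto)
  obtain K where K: "\<And>\<phi>. \<phi> \<in> ell2 V \<Longrightarrow> ell2_norm V (T \<phi>) \<le> K * ell2_norm V \<phi>"
    using regular_operator_bounded[OF T] by metis
  obtain L where L: "\<And>\<phi>. \<phi> \<in> ell2 V \<Longrightarrow> ell2_norm V (S \<phi>) \<le> L * ell2_norm V \<phi>"
    using regular_operator_bounded[OF S] by metis
  show "\<exists>K. \<forall>\<phi>\<in>ell2 V. (\<lambda>v. a * T \<phi> v + b * S \<phi> v) \<in> ell2 V \<and>
    ell2_norm V (\<lambda>v. a * T \<phi> v + b * S \<phi> v) \<le> K * ell2_norm V \<phi>"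
  proof (intro exI ballI conjI)
    fix \<phi> assume \<phi>: "\<phi> \<in> ell2 V"
    note t = ell2_scale[OF regular_operator_ell2[OF T \<phi>], of a]
    note s = ell2_scale[OF regular_operator_ell2[OF S \<phi>], of b]
    show "(\<lambda>v. a * T \<phi> v + b * S \<phi> v) \<in> ell2 V"
      by (rule ell2_add(1)[OF t(1) s(1)])
    have "ell2_norm V (\<lambda>v. a * T \<phi> v + b * S \<phi> v)
        \<le> cmod a * ell2_norm V (T \<phi>) + cmod b * ell2_norm V (S \<phi>)"
      using ell2_add(2)[OF t(1) s(1)] unfolding t(2) s(2) .
    also have "\<dots> \<le> cmod a * (K * ell2_norm V \<phi>) + cmod b * (L * ell2_norm V \<phi>)"
      by (intro add_mono mult_left_mono K L \<phi>) auto
    finally show "ell2_norm V (\<lambda>v. a * T \<phi> v + b * S \<phi> v)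
        \<le> (cmod a * K + cmod b * L) * ell2_norm V \<phi>"
      by (simp add: algebra_simps)
  qed
qed

lemma regular_operator_compose:
  assumes T: "regular_operator V T" and S: "regular_operator V S"
  shows "regular_operator V (\<lambda>\<phi>. T (S \<phi>))"
  unfolding regular_operator_def
proof (intro conjI allI impI)
  show "T (S (\<lambda>v. c * \<phi> v + e * \<psi> v)) = (\<lambda>v. c * T (S \<phi>) v + e * T (S \<psi>) v)" for c e \<phi> \<psi>
    by (simp add: regular_operator_linear[OF T] regular_operator_linear[OF S])
  show "(\<lambda>n. T (S (s n)) v) \<longlonglongrightarrow> T (S \<phi>) v" if "\<forall>v. (\<lambda>n. s n v) \<longlonglongrightarrow> \<phi> v" for s \<phi> v
    by (intro regular_operator_tendsto[OF T] regular_operator_tendsto[OF S]) (use that in auto)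
  obtain K where K: "K > 0" "\<And>\<phi>. \<phi> \<in> ell2 V \<Longrightarrow> ell2_norm V (T \<phi>) \<le> K * ell2_norm V \<phi>"
    using regular_operator_bounded[OF T] by metis
  obtain L where L: "\<And>\<phi>. \<phi> \<in> ell2 V \<Longrightarrow> ell2_norm V (S \<phi>) \<le> L * ell2_norm V \<phi>"
    using regular_operator_bounded[OF S] by metis
  show "\<exists>K. \<forall>\<phi>\<in>ell2 V. T (S \<phi>) \<in> ell2 V \<and> ell2_norm V (T (S \<phi>)) \<le> K * ell2_norm V \<phi>"
  proof (intro exI ballI conjI)
    fix \<phi> assume \<phi>: "\<phi> \<in> ell2 V"
    note s = regular_operator_ell2[OF S \<phi>]
    show "T (S \<phi>) \<in> ell2 V"
      by (rule regular_operator_ell2[OF T s])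
    show "ell2_norm V (T (S \<phi>)) \<le> K * L * ell2_norm V \<phi>"
      using order_trans[OF K(2)[OF s] mult_left_mono[OF L[OF \<phi>] less_imp_le[OF K(1)]]]
      by (simp add: mult.assoc)
  qed
qed

text \<open>Expanding the inner product serves twice: for the contraction in
  \<open>Lax_Milgram\<close> and, with vanishing middle term, for orthogonal eigenvectors.\<close>

lemma ell2_norm_diff_square:
  assumes "\<phi> \<in> ell2 V" "\<psi> \<in> ell2 V"
  shows "(ell2_norm V (\<lambda>v. \<phi> v - \<psi> v))\<^sup>2 =
    (ell2_norm V \<phi>)\<^sup>2 - 2 * Re (pairing V \<psi> (\<lambda>v. cnj (\<phi> v))) + (ell2_norm V \<psi>)\<^sup>2"
proof -
  note c = ell2_cnj(1)[OF assms(1)] ell2_cnj(1)[OF assms(2)]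
  have "complex_of_real ((ell2_norm V (\<lambda>v. \<phi> v - \<psi> v))\<^sup>2) =
      pairing V (\<lambda>v. \<phi> v - \<psi> v) (\<lambda>v. cnj (\<phi> v) - cnj (\<psi> v))"
    using pairing_self[OF ell2_diff(1)[OF assms]] by simp
  also have "\<dots> = pairing V \<phi> (\<lambda>v. cnj (\<phi> v) - cnj (\<psi> v)) - pairing V \<psi> (\<lambda>v. cnj (\<phi> v) - cnj (\<psi> v))"
    by (rule pairing_diff_left[OF assms ell2_diff(1)[OF c]])
  also have "pairing V \<phi> (\<lambda>v. cnj (\<phi> v) - cnj (\<psi> v))
      = pairing V \<phi> (\<lambda>v. cnj (\<phi> v)) - pairing V \<phi> (\<lambda>v. cnj (\<psi> v))"
    unfolding pairing_commute[of V \<phi>] by (rule pairing_diff_left[OF c assms(1)])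
  also have "pairing V \<psi> (\<lambda>v. cnj (\<phi> v) - cnj (\<psi> v))
      = pairing V \<psi> (\<lambda>v. cnj (\<phi> v)) - pairing V \<psi> (\<lambda>v. cnj (\<psi> v))"
    unfolding pairing_commute[of V \<psi>] by (rule pairing_diff_left[OF c assms(2)])
  also have "pairing V \<phi> (\<lambda>v. cnj (\<psi> v)) = cnj (pairing V \<psi> (\<lambda>v. cnj (\<phi> v)))"
    using pairing_cnj[of V \<psi> "\<lambda>v. cnj (\<phi> v)"] pairing_commute[of V \<phi>] by simp
  finally have "complex_of_real ((ell2_norm V (\<lambda>v. \<phi> v - \<psi> v))\<^sup>2) =
    complex_of_real ((ell2_norm V \<phi>)\<^sup>2) - cnj (pairing V \<psi> (\<lambda>v. cnj (\<phi> v)))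
      - (pairing V \<psi> (\<lambda>v. cnj (\<phi> v)) - complex_of_real ((ell2_norm V \<psi>)\<^sup>2))"
    unfolding pairing_self[OF assms(1)] pairing_self[OF assms(2)] .
  from arg_cong[OF this, of Re] show ?thesis
    by simp
qed

text \<open>For small \<open>t\<close> the map \<open>\<phi> \<mapsto> \<phi> - t (T \<phi> - f)\<close> is a contraction.\<close>

theorem Lax_Milgram:
  assumes T: "regular_operator V T" and c: "c > 0"
    and coercive: "\<And>\<phi>. \<phi> \<in> ell2 V \<Longrightarrow> c * (ell2_norm V \<phi>)\<^sup>2 \<le> Re (pairing V (T \<phi>) (\<lambda>v. cnj (\<phi> v)))"
    and f: "f \<in> ell2 V"
  obtains \<phi> where "\<phi> \<in> ell2 V" "T \<phi> = f"
proof -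
  obtain K\<^sub>0 where K0: "\<And>\<phi>. \<phi> \<in> ell2 V \<Longrightarrow> ell2_norm V (T \<phi>) \<le> K\<^sub>0 * ell2_norm V \<phi>"
    using regular_operator_bounded[OF T] by metis
  \<comment> \<open>Enlarging the bound to at least \<open>c\<close> makes c / K \<le> 1, so that
    \<open>q\<close> below is the root of a nonnegative number.\<close>
  define K where "K = max K\<^sub>0 c"
  have K: "K > 0" "c \<le> K"
    using c by (auto simp: K_def)
  have TK: "ell2_norm V (T \<phi>) \<le> K * ell2_norm V \<phi>" if "\<phi> \<in> ell2 V" for \<phi>
    using K0[OF that] mult_right_mono[of K\<^sub>0 K "ell2_norm V \<phi>"] by (simp add: K_def)
  \<comment> \<open>This \<open>t\<close> minimises 1 - 2 t c + (t K)^2; the minimum is 1 - (c /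
    K)^2, the square of \<open>q\<close>.\<close>
  define t where "t = c / K\<^sup>2"
  define q where "q = sqrt (1 - (c / K)\<^sup>2)"
  have t: "t > 0"
    using c K by (simp add: t_def)
  have "c / K \<le> 1"
    using K by simp
  then have ck: "(c / K)\<^sup>2 \<le> 1"
    using c K by (simp add: power_le_one)
  have "0 < (c / K)\<^sup>2"
    using c K by simp
  then have q: "0 \<le> q" "q < 1" and q2: "q\<^sup>2 = 1 - (c / K)\<^sup>2"
    using ck by (auto simp: q_def real_sqrt_lt_1_iff)
  have contr: "ell2_norm V (\<lambda>v. \<phi> v - of_real t * T \<phi> v) \<le> q * ell2_norm V \<phi>"
    if \<phi>: "\<phi> \<in> ell2 V" for \<phi>
  proof (rule power2_le_imp_le)
    have T\<phi>: "T \<phi> \<in> ell2 V"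
      by (rule regular_operator_ell2[OF T \<phi>])
    have "(ell2_norm V (\<lambda>v. \<phi> v - of_real t * T \<phi> v))\<^sup>2 = (ell2_norm V \<phi>)\<^sup>2
        - 2 * t * Re (pairing V (T \<phi>) (\<lambda>v. cnj (\<phi> v))) + (t * ell2_norm V (T \<phi>))\<^sup>2"
      using ell2_norm_diff_square[OF \<phi> ell2_scale(1)[OF T\<phi>, of "of_real t"]] t
      by (simp add: pairing_scale_left ell2_scale(2)[OF T\<phi>])
    also have "\<dots> \<le> (ell2_norm V \<phi>)\<^sup>2 - 2 * t * (c * (ell2_norm V \<phi>)\<^sup>2) + (t * (K * ell2_norm V \<phi>))\<^sup>2"
      by (intro add_mono diff_mono mult_left_mono power_mono coercive \<phi> TK) (use t in auto)
    also have "\<dots> = (1 - 2 * t * c + (t * K)\<^sup>2) * (ell2_norm V \<phi>)\<^sup>2"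
      by (simp add: algebra_simps power2_eq_square)
    also have "1 - 2 * t * c + (t * K)\<^sup>2 = q\<^sup>2"
      using K unfolding q2 t_def by (simp add: power2_eq_square field_simps)
    finally show "(ell2_norm V (\<lambda>v. \<phi> v - of_real t * T \<phi> v))\<^sup>2 \<le> (q * ell2_norm V \<phi>)\<^sup>2"
      by (simp add: power_mult_distrib)
    show "0 \<le> q * ell2_norm V \<phi>"
      using q by simp
  qed
  define s where "s = rec_nat (\<lambda>v. 0) (\<lambda>n \<phi> v. \<phi> v - of_real t * (T \<phi> v - f v))"
  have s_0: "s 0 = (\<lambda>v. 0)" and s_Suc: "s (Suc n) = (\<lambda>v. s n v - of_real t * (T (s n) v - f v))" for n
    by (simp_all add: s_def)
  \<comment> \<open>The inhomogeneity \<open>f\<close> cancels in the increments of the iteration,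
    which therefore shrink by the factor \<open>q\<close> at each step.\<close>
  define D where "D n = (\<lambda>v. s (Suc n) v - s n v)" for n
  have D_0: "D 0 = (\<lambda>v. of_real t * f v)"
    by (simp add: D_def s_0 s_Suc regular_operator_zero[OF T])
  have D_Suc: "D (Suc n) = (\<lambda>v. D n v - of_real t * T (D n) v)" for n
    unfolding D_def regular_operator_diff[OF T] s_Suc[of "Suc n"] s_Suc[of n]
    by (auto simp: algebra_simps)
  define B where "B = ell2_norm V (D 0)"
  have D: "D n \<in> ell2 V \<and> ell2_norm V (D n) \<le> q ^ n * B" for n
  proof (induction n)
    case 0
    then show ?case
      using ell2_scale(1)[OF f] by (simp add: B_def D_0)
  next
    case (Suc n)
    then have Dn: "D n \<in> ell2 V"
      by blast
    have "ell2_norm V (D (Suc n)) \<le> q * ell2_norm V (D n)"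
      unfolding D_Suc by (rule contr[OF Dn])
    also have "\<dots> \<le> q * (q ^ n * B)"
      by (rule mult_left_mono) (use Suc q in auto)
    finally show ?case
      unfolding D_Suc using ell2_diff(1)[OF Dn ell2_scale(1)[OF regular_operator_ell2[OF T Dn]]]
      by (simp add: mult.assoc)
  qed
  have s_sum: "s n v = (\<Sum>i<n. D i v)" for n v
    by (induction n) (auto simp: s_0 D_def)
  have geo: "(\<Sum>i<n. q ^ i) \<le> 1 / (1 - q)" for n
    using q by (metis abs_of_nonneg real_norm_def sum_le_suminf suminf_geometric summable_geometric
        finite_lessThan zero_le_power)
  have s_ell2: "s n \<in> ell2 V \<and> ell2_norm V (s n) \<le> (\<Sum>i<n. q ^ i) * B" for n
  proof (induction n)
    case (Suc n)
    have eq: "s (Suc n) = (\<lambda>v. s n v + D n v)"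
      by (auto simp: D_def)
    show ?case
      unfolding eq using ell2_add[of "s n" V "D n"] Suc D[of n] by (auto simp: algebra_simps)
  qed (simp add: s_0)
  have B: "0 \<le> B"
    by (simp add: B_def)
  \<comment> \<open>Convergence at each vertex suffices: the uniform bound on the norms of
    \<open>s n\<close> puts the limit in l^2, and the regularity of \<open>T\<close> carries the
    fixed point equation over to it.\<close>
  have "summable (\<lambda>i. D i v)" for v
  proof (rule summable_comparison_test)
    have "cmod (D n v) \<le> q ^ n * B" for n
      using norm_le_ell2_norm[of "D n" V v] D[of n] by linarith
    then show "\<exists>N. \<forall>n\<ge>N. cmod (D n v) \<le> q ^ n * B"
      by blast
    show "summable (\<lambda>n. q ^ n * B)"
      using q by (intro summable_mult2 summable_geometric) auto
  qed
  then have lim: "(\<lambda>n. s n v) \<longlonglongrightarrow> (\<Sum>i. D i v)" for v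
    unfolding s_sum by (rule summable_LIMSEQ)
  define \<phi> where "\<phi> v = (\<Sum>i. D i v)" for v
  have lim: "(\<lambda>n. s n v) \<longlonglongrightarrow> \<phi> v" for v
    using lim by (simp add: \<phi>_def)
  have "ell2_norm V (s n) \<le> 1 / (1 - q) * B" for n
    using s_ell2[of n] mult_right_mono[OF geo[of n] B] by linarith
  then have \<phi>: "\<phi> \<in> ell2 V"
    using s_ell2 by (intro ell2_pointwise_limit(1)[OF _ _ lim]) auto
  have "T \<phi> v = f v" for v
  proof -
    have "(\<lambda>n. s (Suc n) v) \<longlonglongrightarrow> \<phi> v - of_real t * (T \<phi> v - f v)"
      unfolding s_Suc by (intro tendsto_intros lim regular_operator_tendsto[OF T])
    moreover have "(\<lambda>n. s (Suc n) v) \<longlonglongrightarrow> \<phi> v"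
      using lim by (rule LIMSEQ_Suc)
    ultimately have "\<phi> v - of_real t * (T \<phi> v - f v) = \<phi> v"
      by (rule LIMSEQ_unique)
    then show ?thesis
      using t by simp
  qed
  then show thesis
    using that[OF \<phi>] by auto
qed

section \<open>Schroedinger operators on square-summable functions\<close>

lemma adj_commute: "adj G u v \<longleftrightarrow> adj G v u"
  by (simp add: adj_def insert_commute)

lemma mem_nbrs_iff: "u \<in> nbrs G v \<longleftrightarrow> adj G u v"
  by (simp add: nbrs_def)

lemma adj_verts:
  assumes "graph G" "adj G u v"
  shows "u \<in> verts G" "v \<in> verts G"
  using assms unfolding graph_def adj_def by (metis doubleton_eq_iff)+

lemma nbrs_outside:
  assumes "graph G" "v \<notin> verts G"
  shows "nbrs G v = {}"
  using adj_verts(2)[OF assms(1)] assms(2) by (auto simp: nbrs_def)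

locale bounded_schroedinger =
  fixes G :: "'v ugraph" and W :: "'v \<Rightarrow> real" and d :: nat and M :: real
  assumes graph: "graph G" and connected: "connected_graph G"
    and degree: "degree_le d G" and W_bound: "v \<in> verts G \<Longrightarrow> \<bar>W v\<bar> \<le> M"
begin

abbreviation "V \<equiv> verts G"

abbreviation "H \<equiv> schroedinger G W"

lemma countable_verts: "countable V"
  using graph by (simp add: graph_def)

lemma nbrs_subset: "nbrs G v \<subseteq> V"
  using adj_verts(1)[OF graph] by (auto simp: nbrs_def)

lemma finite_nbrs: "finite (nbrs G v)"
  using degree nbrs_outside[OF graph, of v] by (cases "v \<in> V") (auto simp: degree_le_def)

lemma card_nbrs: "card (nbrs G v) \<le> d"
  using degree nbrs_outside[OF graph, of v] by (cases "v \<in> V") (auto simp: degree_le_def)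

definition adjacency_operator :: "('v \<Rightarrow> complex) \<Rightarrow> 'v \<Rightarrow> complex" where
  "adjacency_operator \<phi> v = (\<Sum>u\<in>nbrs G v. \<phi> u)"

text \<open>The value 0 outside V makes \<open>H_eq\<close> hold on the whole vertex type.\<close>

definition diagonal :: "'v \<Rightarrow> real" where
  "diagonal v = (if v \<in> V then W v - real (card (nbrs G v)) else 0)"

lemma H_eq: "H \<phi> v = adjacency_operator \<phi> v + of_real (diagonal v) * \<phi> v"
  by (simp add: schroedinger_def adjacency_operator_def diagonal_def nbrs_outside[OF graph]
      sum_subtractf algebra_simps)

lemma diagonal_bound: "\<bar>diagonal v\<bar> \<le> \<bar>M\<bar> + real d"
  using W_bound[of v] card_nbrs[of v] by (auto simp: diagonal_def)

text \<open>For the squared norm, Cauchy-Schwarz over at most d neighbours costs one factor d;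
  exchanging the sums counts each vertex at most d times and costs the other.\<close>

lemma adjacency_operator_ell2:
  assumes \<phi>: "\<phi> \<in> ell2 V"
  shows "adjacency_operator \<phi> \<in> ell2 V" "ell2_norm V (adjacency_operator \<phi>) \<le> d * ell2_norm V \<phi>"
proof -
  have f: "adjacency_operator \<phi> \<in> functions_on V"
    by (simp add: functions_on_def adjacency_operator_def nbrs_outside[OF graph])
  have "L2_set (\<lambda>v. cmod (adjacency_operator \<phi> v)) S \<le> d * ell2_norm V \<phi>"
    if S: "finite S" "S \<subseteq> V" for S
  proof -
    define U where "U = (\<Union>v\<in>S. nbrs G v)"
    have U: "finite U" "U \<subseteq> V"
      using S finite_nbrs nbrs_subset by (auto simp: U_def)
    have "(\<Sum>v\<in>S. (cmod (adjacency_operator \<phi> v))\<^sup>2) \<le> (\<Sum>v\<in>S. d * (\<Sum>u\<in>nbrs G v. (cmod (\<phi> u))\<^sup>2))"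
    proof (rule sum_mono)
      fix v
      have "(cmod (adjacency_operator \<phi> v))\<^sup>2 \<le> (\<Sum>u\<in>nbrs G v. cmod (\<phi> u))\<^sup>2"
        unfolding adjacency_operator_def by (intro power_mono norm_sum) auto
      also have "\<dots> \<le> (\<Sum>u\<in>nbrs G v. (cmod (\<phi> u))\<^sup>2) * card (nbrs G v)"
        by (rule sum_squared_le_sum_of_squares)
      also have "\<dots> \<le> (\<Sum>u\<in>nbrs G v. (cmod (\<phi> u))\<^sup>2) * d"
        using card_nbrs[of v] by (intro mult_left_mono sum_nonneg) auto
      finally show "(cmod (adjacency_operator \<phi> v))\<^sup>2 \<le> d * (\<Sum>u\<in>nbrs G v. (cmod (\<phi> u))\<^sup>2)"
        by (simp add: mult.commute)
    qed
    also have "\<dots> = d * (\<Sum>v\<in>S. \<Sum>u\<in>{u. u \<in> U \<and> adj G u v}. (cmod (\<phi> u))\<^sup>2)"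
      unfolding sum_distrib_left[symmetric] U_def
      by (intro arg_cong2[where f="(*)"] refl sum.cong) (auto simp: nbrs_def)
    also have "(\<Sum>v\<in>S. \<Sum>u\<in>{u. u \<in> U \<and> adj G u v}. (cmod (\<phi> u))\<^sup>2)
        = (\<Sum>u\<in>U. \<Sum>v\<in>{v. v \<in> S \<and> adj G u v}. (cmod (\<phi> u))\<^sup>2)"
      by (rule sum.swap_restrict[OF S(1) U(1)])
    also have "d * (\<Sum>u\<in>U. \<Sum>v\<in>{v. v \<in> S \<and> adj G u v}. (cmod (\<phi> u))\<^sup>2)
        \<le> d * (\<Sum>u\<in>U. d * (cmod (\<phi> u))\<^sup>2)"
    proof (intro mult_left_mono sum_mono)
      fix u
      have "card {v. v \<in> S \<and> adj G u v} \<le> card (nbrs G u)"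
        by (rule card_mono) (auto simp: finite_nbrs mem_nbrs_iff adj_commute)
      then have "card {v. v \<in> S \<and> adj G u v} \<le> d"
        using card_nbrs[of u] by simp
      then show "(\<Sum>v\<in>{v. v \<in> S \<and> adj G u v}. (cmod (\<phi> u))\<^sup>2) \<le> d * (cmod (\<phi> u))\<^sup>2"
        by (simp add: mult_right_mono)
    qed simp
    also have "(\<Sum>u\<in>U. d * (cmod (\<phi> u))\<^sup>2) = d * (L2_set (\<lambda>v. cmod (\<phi> v)) U)\<^sup>2"
      by (simp add: L2_set_def sum_nonneg sum_distrib_left)
    also have "d * (d * (L2_set (\<lambda>v. cmod (\<phi> v)) U)\<^sup>2) \<le> d * (d * (ell2_norm V \<phi>)\<^sup>2)"
      by (intro mult_left_mono power_mono L2_set_le_ell2_norm \<phi> U) auto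
    finally have "(\<Sum>v\<in>S. (cmod (adjacency_operator \<phi> v))\<^sup>2) \<le> (d * ell2_norm V \<phi>)\<^sup>2"
      by (simp add: power2_eq_square algebra_simps)
    then show ?thesis
      unfolding L2_set_def by (intro real_le_lsqrt) (auto simp: sum_nonneg)
  qed
  then show "adjacency_operator \<phi> \<in> ell2 V"
    "ell2_norm V (adjacency_operator \<phi>) \<le> d * ell2_norm V \<phi>"
    using ell2I[OF f] by blast+
qed

text \<open>Both sides are sums over ordered edges, and reversing the edges exchanges them. Fubini
  requires absolute summability over the edges, which comes from the norm bound for the adjacency
  operator applied to the absolute value of \<phi>.\<close>

lemma pairing_adjacency_operator:
  assumes \<phi>: "\<phi> \<in> ell2 V" and \<psi>: "\<psi> \<in> ell2 V"
  shows "pairing V (adjacency_operator \<phi>) \<psi> = pairing V \<phi> (adjacency_operator \<psi>)"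
proof -
  define E where "E = Sigma V (nbrs G)"
  have summable: "(\<lambda>(v, u). \<phi> u * \<psi> v) summable_on E"
    if \<phi>: "\<phi> \<in> ell2 V" and \<psi>: "\<psi> \<in> ell2 V" for \<phi> \<psi>
  proof -
    define \<phi>' where "\<phi>' v = complex_of_real (cmod (\<phi> v))" for v
    have \<phi>': "\<phi>' \<in> ell2 V"
      using \<phi> by (auto simp: ell2_def functions_on_def \<phi>'_def)
    note A\<phi>' = adjacency_operator_ell2(1)[OF \<phi>']
    have "(\<lambda>e. cmod (case e of (v, u) \<Rightarrow> \<phi> u * \<psi> v)) summable_on E"
    proof (rule nonneg_bdd_above_summable_on)
      show "bdd_above (sum (\<lambda>e. cmod (case e of (v, u) \<Rightarrow> \<phi> u * \<psi> v)) ` {F. F \<subseteq> E \<and> finite F})"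
      proof (rule bdd_aboveI2, safe)
        fix F assume F: "F \<subseteq> E" "finite F"
        define S where "S = fst ` F"
        have S: "finite S" "S \<subseteq> V"
          using F by (auto simp: S_def E_def)
        have "(\<Sum>e\<in>F. cmod (case e of (v, u) \<Rightarrow> \<phi> u * \<psi> v))
            \<le> (\<Sum>e\<in>Sigma S (nbrs G). cmod (case e of (v, u) \<Rightarrow> \<phi> u * \<psi> v))"
          by (rule sum_mono2) (use S F finite_nbrs in \<open>force simp: E_def S_def\<close>)+
        also have "\<dots> = (\<Sum>v\<in>S. \<Sum>u\<in>nbrs G v. cmod (\<phi> u) * cmod (\<psi> v))"
          using S finite_nbrs by (subst sum.Sigma) (auto simp: norm_mult case_prod_beta)
        also have "\<dots> = (\<Sum>v\<in>S. cmod (adjacency_operator \<phi>' v * \<psi> v))"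
          by (rule sum.cong) (auto simp: adjacency_operator_def \<phi>'_def norm_mult sum_distrib_right
              sum_nonneg simp flip: of_real_sum)
        also have "\<dots> \<le> ell2_norm V (adjacency_operator \<phi>') * ell2_norm V \<psi>"
          by (rule pairing_sum_bound[OF A\<phi>' \<psi> S])
        finally show "(\<Sum>e\<in>F. cmod (case e of (v, u) \<Rightarrow> \<phi> u * \<psi> v))
            \<le> ell2_norm V (adjacency_operator \<phi>') * ell2_norm V \<psi>" .
      qed
    qed auto
    then show ?thesis
      by (rule abs_summable_summable)
  qed
  have eq: "pairing V (adjacency_operator \<phi>) \<psi> = (\<Sum>\<^sub>\<infinity>(v, u)\<in>E. \<phi> u * \<psi> v)"
    if "\<phi> \<in> ell2 V" "\<psi> \<in> ell2 V" for \<phi> \<psi>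
    unfolding pairing_def E_def
    using infsum_Sigma_banach[OF summable[OF that, unfolded E_def]]
    by (simp add: adjacency_operator_def sum_distrib_right finite_nbrs)
  have "bij_betw prod.swap E E"
    unfolding E_def by (rule bij_betwI[where g=prod.swap])
      (use adj_verts[OF graph] in \<open>auto simp: mem_nbrs_iff adj_commute\<close>)
  then have "(\<Sum>\<^sub>\<infinity>(v, u)\<in>E. \<phi> u * \<psi> v) = (\<Sum>\<^sub>\<infinity>(v, u)\<in>E. \<psi> u * \<phi> v)"
    using infsum_reindex_bij_betw[of prod.swap E E "\<lambda>e. \<phi> (snd e) * \<psi> (fst e)"]
    by (simp add: case_prod_unfold mult.commute)
  then show ?thesis
    using eq[OF \<phi> \<psi>] eq[OF \<psi> \<phi>] pairing_commute by metis
qed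

lemma regular_H: "regular_operator V H"
proof -
  have "regular_operator V (\<lambda>\<phi> v. 1 * adjacency_operator \<phi> v + 1 * (of_real (diagonal v) * \<phi> v))"
  proof (rule regular_operator_combine)
    show "regular_operator V adjacency_operator"
      unfolding regular_operator_def
    proof (intro conjI allI impI)
      show "adjacency_operator (\<lambda>v. a * \<phi> v + b * \<psi> v) =
        (\<lambda>v. a * adjacency_operator \<phi> v + b * adjacency_operator \<psi> v)" for a b \<phi> \<psi>
        by (auto simp: adjacency_operator_def sum.distrib sum_distrib_left)
      show "(\<lambda>n. adjacency_operator (s n) v) \<longlonglongrightarrow> adjacency_operator \<phi> v"
        if "\<forall>v. (\<lambda>n. s n v) \<longlonglongrightarrow> \<phi> v" for s \<phi> v
        unfolding adjacency_operator_def by (intro tendsto_sum) (use that in auto)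
    qed (use adjacency_operator_ell2 in blast)
    show "regular_operator V (\<lambda>\<phi> v. of_real (diagonal v) * \<phi> v)"
      unfolding regular_operator_def
    proof (intro conjI allI impI exI[of _ "\<bar>M\<bar> + real d"] ballI)
      show "(\<lambda>v. complex_of_real (diagonal v) * (a * \<phi> v + b * \<psi> v)) =
        (\<lambda>v. a * (of_real (diagonal v) * \<phi> v) + b * (of_real (diagonal v) * \<psi> v))" for a b \<phi> \<psi>
        by (auto simp: algebra_simps)
      show "(\<lambda>n. of_real (diagonal v) * s n v) \<longlonglongrightarrow> of_real (diagonal v) * \<phi> v"
        if "\<forall>v. (\<lambda>n. s n v) \<longlonglongrightarrow> \<phi> v" for s and \<phi> :: "'v \<Rightarrow> complex" and v
        by (intro tendsto_intros) (use that in auto)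
      fix \<phi> assume \<phi>: "\<phi> \<in> ell2 V"
      have "(\<lambda>v. of_real (diagonal v) * \<phi> v) \<in> functions_on V"
        by (simp add: functions_on_def diagonal_def)
      then show "(\<lambda>v. of_real (diagonal v) * \<phi> v) \<in> ell2 V"
        "ell2_norm V (\<lambda>v. of_real (diagonal v) * \<phi> v) \<le> (\<bar>M\<bar> + real d) * ell2_norm V \<phi>"
        using ell2_dominated[OF \<phi>, of "\<lambda>v. of_real (diagonal v) * \<phi> v" "\<bar>M\<bar> + real d"] diagonal_bound
        by (auto simp: norm_mult mult_right_mono)
    qed
  qed
  also have "(\<lambda>\<phi> v. 1 * adjacency_operator \<phi> v + 1 * (of_real (diagonal v) * \<phi> v)) = H"
    by (intro ext) (simp add: H_eq)
  finally show ?thesis .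
qed

lemma pairing_H:
  assumes \<phi>: "\<phi> \<in> ell2 V" and \<psi>: "\<psi> \<in> ell2 V"
  shows "pairing V (H \<phi>) \<psi> = pairing V \<phi> (H \<psi>)"
proof -
  have *: "pairing V (H \<phi>) \<psi> = pairing V (adjacency_operator \<phi>) \<psi> + (\<Sum>\<^sub>\<infinity>v\<in>V. of_real (diagonal v) * \<phi> v * \<psi> v)"
    if \<phi>: "\<phi> \<in> ell2 V" and \<psi>: "\<psi> \<in> ell2 V" for \<phi> \<psi>
  proof -
    have D: "(\<lambda>v. H \<phi> v - adjacency_operator \<phi> v) \<in> ell2 V"
      by (intro ell2_diff regular_operator_ell2[OF regular_H] adjacency_operator_ell2 \<phi>)
    have "pairing V (H \<phi>) \<psi> = pairing V (\<lambda>v. adjacency_operator \<phi> v + (H \<phi> v - adjacency_operator \<phi> v)) \<psi>"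
      by simp
    also have "\<dots> = pairing V (adjacency_operator \<phi>) \<psi> + pairing V (\<lambda>v. H \<phi> v - adjacency_operator \<phi> v) \<psi>"
      by (rule pairing_add_left[OF adjacency_operator_ell2(1)[OF \<phi>] D \<psi>])
    finally show ?thesis
      by (simp add: pairing_def H_eq)
  qed
  show ?thesis
    using *[OF \<phi> \<psi>] *[OF \<psi> \<phi>] pairing_adjacency_operator[OF \<phi> \<psi>]
    by (simp add: pairing_commute[of V \<phi>] mult.commute mult.left_commute)
qed

lemma H_cnj: "H (\<lambda>v. cnj (\<phi> v)) = (\<lambda>v. cnj (H \<phi> v))"
  by (auto simp: schroedinger_def)

lemma H_functions_on: "H \<phi> \<in> functions_on V"
  by (simp add: functions_on_def schroedinger_def)

text \<open>\<open>H\<close> has real coefficients and is symmetric for the pairing, so conjugation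
  only exchanges the two arguments.\<close>

lemma Im_pairing_H:
  assumes \<phi>: "\<phi> \<in> ell2 V"
  shows "Im (pairing V (H \<phi>) (\<lambda>v. cnj (\<phi> v))) = 0"
proof -
  have "cnj (pairing V (H \<phi>) (\<lambda>v. cnj (\<phi> v))) = pairing V (\<lambda>v. cnj (H \<phi> v)) (\<lambda>v. cnj (cnj (\<phi> v)))"
    by (simp only: pairing_cnj)
  also have "\<dots> = pairing V (H (\<lambda>v. cnj (\<phi> v))) \<phi>"
    by (simp add: H_cnj)
  also have "\<dots> = pairing V (\<lambda>v. cnj (\<phi> v)) (H \<phi>)"
    by (rule pairing_H[OF ell2_cnj(1)[OF \<phi>] \<phi>])
  finally have "cnj (pairing V (H \<phi>) (\<lambda>v. cnj (\<phi> v))) = pairing V (H \<phi>) (\<lambda>v. cnj (\<phi> v))"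
    by (simp add: pairing_commute)
  then show ?thesis
    by (metis Reals_cnj_iff complex_is_Real_iff)
qed

end

section \<open>A criterion for not being in the essential spectrum\<close>

text \<open>Evaluation on F embeds E into a finite-dimensional space. As \<open>finite_dim\<close>
  asks for a spanning set inside E, the points of F are removed one at a time, each contributing at
  most one new generator.\<close>

lemma finite_dim_if_determined:
  assumes "finite F" and "\<And>a b \<phi> \<psi>. \<phi> \<in> E \<Longrightarrow> \<psi> \<in> E \<Longrightarrow> (\<lambda>v. a * \<phi> v + b * \<psi> v) \<in> E"
    and "\<And>\<phi>. \<phi> \<in> E \<Longrightarrow> (\<And>v. v \<in> F \<Longrightarrow> \<phi> v = 0) \<Longrightarrow> \<phi> = (\<lambda>v. 0)"
  shows "finite_dim E"
  using assms
proof (induction F arbitrary: E)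
  case empty
  then have "\<phi> = (\<lambda>v. \<Sum>b\<in>{}. c b * b v)" if "\<phi> \<in> E" for \<phi> and c :: "('a \<Rightarrow> complex) \<Rightarrow> complex"
    using that by simp
  then show ?case
    unfolding finite_dim_def by blast
next
  case (insert x F)
  note lin = insert.prems(1)
  define E\<^sub>0 where "E\<^sub>0 = {\<phi> \<in> E. \<phi> x = 0}"
  have "finite_dim E\<^sub>0"
  proof (rule insert.IH)
    show "(\<lambda>v. a * \<phi> v + b * \<psi> v) \<in> E\<^sub>0" if "\<phi> \<in> E\<^sub>0" "\<psi> \<in> E\<^sub>0" for a b \<phi> \<psi>
      using that lin by (simp add: E\<^sub>0_def)
    show "\<phi> = (\<lambda>v. 0)" if "\<phi> \<in> E\<^sub>0" "\<And>v. v \<in> F \<Longrightarrow> \<phi> v = 0" for \<phi>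
      by (rule insert.prems(2)) (use that in \<open>auto simp: E\<^sub>0_def\<close>)
  qed
  then obtain B where B: "finite B" "B \<subseteq> E\<^sub>0" and span: "\<And>\<phi>. \<phi> \<in> E\<^sub>0 \<Longrightarrow> \<exists>c. \<phi> = (\<lambda>v. \<Sum>b\<in>B. c b * b v)"
    unfolding finite_dim_def by blast
  show ?case
  proof (cases "\<exists>b\<in>E. b x \<noteq> 0")
    case False
    then have "E = E\<^sub>0"
      by (auto simp: E\<^sub>0_def)
    then show ?thesis
      using \<open>finite_dim E\<^sub>0\<close> by simp
  next
    case True
    then obtain e where e: "e \<in> E" "e x \<noteq> 0"
      by blast
    have "\<exists>c. \<phi> = (\<lambda>v. \<Sum>b\<in>insert e B. c b * b v)" if \<phi>: "\<phi> \<in> E" for \<phi>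
    proof -
      have "(\<lambda>v. 1 * \<phi> v + (- \<phi> x / e x) * e v) \<in> E\<^sub>0"
        using lin[OF \<phi> e(1), of 1 "- \<phi> x / e x"] e(2) by (simp add: E\<^sub>0_def)
      then obtain c where c: "(\<lambda>v. 1 * \<phi> v + (- \<phi> x / e x) * e v) = (\<lambda>v. \<Sum>b\<in>B. c b * b v)"
        using span by blast
      have "e \<notin> B"
        using B(2) e(2) by (auto simp: E\<^sub>0_def)
      have "\<phi> v = (\<Sum>b\<in>insert e B. (c(e := \<phi> x / e x)) b * b v)" for v
      proof -
        have "(\<Sum>b\<in>B. (c(e := \<phi> x / e x)) b * b v) = (\<Sum>b\<in>B. c b * b v)"
          by (rule sum.cong) (use \<open>e \<notin> B\<close> in auto)
        then show ?thesis
          using fun_cong[OF c, of v] \<open>e \<notin> B\<close> B(1) by (simp add: algebra_simps)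
      qed
      then show ?thesis
        by blast
    qed
    moreover have "finite (insert e B)" "insert e B \<subseteq> E"
      using B e by (auto simp: E\<^sub>0_def)
    ultimately show ?thesis
      unfolding finite_dim_def by blast
  qed
qed

lemma ell2_norm_restrict:
  assumes "finite F" "F \<subseteq> V"
  shows "ell2_norm V (restrict_to F \<phi>) = L2_set (\<lambda>v. cmod (\<phi> v)) F"
proof -
  have "ell2_norm V (restrict_to F \<phi>) = L2_set (\<lambda>v. cmod (restrict_to F \<phi> v)) F"
    by (rule ell2_finite_support(2)[OF assms]) (simp add: restrict_to_def)
  also have "\<dots> = L2_set (\<lambda>v. cmod (\<phi> v)) F"
    by (rule L2_set_cong) (auto simp: restrict_to_def)
  finally show ?thesis .
qed

section \<open>Resolvent and reality of the spectrum\<close>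

context bounded_schroedinger
begin

definition shifted :: "complex \<Rightarrow> 'v operator" where
  "shifted z \<phi> v = H \<phi> v - z * \<phi> v"

lemma regular_shifted: "regular_operator V (shifted z)"
proof -
  have "regular_operator V (\<lambda>\<phi> v. 1 * H \<phi> v + (-z) * \<phi> v)"
    by (rule regular_operator_combine[OF regular_H regular_operator_id])
  also have "(\<lambda>\<phi> v. 1 * H \<phi> v + (-z) * \<phi> v) = shifted z"
    by (intro ext) (simp add: shifted_def)
  finally show ?thesis .
qed

lemmas shifted_ell2 = regular_operator_ell2[OF regular_shifted]

lemma shifted_cnj: "shifted z (\<lambda>v. cnj (\<phi> v)) = (\<lambda>v. cnj (shifted (cnj z) \<phi> v))"
  by (auto simp: shifted_def H_cnj)

lemma pairing_shifted:
  assumes "\<phi> \<in> ell2 V" "\<psi> \<in> ell2 V"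
  shows "pairing V (shifted z \<phi>) \<psi> = pairing V \<phi> (shifted z \<psi>)"
proof -
  have *: "pairing V (shifted z \<phi>) \<psi> = pairing V (H \<phi>) \<psi> - z * pairing V \<phi> \<psi>"
    if "\<phi> \<in> ell2 V" "\<psi> \<in> ell2 V" for \<phi> \<psi>
    unfolding shifted_def[abs_def]
    using pairing_diff_left[OF regular_operator_ell2[OF regular_H that(1)] ell2_scale(1)[OF that(1)] that(2)]
    by (simp add: pairing_scale_left)
  show ?thesis
    using *[OF assms] *[OF assms(2,1)] pairing_H[OF assms] by (simp add: pairing_commute[of V \<phi>])
qed

lemma shifted_change:
  assumes "\<phi> \<in> ell2 V"
  shows "ell2_norm V (shifted z \<phi>) \<le> ell2_norm V (shifted w \<phi>) + cmod (w - z) * ell2_norm V \<phi>"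
  using ell2_norm_le_add(2)[of "shifted z \<phi>" "shifted w \<phi>" "\<lambda>v. (w - z) * \<phi> v" V]
    shifted_ell2[OF assms, of w] ell2_scale[OF assms, of "w - z"]
  by (simp add: shifted_def algebra_simps)

text \<open>As \<open>H\<close> is real, conjugating \<phi> transfers the lower bound from z to
  \<open>cnj z\<close>. By symmetry the quadratic form of the product of the two shifted operators
  is the squared norm of \<open>shifted (cnj z) \<phi>\<close>; so the product is coercive with
  constant c^2, and \<open>Lax_Milgram\<close> yields surjectivity.\<close>

theorem bounded_below_imp_resolvent:
  assumes c: "c > 0" and below: "\<And>\<phi>. \<phi> \<in> ell2 V \<Longrightarrow> c * ell2_norm V \<phi> \<le> ell2_norm V (shifted z \<phi>)"
  shows "z \<in> resolvent_set V H"
proof -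
  have below_cnj: "c * ell2_norm V \<phi> \<le> ell2_norm V (shifted (cnj z) \<phi>)" if \<phi>: "\<phi> \<in> ell2 V" for \<phi>
    using below[OF ell2_cnj(1)[OF \<phi>]] ell2_cnj(2)[OF \<phi>] ell2_cnj(2)[OF shifted_ell2[OF \<phi>, of "cnj z"]]
    by (simp add: shifted_cnj)
  have surj: "\<exists>\<psi>. \<psi> \<in> ell2 V \<and> shifted z \<psi> = f" if f: "f \<in> ell2 V" for f
  proof -
    have "c\<^sup>2 * (ell2_norm V \<phi>)\<^sup>2
        \<le> Re (pairing V (shifted z (shifted (cnj z) \<phi>)) (\<lambda>v. cnj (\<phi> v)))" if \<phi>: "\<phi> \<in> ell2 V" for \<phi>
    proof -
      note s = shifted_ell2[OF \<phi>, of "cnj z"]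
      have "pairing V (shifted z (shifted (cnj z) \<phi>)) (\<lambda>v. cnj (\<phi> v))
          = pairing V (shifted (cnj z) \<phi>) (\<lambda>v. cnj (shifted (cnj z) \<phi> v))"
        using pairing_shifted[OF s ell2_cnj(1)[OF \<phi>]] by (simp add: shifted_cnj)
      also have "\<dots> = complex_of_real ((ell2_norm V (shifted (cnj z) \<phi>))\<^sup>2)"
        by (rule pairing_self[OF s])
      finally show ?thesis
        using power_mono[OF below_cnj[OF \<phi>], of 2] c by (simp add: power_mult_distrib)
    qed
    then obtain \<phi> where "\<phi> \<in> ell2 V" "shifted z (shifted (cnj z) \<phi>) = f"
      using Lax_Milgram[OF regular_operator_compose[OF regular_shifted regular_shifted] _ _ f, of "c\<^sup>2"] c
      by (metis zero_less_power)
    then show ?thesis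
      using shifted_ell2 by blast
  qed
  have inj: "\<phi> = \<psi>" if "\<phi> \<in> ell2 V" "\<psi> \<in> ell2 V" "shifted z \<phi> = shifted z \<psi>" for \<phi> \<psi>
  proof -
    have "c * ell2_norm V (\<lambda>v. \<phi> v - \<psi> v) \<le> ell2_norm V (\<lambda>v. shifted z \<phi> v - shifted z \<psi> v)"
      using below[OF ell2_diff(1)[OF that(1,2)]] by (simp add: regular_operator_diff[OF regular_shifted])
    then have "ell2_norm V (\<lambda>v. \<phi> v - \<psi> v) \<le> 0"
      using that(3) c by (simp add: mult_le_0_iff)
    from ell2_norm_eq_0D[OF ell2_diff(1)[OF that(1,2)] this] show ?thesis
      by (auto simp: fun_eq_iff)
  qed
  define R where "R f = (THE \<psi>. \<psi> \<in> ell2 V \<and> shifted z \<psi> = f)" for f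
  have R: "R f \<in> ell2 V" "shifted z (R f) = f" if "f \<in> ell2 V" for f
  proof -
    have "\<exists>!\<psi>. \<psi> \<in> ell2 V \<and> shifted z \<psi> = f"
      using surj[OF that] inj by metis
    from theI'[OF this] show "R f \<in> ell2 V" "shifted z (R f) = f"
      by (simp_all add: R_def)
  qed
  have R_eqI: "R f = \<psi>" if "\<psi> \<in> ell2 V" "shifted z \<psi> = f" for f \<psi>
    using R[of f] inj[of "R f" \<psi>] that shifted_ell2 by metis
  have "bounded_operator V R"
    unfolding bounded_operator_def
  proof (intro conjI ballI allI)
    show "R (\<lambda>v. \<phi> v + \<psi> v) = (\<lambda>v. R \<phi> v + R \<psi> v)" if "\<phi> \<in> ell2 V" "\<psi> \<in> ell2 V" for \<phi> \<psi>
    proof (rule R_eqI)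
      show "(\<lambda>v. R \<phi> v + R \<psi> v) \<in> ell2 V"
        by (intro ell2_add R that)
      show "shifted z (\<lambda>v. R \<phi> v + R \<psi> v) = (\<lambda>v. \<phi> v + \<psi> v)"
        using regular_operator_linear[OF regular_shifted, of z 1 "R \<phi>" 1 "R \<psi>"] R(2) that by simp
    qed
    show "R (\<lambda>v. a * \<psi> v) = (\<lambda>v. a * R \<psi> v)" if "\<psi> \<in> ell2 V" for a \<psi>
      using R_eqI[of "\<lambda>v. a * R \<psi> v"] ell2_scale(1)[OF R(1)[OF that]]
        regular_operator_scale[OF regular_shifted, of z a "R \<psi>"] R(2)[OF that] by simp
    show "\<exists>K. \<forall>\<psi>\<in>ell2 V. ell2_norm V (R \<psi>) \<le> K * ell2_norm V \<psi>"
    proof (intro exI ballI)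
      fix \<psi> assume "\<psi> \<in> ell2 V"
      then show "ell2_norm V (R \<psi>) \<le> (1 / c) * ell2_norm V \<psi>"
        using below[OF R(1)] R(2) c by (simp add: field_simps)
    qed
  qed (use R in auto)
  moreover have "R (\<lambda>v. H \<psi> v - z * \<psi> v) = \<psi>" if "\<psi> \<in> ell2 V" for \<psi>
    by (rule R_eqI[OF that]) (auto simp: shifted_def)
  moreover have "(\<lambda>v. H (R \<psi>) v - z * R \<psi> v) = \<psi>" if "\<psi> \<in> ell2 V" for \<psi>
    using R(2)[OF that] by (auto simp: shifted_def fun_eq_iff)
  ultimately show ?thesis
    unfolding resolvent_set_def by blast
qed

lemma spectrum_approximate_eigenvector:
  assumes "z \<in> spectrum V H" "c > 0"
  obtains \<phi> where "\<phi> \<in> ell2 V" "ell2_norm V \<phi> = 1" "ell2_norm V (shifted z \<phi>) < c"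
proof -
  have "\<not> (\<forall>\<phi>\<in>ell2 V. c * ell2_norm V \<phi> \<le> ell2_norm V (shifted z \<phi>))"
    using bounded_below_imp_resolvent[OF assms(2)] assms(1) by (auto simp: spectrum_def)
  then obtain \<phi> where \<phi>: "\<phi> \<in> ell2 V" and less: "ell2_norm V (shifted z \<phi>) < c * ell2_norm V \<phi>"
    by force
  define m where "m = ell2_norm V \<phi>"
  have "0 < c * m"
    unfolding m_def using ell2_norm_nonneg less by (rule order.strict_trans1)
  then have m: "m > 0"
    using assms(2) by (simp add: zero_less_mult_iff)
  let ?\<psi> = "\<lambda>v. of_real (1 / m) * \<phi> v"
  have "ell2_norm V (shifted z ?\<psi>) = (1 / m) * ell2_norm V (shifted z \<phi>)"
    unfolding regular_operator_scale[OF regular_shifted] ell2_scale(2)[OF shifted_ell2[OF \<phi>]]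
    using m by (simp add: norm_divide)
  also have "\<dots> < c"
    using less m by (simp add: m_def field_simps)
  finally show thesis
    using that[of ?\<psi>] ell2_scale[OF \<phi>, of "of_real (1 / m)"] m by (simp add: m_def norm_divide)
qed

text \<open>On unit vectors the quadratic form of H - z has imaginary part -Im z, so H - z is
  bounded below by the absolute value of Im z.\<close>

lemma spectrum_real:
  assumes "z \<in> spectrum V H"
  shows "Im z = 0"
proof (rule ccontr)
  assume z: "Im z \<noteq> 0"
  then obtain \<phi> where \<phi>: "\<phi> \<in> ell2 V" "ell2_norm V \<phi> = 1"
    and less: "ell2_norm V (shifted z \<phi>) < \<bar>Im z\<bar>"
    using spectrum_approximate_eigenvector[OF assms, of "\<bar>Im z\<bar>"] by auto
  note c = ell2_cnj[OF \<phi>(1)]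
  have "pairing V (shifted z \<phi>) (\<lambda>v. cnj (\<phi> v)) = pairing V (H \<phi>) (\<lambda>v. cnj (\<phi> v)) - z"
    unfolding shifted_def[abs_def]
    using pairing_diff_left[OF regular_operator_ell2[OF regular_H \<phi>(1)] ell2_scale(1)[OF \<phi>(1)] c(1), of z]
    by (simp add: pairing_scale_left pairing_self[OF \<phi>(1)] \<phi>(2))
  then have "\<bar>Im z\<bar> = \<bar>Im (pairing V (shifted z \<phi>) (\<lambda>v. cnj (\<phi> v)))\<bar>"
    using Im_pairing_H[OF \<phi>(1)] by simp
  also have "\<dots> \<le> ell2_norm V (shifted z \<phi>)"
    using abs_Im_le_cmod pairing_Cauchy_Schwarz[OF shifted_ell2[OF \<phi>(1), of z] c(1)] c(2) \<phi>(2)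
    by (metis mult.right_neutral order_trans)
  finally show False
    using less by simp
qed

lemma eigenspace_iff_shifted: "\<phi> \<in> eigenspace V H z \<longleftrightarrow> \<phi> \<in> ell2 V \<and> shifted z \<phi> = (\<lambda>v. 0)"
  by (auto simp: eigenspace_def shifted_def fun_eq_iff)

lemma eigenspace_orthogonal:
  assumes \<phi>: "\<phi> \<in> eigenspace V H x" and \<psi>: "\<psi> \<in> eigenspace V H y" and "x \<noteq> y" "Im y = 0"
  shows "pairing V \<phi> (\<lambda>v. cnj (\<psi> v)) = 0"
proof -
  have e: "\<phi> \<in> ell2 V" "\<psi> \<in> ell2 V" "H \<phi> = (\<lambda>v. x * \<phi> v)" "H \<psi> = (\<lambda>v. y * \<psi> v)"
    using \<phi> \<psi> by (auto simp: eigenspace_def)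
  have y: "cnj y = y"
    using assms(4) by (simp add: complex_eq_iff)
  have "x * pairing V \<phi> (\<lambda>v. cnj (\<psi> v)) = pairing V (H \<phi>) (\<lambda>v. cnj (\<psi> v))"
    by (simp add: e(3) pairing_scale_left)
  also have "\<dots> = pairing V \<phi> (H (\<lambda>v. cnj (\<psi> v)))"
    by (rule pairing_H[OF e(1) ell2_cnj(1)[OF e(2)]])
  also have "\<dots> = pairing V (\<lambda>v. y * cnj (\<psi> v)) \<phi>"
    by (simp add: H_cnj e(4) y pairing_commute)
  also have "\<dots> = y * pairing V \<phi> (\<lambda>v. cnj (\<psi> v))"
    by (simp add: pairing_scale_left pairing_commute)
  finally show ?thesis
    using assms(3) by simp
qed

section \<open>Spectrum near lam under a lower bound modulo a finite set\<close>

context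
  fixes F :: "'v set" and C :: real and lam :: complex
  assumes F: "finite F" "F \<subseteq> V" and C: "C > 0"
    and estimate: "\<And>\<phi>. \<phi> \<in> ell2 V \<Longrightarrow>
      ell2_norm V \<phi> \<le> C * (ell2_norm V (shifted lam \<phi>) + ell2_norm V (restrict_to F \<phi>))"
begin

text \<open>The radius 1 / (2 * C) lets half of the norm absorb the change from lam to z, so the
  estimate holds at z with the constant 2 * C. Approximate eigenvectors then keep a fixed share of
  their mass on F, and mass on a finite set survives pointwise limits.\<close>

lemma spectrum_near_eigenvector:
  assumes z: "z \<in> spectrum V H" "cmod (z - lam) \<le> 1 / (2 * C)"
  obtains \<phi> where "\<phi> \<in> eigenspace V H z" "ell2_norm V \<phi> = 1"
proof -
  have est: "ell2_norm V \<phi> \<le> 2 * C * (ell2_norm V (shifted z \<phi>) + ell2_norm V (restrict_to F \<phi>))"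
    if \<phi>: "\<phi> \<in> ell2 V" for \<phi>
  proof -
    have "C * ell2_norm V (shifted lam \<phi>)
        \<le> C * (ell2_norm V (shifted z \<phi>) + 1 / (2 * C) * ell2_norm V \<phi>)"
      using shifted_change[OF \<phi>, of lam z] mult_right_mono[OF z(2), of "ell2_norm V \<phi>"] C
      by (intro mult_left_mono) auto
    also have "\<dots> = C * ell2_norm V (shifted z \<phi>) + ell2_norm V \<phi> / 2"
      using C by (simp add: field_simps)
    finally show ?thesis
      using estimate[OF \<phi>] by (simp add: algebra_simps)
  qed
  have "\<exists>\<phi>. \<phi> \<in> ell2 V \<and> ell2_norm V \<phi> = 1 \<and> ell2_norm V (shifted z \<phi>) < inverse (real (Suc n))" for n
    using spectrum_approximate_eigenvector[OF z(1), of "inverse (real (Suc n))"] by auto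
  then obtain s where s: "\<And>n. s n \<in> ell2 V" "\<And>n. ell2_norm V (s n) = 1"
    "\<And>n. ell2_norm V (shifted z (s n)) < inverse (real (Suc n))"
    by metis
  have "cmod (s n v) \<le> 1" for n v
    using norm_le_ell2_norm[OF s(1), of n v] s(2)[of n] by simp
  then obtain r \<phi> where r: "strict_mono r" and lim: "\<And>v. (\<lambda>n. s (r n) v) \<longlonglongrightarrow> \<phi> v"
    using pointwise_convergent_subsequence[OF countable_verts, of s 1] s(1)[THEN ell2_functions_on] by metis
  have \<phi>: "\<phi> \<in> ell2 V"
    by (rule ell2_pointwise_limit(1)[OF _ _ lim, where K=1]) (use s in auto)
  have inv0: "(\<lambda>n. inverse (real (Suc (r n)))) \<longlonglongrightarrow> 0"
    using LIMSEQ_subseq_LIMSEQ[OF LIMSEQ_inverse_real_of_nat r] by (simp add: o_def)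
  have "shifted z \<phi> v = 0" for v
  proof (rule LIMSEQ_unique)
    show "(\<lambda>n. shifted z (s (r n)) v) \<longlonglongrightarrow> shifted z \<phi> v"
      by (rule regular_operator_tendsto[OF regular_shifted lim])
    have "cmod (shifted z (s (r n)) v) \<le> inverse (real (Suc (r n)))" for n
      using norm_le_ell2_norm[OF shifted_ell2[OF s(1)], of z "r n" v] s(3)[of "r n"] by linarith
    then show "(\<lambda>n. shifted z (s (r n)) v) \<longlonglongrightarrow> 0"
      by (intro Lim_null_comparison[OF _ inv0]) auto
  qed
  then have eig: "\<phi> \<in> eigenspace V H z"
    using \<phi> by (auto simp: eigenspace_iff_shifted)
  \<comment> \<open>The summand 0 is the limit of the errors of the approximate eigenvectors; the
    rest bounds the mass of the limit on F from below.\<close>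
  have "1 / (2 * C) \<le> 0 + L2_set (\<lambda>v. cmod (\<phi> v)) F"
  proof (rule LIMSEQ_le_const)
    show "(\<lambda>n. inverse (real (Suc (r n))) + L2_set (\<lambda>v. cmod (s (r n) v)) F)
        \<longlonglongrightarrow> 0 + L2_set (\<lambda>v. cmod (\<phi> v)) F"
      unfolding L2_set_def by (intro tendsto_intros inv0 lim)
    have "1 / (2 * C) \<le> inverse (real (Suc (r n))) + L2_set (\<lambda>v. cmod (s (r n) v)) F" for n
    proof -
      have "1 / (2 * C) \<le> ell2_norm V (shifted z (s (r n))) + L2_set (\<lambda>v. cmod (s (r n) v)) F"
        using est[OF s(1)[of "r n"]] s(2)[of "r n"] C ell2_norm_restrict[OF F, of "s (r n)"]
        by (simp add: field_simps)
      then show ?thesis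
        using s(3)[of "r n"] by linarith
    qed
    then show "\<exists>N. \<forall>n\<ge>N. 1 / (2 * C) \<le> inverse (real (Suc (r n))) + L2_set (\<lambda>v. cmod (s (r n) v)) F"
      by blast
  qed
  moreover have "0 < 1 / (2 * C)"
    using C by simp
  ultimately have "0 < L2_set (\<lambda>v. cmod (\<phi> v)) F"
    by linarith
  then have pos: "0 < ell2_norm V \<phi>"
    using L2_set_le_ell2_norm[OF \<phi> F] by linarith
  let ?\<psi> = "\<lambda>v. of_real (1 / ell2_norm V \<phi>) * \<phi> v"
  have "(\<lambda>v. a * \<phi> v) \<in> eigenspace V H z" for a
    using eig ell2_scale(1)[OF \<phi>] regular_operator_scale[OF regular_shifted]
    by (simp add: eigenspace_iff_shifted)
  then have "?\<psi> \<in> eigenspace V H z" .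
  moreover have "ell2_norm V ?\<psi> = 1"
    unfolding ell2_scale(2)[OF \<phi>] using pos by (simp add: norm_divide)
  ultimately show thesis
    by (rule that)
qed

text \<open>Unit eigenvectors for points tending to lam have a pointwise limit \<phi> in the
  eigenspace of lam, possibly 0. They are orthogonal to it and so stay at distance at least 1 from
  it. Yet the estimate sends their differences from \<phi> to 0, since the shifted differences tend
  to 0 in norm and pointwise convergence is enough on F.\<close>

lemma isolated_in_spectrum:
  assumes "lam \<in> spectrum V H"
  shows "lam isolated_in spectrum V H"
proof (rule ccontr)
  assume "\<not> lam isolated_in spectrum V H"
  then have islimpt: "lam islimpt spectrum V H"
    using assms by (simp add: isolated_in_islimpt_iff)
  \<comment> \<open>The minimum keeps the points within the range of
    \<open>spectrum_near_eigenvector\<close>, so that genuine eigenvectors exist, and lets the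
    points tend to lam.\<close>
  define \<epsilon> where "\<epsilon> n = min (1 / (2 * C)) (inverse (real (Suc n)))" for n
  have "\<epsilon> n > 0" for n
    using C by (simp add: \<epsilon>_def)
  then have "\<exists>z\<in>spectrum V H. z \<noteq> lam \<and> dist z lam < \<epsilon> n" for n
    using islimpt by (simp add: islimpt_approachable)
  then obtain z where z: "\<And>n. z n \<in> spectrum V H" "\<And>n. z n \<noteq> lam" "\<And>n. dist (z n) lam < \<epsilon> n"
    by metis
  have "\<exists>\<phi>. \<phi> \<in> eigenspace V H (z n) \<and> ell2_norm V \<phi> = 1" for n
    using spectrum_near_eigenvector[OF z(1)[of n]] z(3)[of n] by (auto simp: \<epsilon>_def dist_norm)
  then obtain s where s: "\<And>n. s n \<in> eigenspace V H (z n)" "\<And>n. ell2_norm V (s n) = 1"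
    by metis
  then have s_ell2: "s n \<in> ell2 V" for n
    by (auto simp: eigenspace_def)
  have "cmod (s n v) \<le> 1" for n v
    using norm_le_ell2_norm[OF s_ell2, of n v] s(2)[of n] by simp
  then obtain r \<phi> where r: "strict_mono r" and lim: "\<And>v. (\<lambda>n. s (r n) v) \<longlonglongrightarrow> \<phi> v"
    using pointwise_convergent_subsequence[OF countable_verts, of s 1] s_ell2[THEN ell2_functions_on] by metis
  have \<phi>: "\<phi> \<in> ell2 V"
    by (rule ell2_pointwise_limit(1)[OF _ _ lim, where K=1]) (use s s_ell2 in auto)
  have z_lim: "(\<lambda>n. cmod (z (r n) - lam)) \<longlonglongrightarrow> 0"
  proof (rule Lim_null_comparison)
    show "(\<lambda>n. inverse (real (Suc (r n)))) \<longlonglongrightarrow> 0"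
      using LIMSEQ_subseq_LIMSEQ[OF LIMSEQ_inverse_real_of_nat r] by (simp add: o_def)
    show "\<forall>\<^sub>F n in sequentially. norm (cmod (z (r n) - lam)) \<le> inverse (real (Suc (r n)))"
      using z(3) by (auto simp: \<epsilon>_def dist_norm less_imp_le)
  qed
  have shift_s: "shifted lam (s n) = (\<lambda>v. (z n - lam) * s n v)" for n
    using s(1)[of n] by (auto simp: eigenspace_def shifted_def algebra_simps)
  have "shifted lam \<phi> v = 0" for v
  proof (rule LIMSEQ_unique)
    show "(\<lambda>n. shifted lam (s (r n)) v) \<longlonglongrightarrow> shifted lam \<phi> v"
      by (rule regular_operator_tendsto[OF regular_shifted lim])
    show "(\<lambda>n. shifted lam (s (r n)) v) \<longlonglongrightarrow> 0"
      unfolding shift_s using tendsto_mult[OF tendsto_norm_zero_cancel[OF z_lim] lim] by simp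
  qed
  then have shift_\<phi>: "shifted lam \<phi> = (\<lambda>v. 0)"
    by auto
  then have eig: "\<phi> \<in> eigenspace V H lam"
    using \<phi> by (simp add: eigenspace_iff_shifted)
  have "1 \<le> C * (0 + L2_set (\<lambda>v. cmod (\<phi> v - \<phi> v)) F)"
  proof (rule LIMSEQ_le_const)
    show "(\<lambda>n. C * (cmod (z (r n) - lam) + L2_set (\<lambda>v. cmod (s (r n) v - \<phi> v)) F))
        \<longlonglongrightarrow> C * (0 + L2_set (\<lambda>v. cmod (\<phi> v - \<phi> v)) F)"
      unfolding L2_set_def by (intro tendsto_intros z_lim lim)
    have "1 \<le> C * (cmod (z (r n) - lam) + L2_set (\<lambda>v. cmod (s (r n) v - \<phi> v)) F)" for n
    proof -
      let ?d = "\<lambda>v. s (r n) v - \<phi> v"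
      have d: "?d \<in> ell2 V"
        by (rule ell2_diff(1)[OF s_ell2 \<phi>])
      have "pairing V \<phi> (\<lambda>v. cnj (s (r n) v)) = 0"
        by (rule eigenspace_orthogonal[OF eig s(1) z(2)[symmetric] spectrum_real[OF z(1)]])
      then have "1 \<le> (ell2_norm V ?d)\<^sup>2"
        using ell2_norm_diff_square[OF s_ell2 \<phi>, of "r n"] s(2)[of "r n"] by simp
      then have "1 \<le> ell2_norm V ?d"
        using power2_le_imp_le[of 1 "ell2_norm V ?d"] by simp
      also have "\<dots> \<le> C * (ell2_norm V (shifted lam ?d) + ell2_norm V (restrict_to F ?d))"
        by (rule estimate[OF d])
      also have "shifted lam ?d = (\<lambda>v. (z (r n) - lam) * s (r n) v)"
        unfolding regular_operator_diff[OF regular_shifted] shift_s shift_\<phi> by simp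
      also have "ell2_norm V \<dots> = cmod (z (r n) - lam)"
        by (simp add: ell2_scale(2)[OF s_ell2] s(2))
      also have "ell2_norm V (restrict_to F ?d) = L2_set (\<lambda>v. cmod (?d v)) F"
        by (rule ell2_norm_restrict[OF F])
      finally show ?thesis .
    qed
    then show "\<exists>N. \<forall>n\<ge>N. 1 \<le> C * (cmod (z (r n) - lam) + L2_set (\<lambda>v. cmod (s (r n) v - \<phi> v)) F)"
      by blast
  qed
  then show False
    by (simp add: L2_set_def)
qed

text \<open>The estimate bounds an element of the eigenspace by its restriction to F, so its values
  on F determine it.\<close>

lemma finite_dim_eigenspace: "finite_dim (eigenspace V H lam)"
proof (rule finite_dim_if_determined[OF F(1)])
  show "(\<lambda>v. a * \<phi> v + b * \<psi> v) \<in> eigenspace V H lam"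
    if "\<phi> \<in> eigenspace V H lam" "\<psi> \<in> eigenspace V H lam" for a b \<phi> \<psi>
    using that regular_operator_linear[OF regular_shifted, of lam a \<phi> b \<psi>]
      ell2_add(1)[OF ell2_scale(1) ell2_scale(1), of \<phi> V \<psi> a b]
    by (simp add: eigenspace_iff_shifted)
  show "\<phi> = (\<lambda>v. 0)" if "\<phi> \<in> eigenspace V H lam" "\<And>v. v \<in> F \<Longrightarrow> \<phi> v = 0" for \<phi>
  proof (rule ell2_norm_eq_0D)
    show \<phi>: "\<phi> \<in> ell2 V"
      using that(1) by (simp add: eigenspace_def)
    have "restrict_to F \<phi> = (\<lambda>v. 0)" "shifted lam \<phi> = (\<lambda>v. 0)"
      using that by (auto simp: restrict_to_def eigenspace_iff_shifted)
    then show "ell2_norm V \<phi> \<le> 0"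
      using estimate[OF \<phi>] by simp
  qed
qed

theorem not_in_essential_spectrum: "lam \<notin> essential_spectrum V H"
proof
  assume "lam \<in> essential_spectrum V H"
  then have spec: "lam \<in> spectrum V H" and not: "lam \<notin> discrete_spectrum V H"
    by (auto simp: essential_spectrum_def)
  obtain \<phi> where \<phi>: "\<phi> \<in> eigenspace V H lam" "ell2_norm V \<phi> = 1"
    using spectrum_near_eigenvector[OF spec] C by auto
  then have "\<phi> \<noteq> (\<lambda>v. 0)"
    by auto
  then show False
    using not \<phi>(1) isolated_in_spectrum[OF spec] finite_dim_eigenspace
    by (auto simp: discrete_spectrum_def eigenvalue_def)
qed

end

end

section \<open>Balls\<close>

lemma relpowp_adj_commute: "(adj G ^^ n) u v \<Longrightarrow> (adj G ^^ n) v u"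
proof (induction n arbitrary: v)
  case (Suc n)
  then obtain w where "(adj G ^^ n) u w" "adj G w v"
    by auto
  then show ?case
    using Suc.IH relpowp_Suc_I2[of "adj G" v w n u] adj_commute by metis
qed auto

lemma gdist_le: "(adj G ^^ n) u v \<Longrightarrow> gdist G u v \<le> n"
  unfolding gdist_def by (rule Least_le)

lemma gdist_walk:
  assumes "connected_graph G" "u \<in> verts G" "v \<in> verts G"
  shows "(adj G ^^ gdist G u v) u v"
proof -
  have "\<exists>n. (adj G ^^ n) u v"
    using assms rtranclp_imp_relpowp unfolding connected_graph_def by metis
  then show ?thesis
    unfolding gdist_def by (rule LeastI_ex)
qed

lemma gdist_commute: "gdist G u v = gdist G v u"
  unfolding gdist_def using relpowp_adj_commute by metis

lemma gdist_self [simp]: "gdist G v v = 0"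
  using gdist_le[of 0 G v v] by simp

lemma gdist_triangle:
  assumes "connected_graph G" "u \<in> verts G" "v \<in> verts G" "w \<in> verts G"
  shows "gdist G u w \<le> gdist G u v + gdist G v w"
  using gdist_walk[OF assms(1)] assms(2-4) by (intro gdist_le) (auto simp: relpowp_add)

lemma gdist_adj: "adj G u v \<Longrightarrow> gdist G u v \<le> 1"
  by (rule gdist_le) (simp add: eq_OO)

lemma gball_center: "v \<in> verts G \<Longrightarrow> v \<in> gball G v r"
  by (simp add: gball_def)

lemma gball_subset: "gball G v r \<subseteq> verts G"
  by (auto simp: gball_def)

lemma gball_mono: "r \<le> s \<Longrightarrow> gball G v r \<subseteq> gball G v s"
  by (auto simp: gball_def)

lemma gball_0:
  assumes "connected_graph G" "v \<in> verts G"
  shows "gball G v 0 = {v}"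
  using gdist_walk[OF assms(1) _ assms(2)] assms(2) by (fastforce simp: gball_def)

text \<open>This recursion drives the inductions on the radius: finiteness and cardinality of balls,
  and the convergence of labelled balls.\<close>

lemma gball_Suc:
  assumes "graph G" "connected_graph G" "v \<in> verts G"
  shows "gball G v (Suc r) = gball G v r \<union> (\<Union>w\<in>gball G v r. nbrs G w)"
proof
  show "gball G v (Suc r) \<subseteq> gball G v r \<union> (\<Union>w\<in>gball G v r. nbrs G w)"
  proof
    fix u assume u: "u \<in> gball G v (Suc r)"
    show "u \<in> gball G v r \<union> (\<Union>w\<in>gball G v r. nbrs G w)"
    proof (cases "gdist G u v \<le> r")
      case False
      then have "gdist G u v = Suc r" and uV: "u \<in> verts G"
        using u by (auto simp: gball_def)
      then have "(adj G ^^ Suc r) u v"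
        using gdist_walk[OF assms(2) uV assms(3)] by simp
      then obtain w where w: "adj G u w" "(adj G ^^ r) w v"
        using relpowp_Suc_D2 by metis
      then have "w \<in> gball G v r"
        using adj_verts(2)[OF assms(1)] gdist_le by (auto simp: gball_def)
      then show ?thesis
        using w(1) by (auto simp: nbrs_def)
    qed (use u in \<open>auto simp: gball_def\<close>)
  qed
  show "gball G v r \<union> (\<Union>w\<in>gball G v r. nbrs G w) \<subseteq> gball G v (Suc r)"
  proof -
    have "u \<in> gball G v (Suc r)" if "w \<in> gball G v r" "adj G u w" for u w
    proof -
      have "gdist G u v \<le> gdist G u w + gdist G w v"
        using gdist_triangle[OF assms(2) adj_verts[OF assms(1) that(2)] assms(3)] .
      then show ?thesis
        using that gdist_adj[OF that(2)] adj_verts(1)[OF assms(1) that(2)] by (auto simp: gball_def)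
    qed
    then show ?thesis
      using gball_mono[of r "Suc r" G v] by (auto simp: nbrs_def)
  qed
qed

context bounded_schroedinger
begin

lemma finite_gball: "v \<in> V \<Longrightarrow> finite (gball G v r)"
  by (induction r) (auto simp: gball_0[OF connected] gball_Suc[OF graph connected] finite_nbrs)

lemma gball_gdist:
  assumes "u \<in> gball G v r" "v \<in> V" "w \<in> V"
  shows "gdist G v w \<le> gdist G u w + r"
  using assms gdist_triangle[OF connected, of v u w] gdist_commute[of G v u] by (auto simp: gball_def)


section \<open>From local estimates to a global estimate\<close>

text \<open>Cut the graph into annuli of width L around the root. The squares of the values fall
  like 4^-i on annulus i, while a growth rate whose L-th power is 2 allows at most 2 C 2^i vertices
  there; a convergent geometric series remains. The growth hypothesis enters the whole proof only
  here.\<close>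

lemma exponential_decay_ell2:
  assumes growth: "subexponential_growth G v\<^sub>0"
    and v0: "v\<^sub>0 \<in> V" and "L > 0" and \<phi>: "\<phi> \<in> functions_on V"
    and decay: "\<And>v. v \<in> V \<Longrightarrow> cmod (\<phi> v) \<le> K / 2 ^ (gdist G v v\<^sub>0 div L)"
  shows "\<phi> \<in> ell2 V"
proof -
  define j where "j v = gdist G v v\<^sub>0 div L" for v
  define \<gamma> where "\<gamma> = root L 2"
  have \<gamma>: "\<gamma> > 1" "\<gamma> ^ L = 2"
    using \<open>L > 0\<close> by (auto simp: \<gamma>_def)
  then obtain C where C: "C > 0" "\<And>r. real (card (gball G v\<^sub>0 r)) < C * \<gamma> ^ r"
    using growth unfolding subexponential_growth_def by blast
  \<comment> \<open>The factor 4 * C is 2 * C, from the ball of radius \<open>L * Suc i\<close> that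
    contains annulus i, times the sum 2 of the geometric series.\<close>
  have "L2_set (\<lambda>v. cmod (\<phi> v)) S \<le> sqrt (K\<^sup>2 * (4 * C))" if S: "finite S" "S \<subseteq> V" for S
  proof -
    have level: "(\<Sum>v\<in>{v. v \<in> S \<and> j v = i}. (cmod (\<phi> v))\<^sup>2) \<le> K\<^sup>2 * (2 * C) * (1 / 2) ^ i" for i
    proof -
      have "{v. v \<in> S \<and> j v = i} \<subseteq> gball G v\<^sub>0 (L * Suc i)"
      proof
        fix v assume v: "v \<in> {v. v \<in> S \<and> j v = i}"
        have "gdist G v v\<^sub>0 = L * j v + gdist G v v\<^sub>0 mod L"
          by (simp add: j_def)
        moreover have "gdist G v v\<^sub>0 mod L < L"
          using \<open>L > 0\<close> by simp
        ultimately show "v \<in> gball G v\<^sub>0 (L * Suc i)"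
          using v S by (auto simp: gball_def)
      qed
      then have "card {v. v \<in> S \<and> j v = i} \<le> card (gball G v\<^sub>0 (L * Suc i))"
        by (rule card_mono[OF finite_gball[OF v0]])
      then have card: "real (card {v. v \<in> S \<and> j v = i}) \<le> C * 2 ^ Suc i"
        using C(2)[of "L * Suc i"] unfolding power_mult \<gamma>(2) by linarith
      have "(\<Sum>v\<in>{v. v \<in> S \<and> j v = i}. (cmod (\<phi> v))\<^sup>2) \<le> (\<Sum>v\<in>{v. v \<in> S \<and> j v = i}. (K / 2 ^ i)\<^sup>2)"
        by (intro sum_mono power_mono) (use decay S in \<open>auto simp: j_def\<close>)
      also have "\<dots> = real (card {v. v \<in> S \<and> j v = i}) * (K / 2 ^ i)\<^sup>2"
        by simp
      also have "\<dots> \<le> C * 2 ^ Suc i * (K / 2 ^ i)\<^sup>2"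
        by (rule mult_right_mono[OF card]) simp
      also have "\<dots> = K\<^sup>2 * (2 * C) * (1 / 2) ^ i"
        by (simp add: power2_eq_square field_simps)
      finally show ?thesis .
    qed
    have "(\<Sum>v\<in>S. (cmod (\<phi> v))\<^sup>2) = (\<Sum>i\<in>j ` S. \<Sum>v\<in>{v. v \<in> S \<and> j v = i}. (cmod (\<phi> v))\<^sup>2)"
      by (rule sum.image_gen[OF S(1)])
    also have "\<dots> \<le> (\<Sum>i\<in>j ` S. K\<^sup>2 * (2 * C) * (1 / 2) ^ i)"
      by (rule sum_mono[OF level])
    also have "\<dots> = K\<^sup>2 * (2 * C) * (\<Sum>i\<in>j ` S. (1 / 2) ^ i)"
      by (simp add: sum_distrib_left)
    also have "\<dots> \<le> K\<^sup>2 * (2 * C) * 2"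
    proof (rule mult_left_mono)
      have "(\<Sum>i\<in>j ` S. (1 / 2) ^ i) \<le> (\<Sum>i. (1 / 2 :: real) ^ i)"
        by (rule sum_le_suminf) (use S in auto)
      then show "(\<Sum>i\<in>j ` S. (1 / 2) ^ i) \<le> (2::real)"
        by (simp add: suminf_geometric)
    qed (use C in simp)
    finally show ?thesis
      unfolding L2_set_def by (intro real_sqrt_le_mono) simp
  qed
  then show ?thesis
    using ell2I(1)[OF \<phi>] by blast
qed

end

text \<open>\<open>local_bound\<close> is what remains if no approximate eigenfunctions can be found
  far out: R is the radius of the test ball, N the distance beyond which the test applies, \<delta>
  the tolerated error. The gain from 1 to 1 / 2 is what gets iterated.\<close>

locale local_estimate = bounded_schroedinger G W d M
  for G :: "'v ugraph" and W d M +
  fixes v\<^sub>0 :: 'v and lam :: complex and R N :: nat and \<delta> :: real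
  assumes root: "v\<^sub>0 \<in> V" and growth: "subexponential_growth G v\<^sub>0"
    and real_lam: "Im lam = 0" and \<delta>: "\<delta> > 0"
    and local_bound: "\<And>v \<phi>. v \<in> V \<Longrightarrow> N < gdist G v v\<^sub>0 \<Longrightarrow>
      (\<And>u. u \<in> gball G v R \<Longrightarrow> cmod (\<phi> u) \<le> 1 \<and> cmod (shifted lam \<phi> u) \<le> \<delta>) \<Longrightarrow>
      cmod (\<phi> v) \<le> 1 / 2"
begin

section \<open>The damped operator and its bounded kernel\<close>

definition "F = gball G v\<^sub>0 N"

text \<open>The imaginary potential on \<open>F\<close> removes the eigenfunctions that decay away from \<open>F\<close>.\<close>

definition damped :: "real \<Rightarrow> 'v operator" where
  "damped \<eta> \<phi> v = shifted (lam + \<i> * of_real \<eta>) \<phi> v - \<i> * restrict_to F \<phi> v"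

lemma F: "finite F" "F \<subseteq> V"
  using finite_gball[OF root] gball_subset[of G v\<^sub>0 N] by (auto simp: F_def)

lemma far_iff: "v \<in> V \<Longrightarrow> v \<notin> F \<longleftrightarrow> N < gdist G v v\<^sub>0"
  by (auto simp: F_def gball_def)

lemma damped_0_off: "u \<notin> F \<Longrightarrow> damped 0 \<phi> u = shifted lam \<phi> u"
  by (simp add: damped_def restrict_to_def)

lemma damped_eq: "damped \<eta> \<phi> v = damped 0 \<phi> v - \<i> * of_real \<eta> * \<phi> v"
  by (simp add: damped_def shifted_def algebra_simps)

lemma regular_damped: "regular_operator V (damped \<eta>)"
proof -
  have "regular_operator V (\<lambda>\<phi> v. 1 * shifted (lam + \<i> * of_real \<eta>) \<phi> v + (-\<i>) * restrict_to F \<phi> v)"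
    by (rule regular_operator_combine[OF regular_shifted regular_operator_restrict])
  also have "(\<lambda>\<phi> v. 1 * shifted (lam + \<i> * of_real \<eta>) \<phi> v + (-\<i>) * restrict_to F \<phi> v) = damped \<eta>"
    by (intro ext) (simp add: damped_def)
  finally show ?thesis .
qed

lemma damped_functions_on:
  assumes "\<phi> \<in> functions_on V"
  shows "damped \<eta> \<phi> \<in> functions_on V"
  using assms H_functions_on[of \<phi>] F(2)
  by (auto simp: functions_on_def damped_def shifted_def restrict_to_def)

lemma pairing_damped:
  assumes "\<phi> \<in> ell2 V" "\<psi> \<in> ell2 V"
  shows "pairing V (damped \<eta> \<phi>) \<psi> = pairing V \<phi> (damped \<eta> \<psi>)"
proof -
  let ?z = "lam + \<i> * of_real \<eta>"
  have *: "pairing V (damped \<eta> \<phi>) \<psi> = pairing V (shifted ?z \<phi>) \<psi> - \<i> * pairing V (restrict_to F \<phi>) \<psi>"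
    if "\<phi> \<in> ell2 V" "\<psi> \<in> ell2 V" for \<phi> \<psi>
    unfolding damped_def[abs_def]
    using pairing_diff_left[OF shifted_ell2[OF that(1)] ell2_scale(1)[OF ell2_restrict(1)[OF that(1)]] that(2)]
    by (simp add: pairing_scale_left)
  have "pairing V \<phi> (damped \<eta> \<psi>) = pairing V (damped \<eta> \<psi>) \<phi>"
    by (rule pairing_commute)
  then show ?thesis
    unfolding *[OF assms] *[OF assms(2,1)]
    using pairing_shifted[OF assms(2,1)] pairing_commute[of V \<psi>] pairing_restrict_commute[of V F \<psi> \<phi>]
      pairing_commute[of V \<phi>] by metis
qed

text \<open>H and lam contribute real numbers, so only the two imaginary terms remain. Their common
  sign gives coercivity for \<eta> > 0 and, for \<eta> = 0, forces square-summable elements of the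
  kernel to vanish on F.\<close>

lemma pairing_damped_self:
  assumes "\<phi> \<in> ell2 V"
  shows "Im (pairing V (damped \<eta> \<phi>) (\<lambda>v. cnj (\<phi> v)))
    = - (\<eta> * (ell2_norm V \<phi>)\<^sup>2 + (ell2_norm V (restrict_to F \<phi>))\<^sup>2)"
proof -
  note c = ell2_cnj(1)[OF assms] and H\<phi> = regular_operator_ell2[OF regular_H assms]
    and r = ell2_restrict(1)[OF assms, of F]
  let ?z = "lam + \<i> * of_real \<eta>"
  have "pairing V (damped \<eta> \<phi>) (\<lambda>v. cnj (\<phi> v))
      = pairing V (\<lambda>v. H \<phi> v - ?z * \<phi> v) (\<lambda>v. cnj (\<phi> v))
        - pairing V (\<lambda>v. \<i> * restrict_to F \<phi> v) (\<lambda>v. cnj (\<phi> v))"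
    unfolding damped_def[abs_def] shifted_def
    by (rule pairing_diff_left[OF ell2_diff(1)[OF H\<phi> ell2_scale(1)[OF assms]] ell2_scale(1)[OF r] c])
  also have "pairing V (\<lambda>v. H \<phi> v - ?z * \<phi> v) (\<lambda>v. cnj (\<phi> v))
      = pairing V (H \<phi>) (\<lambda>v. cnj (\<phi> v)) - pairing V (\<lambda>v. ?z * \<phi> v) (\<lambda>v. cnj (\<phi> v))"
    by (rule pairing_diff_left[OF H\<phi> ell2_scale(1)[OF assms] c])
  finally have eq: "pairing V (damped \<eta> \<phi>) (\<lambda>v. cnj (\<phi> v)) = pairing V (H \<phi>) (\<lambda>v. cnj (\<phi> v))
      - ?z * complex_of_real ((ell2_norm V \<phi>)\<^sup>2)
      - \<i> * complex_of_real ((ell2_norm V (restrict_to F \<phi>))\<^sup>2)"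
    unfolding pairing_scale_left pairing_self[OF assms] pairing_restrict_self[OF assms] .
  show ?thesis
    unfolding eq using Im_pairing_H[OF assms] real_lam by (simp del: of_real_power)
qed

text \<open>Iteration needs the local bound at every scale; dividing by K provides it. For K \<le> 0
  the hypothesis at the centre v already decides.\<close>

lemma local_scaled:
  assumes "v \<in> V" "v \<notin> F"
    and "\<And>u. u \<in> gball G v R \<Longrightarrow> cmod (\<phi> u) \<le> K"
    and "\<And>u. u \<in> gball G v R \<Longrightarrow> cmod (shifted lam \<phi> u) \<le> \<delta> * K"
  shows "cmod (\<phi> v) \<le> K / 2"
proof (cases "K > 0")
  case True
  have "cmod (of_real (1 / K) * \<phi> v) \<le> 1 / 2"
  proof (rule local_bound)
    fix u assume "u \<in> gball G v R"
    then show "cmod (of_real (1 / K) * \<phi> u) \<le> 1 \<and> cmod (shifted lam (\<lambda>v. of_real (1 / K) * \<phi> v) u) \<le> \<delta>"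
      unfolding regular_operator_scale[OF regular_shifted]
      using assms(3,4)[of u] True by (simp add: norm_mult norm_divide field_simps)
  qed (use assms far_iff in auto)
  then show ?thesis
    using True by (simp add: norm_mult norm_divide field_simps)
next
  case False
  then show ?thesis
    using assms(3)[OF gball_center[OF assms(1)]] norm_ge_zero[of "\<phi> v"] by linarith
qed

text \<open>The test ball around a vertex of level j + 1 stays within the region of level j, so each
  step outwards by \<open>Suc R\<close> halves the bound. The step \<open>Suc R\<close> is positive
  even for R = 0, as the width of annuli has to be.\<close>

lemma damped_kernel_decay:
  assumes K: "\<And>v. cmod (\<phi> v) \<le> K" and ker: "\<And>v. v \<in> V \<Longrightarrow> damped 0 \<phi> v = 0"
    and "v \<in> V" "N + j * Suc R < gdist G v v\<^sub>0"
  shows "cmod (\<phi> v) \<le> K / 2 ^ j"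
  using assms(3,4)
proof (induction j arbitrary: v)
  case 0
  then show ?case
    using K by simp
next
  case (Suc j)
  have far: "u \<in> V \<and> N + j * Suc R < gdist G u v\<^sub>0" if "u \<in> gball G v R" for u
    using gball_gdist[OF that Suc.prems(1) root] Suc.prems(2) that by (auto simp: gball_def)
  have "0 \<le> K"
    using K norm_ge_zero order_trans by blast
  have "cmod (\<phi> v) \<le> (K / 2 ^ j) / 2"
  proof (rule local_scaled)
    show "v \<notin> F"
      using Suc.prems far_iff by auto
    fix u assume u: "u \<in> gball G v R"
    show "cmod (\<phi> u) \<le> K / 2 ^ j"
      using Suc.IH far[OF u] by blast
    have "u \<notin> F"
      using far[OF u] far_iff by auto
    then show "cmod (shifted lam \<phi> u) \<le> \<delta> * (K / 2 ^ j)"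
      using ker[of u] far[OF u] damped_0_off[of u \<phi>] \<delta> \<open>0 \<le> K\<close> by simp
  qed (use Suc.prems in auto)
  then show ?case
    by simp
qed

text \<open>Once \<phi> is known to vanish on F, the equation holds without the damping term. The
  halving argument then runs on all of V with no condition on the distance, so \<phi> is bounded by
  \<open>K / 2 ^ j\<close> for every j.\<close>

lemma damped_kernel_trivial:
  assumes \<phi>: "\<phi> \<in> functions_on V" and K: "\<And>v. cmod (\<phi> v) \<le> K"
    and ker: "\<And>v. v \<in> V \<Longrightarrow> damped 0 \<phi> v = 0"
  shows "\<phi> = (\<lambda>v. 0)"
proof -
  have "0 \<le> K"
    using K norm_ge_zero order_trans by blast
  have "\<phi> \<in> ell2 V"
  proof (rule exponential_decay_ell2[OF growth root _ \<phi>])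
    show "0 < Suc R"
      by simp
    fix v assume v: "v \<in> V"
    define i where "i = gdist G v v\<^sub>0 div Suc R"
    \<comment> \<open>The first \<open>Suc N\<close> annuli of width \<open>Suc R\<close> contain F;
      the factor \<open>2 ^ Suc N\<close> makes the trivial bound K suffice on them.\<close>
    show "cmod (\<phi> v) \<le> K * 2 ^ Suc N / 2 ^ (gdist G v v\<^sub>0 div Suc R)"
    proof (cases "Suc N \<le> i")
      case True
      have "N + (i - Suc N) * Suc R < Suc N * Suc R + (i - Suc N) * Suc R"
        by simp
      also have "\<dots> = i * Suc R"
        using True by (simp only: add_mult_distrib[symmetric]) simp
      also have "\<dots> \<le> gdist G v v\<^sub>0"
        by (simp add: i_def del: mult_Suc_right)
      finally have far: "N + (i - Suc N) * Suc R < gdist G v v\<^sub>0" .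
      have "cmod (\<phi> v) \<le> K / 2 ^ (i - Suc N)"
        by (rule damped_kernel_decay[of \<phi>]) (fact K ker v far)+
      also have "\<dots> = K * 2 ^ Suc N / 2 ^ i"
        using True by (subst power_diff) auto
      finally show ?thesis
        by (simp add: i_def)
    next
      case False
      then have "(2::real) ^ i \<le> 2 ^ Suc N"
        by (intro power_increasing) auto
      then have "K * 2 ^ i \<le> K * 2 ^ Suc N"
        using \<open>0 \<le> K\<close> by (rule mult_left_mono)
      then have "K \<le> K * 2 ^ Suc N / 2 ^ i"
        by (simp add: field_simps)
      then show ?thesis
        using K[of v] by (simp add: i_def)
    qed
  qed
  note \<phi>2 = this
  have "damped 0 \<phi> = (\<lambda>v. 0)"
    using ker damped_functions_on[OF \<phi>] by (auto simp: functions_on_def)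
  then have "ell2_norm V (restrict_to F \<phi>) = 0"
    using pairing_damped_self[OF \<phi>2, of 0] by (simp add: pairing_def)
  then have "restrict_to F \<phi> = (\<lambda>v. 0)"
    using ell2_norm_eq_0D[OF ell2_restrict(1)[OF \<phi>2]] by simp
  then have zero: "\<phi> v = 0" if "v \<in> F" for v
    using that by (auto simp: restrict_to_def fun_eq_iff split: if_splits)
  have shift: "shifted lam \<phi> v = 0" if "v \<in> V" for v
    using ker[OF that] zero by (auto simp: damped_def restrict_to_def split: if_splits)
  have "cmod (\<phi> v) \<le> K / 2 ^ j" for v j
  proof (induction j arbitrary: v)
    case (Suc j)
    consider "v \<in> F" | "v \<notin> V" | "v \<in> V" "v \<notin> F"
      by blast
    then show ?case
    proof cases
      case 3
      have "cmod (\<phi> v) \<le> (K / 2 ^ j) / 2"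
      proof (rule local_scaled[OF 3 Suc])
        fix u assume "u \<in> gball G v R"
        then have "u \<in> V"
          by (auto simp: gball_def)
        then show "cmod (shifted lam \<phi> u) \<le> \<delta> * (K / 2 ^ j)"
          using shift \<delta> \<open>0 \<le> K\<close> by simp
      qed
      then show ?thesis
        by simp
    qed (use zero \<phi> \<open>0 \<le> K\<close> in \<open>auto simp: functions_on_def\<close>)
  qed (use K in simp)
  moreover have "(\<lambda>j. K / 2 ^ j) \<longlonglongrightarrow> 0"
    by (rule LIMSEQ_divide_realpow_zero) simp
  ultimately have "cmod (\<phi> v) \<le> 0" for v
    by (intro LIMSEQ_le_const[of "\<lambda>j. K / 2 ^ j"]) auto
  then show ?thesis
    by auto
qed

text \<open>Otherwise a sequence violates the bound with residuals tending to 0. The local bound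
  confines the offending vertices to a fixed finite ball, so a pointwise limit is a nonzero bounded
  element of the kernel, against \<open>damped_kernel_trivial\<close>.\<close>

lemma damped_0_contraction:
  obtains c where "c > 0"
    "\<And>\<phi> v. \<phi> \<in> functions_on V \<Longrightarrow> (\<And>v. cmod (\<phi> v) \<le> 1) \<Longrightarrow> (\<And>v. cmod (damped 0 \<phi> v) \<le> c) \<Longrightarrow>
      cmod (\<phi> v) \<le> 1 / 2"
proof (rule ccontr)
  define good where "good c \<phi> u \<longleftrightarrow> \<phi> \<in> functions_on V \<and> (\<forall>v. cmod (\<phi> v) \<le> 1)
    \<and> (\<forall>v. cmod (damped 0 \<phi> v) \<le> c) \<and> 1 / 2 < cmod (\<phi> u)" for c \<phi> u
  assume "\<not> thesis"
  with that have ex: "\<exists>\<phi> u. good c \<phi> u" if "c > 0" for c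
    using \<open>c > 0\<close> unfolding good_def by (meson not_less)
  \<comment> \<open>Residuals of at most \<delta> make \<open>local_bound\<close> applicable; the
    second term sends them to 0.\<close>
  define \<epsilon> where "\<epsilon> n = min \<delta> (inverse (real (Suc n)))" for n
  have "\<epsilon> n > 0" for n
    using \<delta> by (simp add: \<epsilon>_def)
  then have "\<exists>\<phi> u. good (\<epsilon> n) \<phi> u" for n
    by (rule ex)
  then obtain s x where good: "\<And>n. good (\<epsilon> n) (s n) (x n)"
    by metis
  then have s: "\<And>n. s n \<in> functions_on V" "\<And>n v. cmod (s n v) \<le> 1"
    "\<And>n v. cmod (damped 0 (s n) v) \<le> \<epsilon> n" "\<And>n. 1 / 2 < cmod (s n (x n))"
    unfolding good_def by auto
  \<comment> \<open>Around a vertex beyond distance \<open>N + R\<close> the test ball misses F, so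
    the damping is invisible there.\<close>
  define F' where "F' = gball G v\<^sub>0 (N + R)"
  have F': "finite F'"
    using finite_gball[OF root] by (simp add: F'_def)
  have xV: "x n \<in> V" for n
  proof (rule ccontr)
    assume "x n \<notin> V"
    then have "s n (x n) = 0"
      using s(1)[of n] by (simp add: functions_on_def)
    then show False
      using s(4)[of n] by simp
  qed
  have "x n \<in> F'" for n
  proof (rule ccontr)
    assume "x n \<notin> F'"
    then have far: "N + R < gdist G (x n) v\<^sub>0"
      using xV by (auto simp: F'_def gball_def)
    have "cmod (s n (x n)) \<le> 1 / 2"
    proof (rule local_bound[OF xV])
      fix u assume u: "u \<in> gball G (x n) R"
      then have "u \<in> V"
        by (auto simp: gball_def)
      have "N < gdist G u v\<^sub>0"
        using gball_gdist[OF u xV root] far by simp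
      then have "shifted lam (s n) u = damped 0 (s n) u"
        using damped_0_off[of u "s n"] far_iff[OF \<open>u \<in> V\<close>] by simp
      then show "cmod (s n u) \<le> 1 \<and> cmod (shifted lam (s n) u) \<le> \<delta>"
        using s(2)[of n u] s(3)[of n u] by (simp add: \<epsilon>_def)
    qed (use far in simp)
    then show False
      using s(4)[of n] by simp
  qed
  \<comment> \<open>The sum over \<open>F'\<close> detects the large value wherever it lies, so no
    subsequence with constant \<open>x n\<close> has to be chosen.\<close>
  then have large: "1 / 2 \<le> (\<Sum>v\<in>F'. cmod (s n v))" for n
    using s(4)[of n] member_le_sum[of "x n" F' "\<lambda>v. cmod (s n v)"] F' by force
  obtain r \<phi> where r: "strict_mono r" and \<phi>: "\<phi> \<in> functions_on V" and lim: "\<And>v. (\<lambda>n. s (r n) v) \<longlonglongrightarrow> \<phi> v"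
    by (rule pointwise_convergent_subsequence[OF countable_verts, of s 1]) (use s in blast)+
  have "damped 0 \<phi> v = 0" for v
  proof (rule LIMSEQ_unique)
    show "(\<lambda>n. damped 0 (s (r n)) v) \<longlonglongrightarrow> damped 0 \<phi> v"
      by (rule regular_operator_tendsto[OF regular_damped lim])
    show "(\<lambda>n. damped 0 (s (r n)) v) \<longlonglongrightarrow> 0"
    proof (rule Lim_null_comparison)
      show "(\<lambda>n. inverse (real (Suc (r n)))) \<longlonglongrightarrow> 0"
        using LIMSEQ_subseq_LIMSEQ[OF LIMSEQ_inverse_real_of_nat r] by (simp add: o_def)
      show "\<forall>\<^sub>F n in sequentially. cmod (damped 0 (s (r n)) v) \<le> inverse (real (Suc (r n)))"
        using s(3) by (simp add: \<epsilon>_def)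
    qed
  qed
  moreover have "cmod (\<phi> v) \<le> 1" for v
    by (rule LIMSEQ_le_const2[OF tendsto_norm[OF lim]]) (use s(2) in auto)
  ultimately have "\<phi> = (\<lambda>v. 0)"
    using damped_kernel_trivial[OF \<phi>] by blast
  moreover have "1 / 2 \<le> (\<Sum>v\<in>F'. cmod (\<phi> v))"
  proof (rule LIMSEQ_le_const)
    show "(\<lambda>n. \<Sum>v\<in>F'. cmod (s (r n) v)) \<longlonglongrightarrow> (\<Sum>v\<in>F'. cmod (\<phi> v))"
      by (intro tendsto_intros lim)
    show "\<exists>N. \<forall>n\<ge>N. 1 / 2 \<le> (\<Sum>v\<in>F'. cmod (s (r n) v))"
      using large by blast
  qed
  ultimately show False
    by simp
qed

end

section \<open>Green function and Schur's test\<close>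

lemma pairing_delta:
  assumes "v \<in> V"
  shows "pairing V (\<lambda>u. if u = v then 1 else 0) \<psi> = \<psi> v"
proof -
  have "pairing V (\<lambda>u. if u = v then 1 else 0) \<psi>
      = (\<Sum>\<^sub>\<infinity>u\<in>{v}. (if u = v then 1 else 0) * \<psi> u)"
    unfolding pairing_def by (rule infsum_cong_neutral) (use assms in auto)
  then show ?thesis
    by simp
qed

lemma pairing_finite_support:
  assumes "finite S" "S \<subseteq> V" "\<And>v. v \<notin> S \<Longrightarrow> \<phi> v = 0"
  shows "pairing V \<phi> \<psi> = (\<Sum>v\<in>S. \<phi> v * \<psi> v)"
proof -
  have "pairing V \<phi> \<psi> = (\<Sum>\<^sub>\<infinity>v\<in>S. \<phi> v * \<psi> v)"
    unfolding pairing_def by (rule infsum_cong_neutral) (use assms in auto)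
  then show ?thesis
    using assms(1) by simp
qed

context local_estimate
begin

text \<open>Multiplication by i turns the negative imaginary part in
  \<open>pairing_damped_self\<close> into a real part of at least \<eta> times the squared norm, as
  \<open>Lax_Milgram\<close> requires.\<close>

lemma damped_surj:
  assumes "\<eta> > 0" "f \<in> ell2 V"
  obtains \<phi> where "\<phi> \<in> ell2 V" "damped \<eta> \<phi> = f"
proof -
  have regular: "regular_operator V (\<lambda>\<phi> v. \<i> * damped \<eta> \<phi> v)"
    using regular_operator_combine[OF regular_damped regular_damped, of \<i> \<eta> 0] by simp
  have coercive: "\<eta> * (ell2_norm V \<phi>)\<^sup>2
      \<le> Re (pairing V (\<lambda>v. \<i> * damped \<eta> \<phi> v) (\<lambda>v. cnj (\<phi> v)))" if "\<phi> \<in> ell2 V" for \<phi>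
    unfolding pairing_scale_left using pairing_damped_self[OF that] by simp
  obtain \<phi> where "\<phi> \<in> ell2 V" "(\<lambda>v. \<i> * damped \<eta> \<phi> v) = (\<lambda>v. \<i> * f v)"
    using Lax_Milgram[OF regular assms(1) coercive ell2_scale(1)[OF assms(2)]] by metis
  then show thesis
    using that[of \<phi>] by (simp add: fun_eq_iff)
qed

text \<open>The bound on the supremum norm gives uniform bounds for the row sums of the Green function
  \<open>g\<close> of \<open>damped \<eta>\<close>. As \<open>g\<close> is symmetric, Schur's test turns them into a bound on the
  square-summable functions.\<close>

theorem global_estimate:
  obtains C where "C > 0" "\<And>\<phi>. \<phi> \<in> ell2 V \<Longrightarrow>
    ell2_norm V \<phi> \<le> C * (ell2_norm V (shifted lam \<phi>) + ell2_norm V (restrict_to F \<phi>))"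
proof -
  obtain c where c: "c > 0" and contraction:
    "\<And>\<phi> v. \<phi> \<in> functions_on V \<Longrightarrow> (\<And>v. cmod (\<phi> v) \<le> 1) \<Longrightarrow> (\<And>v. cmod (damped 0 \<phi> v) \<le> c) \<Longrightarrow>
      cmod (\<phi> v) \<le> 1 / 2"
    using damped_0_contraction by blast
  \<comment> \<open>In \<open>sup_bound\<close> the residual is at most 1 / B + \<eta> = 3 c / 4,
    which the contraction tolerates; at the end B * \<eta> = 1 / 2 lets the shift be
    absorbed.\<close>
  define \<eta> where "\<eta> = c / 4"
  define B where "B = 2 / c"
  have \<eta>: "\<eta> > 0" and B: "B > 0"
    using c by (auto simp: \<eta>_def B_def)
  \<comment> \<open>If the supremum m exceeds B, dividing by m makes the contraction applicable,
    which gives m \<le> m / 2.\<close>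
  have sup_bound: "cmod (\<phi> v) \<le> B"
    if \<phi>: "\<phi> \<in> ell2 V" and le: "\<And>v. cmod (damped \<eta> \<phi> v) \<le> 1" for \<phi> v
  proof (rule ccontr)
    assume "\<not> cmod (\<phi> v) \<le> B"
    define m where "m = (SUP v. cmod (\<phi> v))"
    have bdd: "bdd_above (range (\<lambda>v. cmod (\<phi> v)))"
      by (rule bdd_aboveI2) (rule norm_le_ell2_norm[OF \<phi>])
    then have le_m: "cmod (\<phi> u) \<le> m" for u
      unfolding m_def by (intro cSUP_upper) auto
    have m: "B < m"
      using le_m[of v] \<open>\<not> cmod (\<phi> v) \<le> B\<close> by simp
    then have m0: "0 < m"
      using B by simp
    have "cmod (of_real (1 / m) * \<phi> u) \<le> 1 / 2" for u
    proof (rule contraction)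
      show "(\<lambda>u. of_real (1 / m) * \<phi> u) \<in> functions_on V"
        by (rule ell2_functions_on[OF ell2_scale(1)[OF \<phi>]])
      show le1: "cmod (of_real (1 / m) * \<phi> u) \<le> 1" for u
        using le_m[of u] m0 by (simp add: norm_mult norm_divide)
      show "cmod (damped 0 (\<lambda>u. of_real (1 / m) * \<phi> u) u) \<le> c" for u
      proof -
        have "damped 0 (\<lambda>u. of_real (1 / m) * \<phi> u) u
            = of_real (1 / m) * damped \<eta> \<phi> u + \<i> * of_real \<eta> * (of_real (1 / m) * \<phi> u)"
          unfolding regular_operator_scale[OF regular_damped] damped_eq[of \<eta>] by (simp add: algebra_simps)
        also have "cmod \<dots> \<le> cmod (of_real (1 / m) * damped \<eta> \<phi> u)
            + cmod (\<i> * of_real \<eta> * (of_real (1 / m) * \<phi> u))"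
          by (rule norm_triangle_ineq)
        also have "\<dots> \<le> 1 / m + \<eta>"
        proof (rule add_mono)
          show "cmod (of_real (1 / m) * damped \<eta> \<phi> u) \<le> 1 / m"
            using le[of u] m0 by (simp add: norm_mult norm_divide field_simps)
          show "cmod (\<i> * of_real \<eta> * (of_real (1 / m) * \<phi> u)) \<le> \<eta>"
          proof -
            have "cmod (\<i> * of_real \<eta> * (of_real (1 / m) * \<phi> u)) = \<eta> * cmod (of_real (1 / m) * \<phi> u)"
              unfolding norm_mult using \<eta> by simp
            also have "\<dots> \<le> \<eta> * 1"
              by (rule mult_left_mono[OF le1]) (use \<eta> in simp)
            finally show ?thesis
              by simp
          qed
        qed
        also have "\<dots> \<le> c"
        proof -
          have "1 / m \<le> 1 / B"
            using m B by (simp add: frac_le)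
          then show ?thesis
            using c by (simp add: B_def \<eta>_def)
        qed
        finally show ?thesis .
      qed
    qed
    then have "cmod (\<phi> u) \<le> m / 2" for u
      using m0 by (simp add: norm_mult norm_divide field_simps)
    then have "m \<le> m / 2"
      unfolding m_def by (intro cSUP_least) auto
    then show False
      using m0 by simp
  qed
  define \<Delta> where "\<Delta> v u = (if u = v then 1 else 0 :: complex)" for v u :: 'v
  have \<Delta>: "\<Delta> v \<in> ell2 V" if "v \<in> V" for v
    using ell2_finite_support(1)[of "{v}" V "\<Delta> v"] that by (auto simp: \<Delta>_def)
  have "\<exists>\<phi>. \<phi> \<in> ell2 V \<and> damped \<eta> \<phi> = \<Delta> v" if "v \<in> V" for v
    using damped_surj[OF \<eta> \<Delta>[OF that]] by metis
  then obtain g where g: "\<And>v. v \<in> V \<Longrightarrow> g v \<in> ell2 V" "\<And>v. v \<in> V \<Longrightarrow> damped \<eta> (g v) = \<Delta> v"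
    by metis
  \<comment> \<open>Symmetry moves the operator onto \<open>g u\<close>, where it produces the point
    mass at u.\<close>
  have green: "\<psi> u = pairing V (damped \<eta> \<psi>) (g u)" if "\<psi> \<in> ell2 V" "u \<in> V" for \<psi> u
    using pairing_damped[OF that(1) g(1)[OF that(2)]] pairing_delta[OF that(2), of \<psi>]
    by (simp add: g(2)[OF that(2)] pairing_commute[of V \<psi>] \<Delta>_def[abs_def])
  have sym: "g v u = g u v" if "u \<in> V" "v \<in> V" for u v
    using green[OF g(1)[OF that(2)] that(1)] pairing_delta[OF that(2), of "g u"]
    by (simp add: g(2)[OF that(2)] \<Delta>_def[abs_def])
  have row: "(\<Sum>v\<in>S. cmod (g u v)) \<le> B" if S: "finite S" "S \<subseteq> V" and u: "u \<in> V" for S u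
  proof -
    \<comment> \<open>The conjugate phases of row u form data of supremum norm at most 1, and the
      solution for these data has the row sum as its value at u.\<close>
    define f where "f v = (if v \<in> S then cnj (sgn (g u v)) else 0)" for v
    have supp: "f v = 0" if "v \<notin> S" for v
      using that by (simp add: f_def)
    have "f \<in> ell2 V"
      by (rule ell2_finite_support(1)[OF S supp])
    then obtain \<phi> where \<phi>: "\<phi> \<in> ell2 V" "damped \<eta> \<phi> = f"
      by (rule damped_surj[OF \<eta>])
    have "(\<Sum>v\<in>S. f v * g u v) = \<phi> u"
      using green[OF \<phi>(1) u] pairing_finite_support[OF S supp] \<phi>(2) by simp
    moreover have "(\<Sum>v\<in>S. f v * g u v) = of_real (\<Sum>v\<in>S. cmod (g u v))"
      unfolding of_real_sum
    proof (rule sum.cong)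
      fix v assume "v \<in> S"
      then have "f v * g u v = (g u v * cnj (g u v)) / of_real (cmod (g u v))"
        by (simp add: f_def sgn_eq)
      also have "\<dots> = of_real (cmod (g u v))"
        unfolding complex_norm_square[symmetric] by (simp add: power2_eq_square)
      finally show "f v * g u v = of_real (cmod (g u v))" .
    qed simp
    ultimately have "\<phi> u = of_real (\<Sum>v\<in>S. cmod (g u v))"
      by simp
    then have "(\<Sum>v\<in>S. cmod (g u v)) = cmod (\<phi> u)"
      by (simp only: norm_of_real) (simp add: sum_nonneg)
    also have "\<dots> \<le> B"
      by (rule sup_bound[OF \<phi>(1)]) (simp add: \<phi>(2) f_def norm_sgn)
    finally show ?thesis .
  qed
  \<comment> \<open>Finitely supported data keep the representation by \<open>g\<close> a finite
    sum; \<open>dual\<close> then removes this restriction.\<close>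
  have schur: "ell2_norm V \<psi> \<le> B * L2_set (\<lambda>v. cmod (damped \<eta> \<psi> v)) U"
    if \<psi>: "\<psi> \<in> ell2 V" and U: "finite U" "U \<subseteq> V" and supp: "\<And>v. v \<notin> U \<Longrightarrow> damped \<eta> \<psi> v = 0" for \<psi> U
  proof (rule ell2I(2)[OF ell2_functions_on[OF \<psi>]])
    fix S assume S: "finite S" "S \<subseteq> V"
    define f where "f v = cmod (damped \<eta> \<psi> v)" for v
    have "(\<Sum>u\<in>S. (cmod (\<psi> u))\<^sup>2) \<le> (\<Sum>u\<in>S. B * (\<Sum>v\<in>U. cmod (g u v) * (f v)\<^sup>2))"
    proof (rule sum_mono)
      fix u assume "u \<in> S"
      then have u: "u \<in> V"
        using S by blast
      have "\<psi> u = (\<Sum>v\<in>U. damped \<eta> \<psi> v * g u v)"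
        using green[OF \<psi> u] pairing_finite_support[OF U supp] by simp
      then have "cmod (\<psi> u) \<le> (\<Sum>v\<in>U. cmod (damped \<eta> \<psi> v * g u v))"
        using norm_sum by metis
      \<comment> \<open>Splitting the kernel into two square roots lets Cauchy-Schwarz produce a row
        sum as one factor; symmetry later turns the column sums into row sums.\<close>
      also have "\<dots> = (\<Sum>v\<in>U. sqrt (cmod (g u v)) * (sqrt (cmod (g u v)) * f v))"
        by (rule sum.cong) (auto simp: f_def norm_mult simp flip: mult.assoc)
      finally have "(cmod (\<psi> u))\<^sup>2 \<le> (\<Sum>v\<in>U. sqrt (cmod (g u v)) * (sqrt (cmod (g u v)) * f v))\<^sup>2"
        by (intro power_mono) auto
      also have "\<dots> \<le> (\<Sum>v\<in>U. (sqrt (cmod (g u v)))\<^sup>2) * (\<Sum>v\<in>U. (sqrt (cmod (g u v)) * f v)\<^sup>2)"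
        by (rule Cauchy_Schwarz_ineq_sum)
      also have "\<dots> = (\<Sum>v\<in>U. cmod (g u v)) * (\<Sum>v\<in>U. cmod (g u v) * (f v)\<^sup>2)"
        by (simp add: power_mult_distrib)
      also have "\<dots> \<le> B * (\<Sum>v\<in>U. cmod (g u v) * (f v)\<^sup>2)"
        by (intro mult_right_mono row U u sum_nonneg) auto
      finally show "(cmod (\<psi> u))\<^sup>2 \<le> B * (\<Sum>v\<in>U. cmod (g u v) * (f v)\<^sup>2)" .
    qed
    also have "\<dots> = B * (\<Sum>v\<in>U. (\<Sum>u\<in>S. cmod (g v u)) * (f v)\<^sup>2)"
    proof -
      have swap: "cmod (g u v) = cmod (g v u)" if "u \<in> S" "v \<in> U" for u v
        by (rule arg_cong[where f=cmod], rule sym) (use that S U in auto)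
      have "(\<Sum>u\<in>S. \<Sum>v\<in>U. cmod (g u v) * (f v)\<^sup>2) = (\<Sum>v\<in>U. \<Sum>u\<in>S. cmod (g u v) * (f v)\<^sup>2)"
        by (rule sum.swap)
      also have "\<dots> = (\<Sum>v\<in>U. (\<Sum>u\<in>S. cmod (g v u)) * (f v)\<^sup>2)"
        unfolding sum_distrib_right by (intro sum.cong refl) (simp add: swap)
      finally show ?thesis
        by (simp add: sum_distrib_left[symmetric])
    qed
    also have "\<dots> \<le> B * (\<Sum>v\<in>U. B * (f v)\<^sup>2)"
      by (intro mult_left_mono sum_mono mult_right_mono row) (use S U B in auto)
    also have "\<dots> = (B * L2_set f U)\<^sup>2"
      by (simp add: power_mult_distrib L2_set_def sum_nonneg power2_eq_square[of B] sum_distrib_left mult.assoc)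
    finally show "L2_set (\<lambda>v. cmod (\<psi> v)) S \<le> B * L2_set (\<lambda>v. cmod (damped \<eta> \<psi> v)) U"
      unfolding f_def L2_set_def[of _ S]
      by (intro real_le_lsqrt) (use B in \<open>auto simp: sum_nonneg\<close>)
  qed
  have dual: "ell2_norm V \<phi> \<le> B * ell2_norm V (damped \<eta> \<phi>)" if \<phi>: "\<phi> \<in> ell2 V" for \<phi>
  proof (rule ell2I(2)[OF ell2_functions_on[OF \<phi>]])
    fix U assume U: "finite U" "U \<subseteq> V"
    \<comment> \<open>Pairing \<phi> with these data gives the squared mass of \<phi> on U. Solving
      for the data moves the operator onto \<phi>, and as they are finitely supported,
      \<open>schur\<close> bounds the solution.\<close>
    define f where "f v = (if v \<in> U then cnj (\<phi> v) else 0)" for v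
    have supp: "f v = 0" if "v \<notin> U" for v
      using that by (simp add: f_def)
    have "f \<in> ell2 V"
      by (rule ell2_finite_support(1)[OF U supp])
    then obtain \<psi> where \<psi>: "\<psi> \<in> ell2 V" "damped \<eta> \<psi> = f"
      by (rule damped_surj[OF \<eta>])
    define x where "x = L2_set (\<lambda>v. cmod (\<phi> v)) U"
    have x: "L2_set (\<lambda>v. cmod (damped \<eta> \<psi> v)) U = x"
      unfolding x_def \<psi>(2) by (rule L2_set_cong) (auto simp: f_def)
    have "complex_of_real (x\<^sup>2) = (\<Sum>v\<in>U. f v * \<phi> v)"
      unfolding x_def L2_set_def
      by (auto simp: sum_nonneg f_def complex_norm_square mult.commute simp del: of_real_power intro!: sum.cong)
    also have "\<dots> = pairing V (damped \<eta> \<psi>) \<phi>"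
      using pairing_finite_support[OF U supp] \<psi>(2) by simp
    also have "\<dots> = pairing V (damped \<eta> \<phi>) \<psi>"
      using pairing_damped[OF \<phi> \<psi>(1)] by (simp add: pairing_commute)
    finally have "cmod (complex_of_real (x\<^sup>2)) \<le> ell2_norm V (damped \<eta> \<phi>) * ell2_norm V \<psi>"
      using pairing_Cauchy_Schwarz[OF regular_operator_ell2[OF regular_damped \<phi>] \<psi>(1)] by metis
    also have "\<dots> \<le> ell2_norm V (damped \<eta> \<phi>) * (B * x)"
      using schur[OF \<psi>(1) U] supp \<psi>(2) x by (intro mult_left_mono) auto
    finally have "x * x \<le> (B * ell2_norm V (damped \<eta> \<phi>)) * x"
      unfolding norm_of_real by (simp add: power2_eq_square algebra_simps)
    moreover have "0 \<le> x"
      by (simp add: x_def)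
    ultimately have "x \<le> B * ell2_norm V (damped \<eta> \<phi>)"
      using B by (cases "x = 0") (auto simp: mult_le_cancel_right)
    then show "L2_set (\<lambda>v. cmod (\<phi> v)) U \<le> B * ell2_norm V (damped \<eta> \<phi>)"
      by (simp add: x_def)
  qed
  have "ell2_norm V \<phi> \<le> 2 * B * (ell2_norm V (shifted lam \<phi>) + ell2_norm V (restrict_to F \<phi>))"
    if \<phi>: "\<phi> \<in> ell2 V" for \<phi>
  proof -
    let ?a = "\<lambda>v. (-\<i>) * restrict_to F \<phi> v" and ?b = "\<lambda>v. (- \<i> * of_real \<eta>) * \<phi> v"
    have a: "?a \<in> ell2 V" "ell2_norm V ?a = ell2_norm V (restrict_to F \<phi>)"
      using ell2_scale[OF ell2_restrict(1)[OF \<phi>], of "-\<i>"] by auto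
    have b: "?b \<in> ell2 V" "ell2_norm V ?b = \<eta> * ell2_norm V \<phi>"
      using ell2_scale[OF \<phi>, of "- \<i> * of_real \<eta>"] \<eta> by (auto simp: norm_mult)
    have "ell2_norm V (damped 0 \<phi>) \<le> ell2_norm V (shifted lam \<phi>) + ell2_norm V ?a"
      by (rule ell2_norm_le_add(2)[OF _ shifted_ell2[OF \<phi>] a(1)]) (simp add: damped_def)
    moreover have "ell2_norm V (damped \<eta> \<phi>) \<le> ell2_norm V (damped 0 \<phi>) + ell2_norm V ?b"
      by (rule ell2_norm_le_add(2)[OF _ regular_operator_ell2[OF regular_damped \<phi>] b(1)])
        (simp add: damped_eq[of \<eta>])
    ultimately have "ell2_norm V (damped \<eta> \<phi>)
        \<le> ell2_norm V (shifted lam \<phi>) + ell2_norm V (restrict_to F \<phi>) + \<eta> * ell2_norm V \<phi>"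
      using a(2) b(2) by linarith
    then have "ell2_norm V \<phi>
        \<le> B * (ell2_norm V (shifted lam \<phi>) + ell2_norm V (restrict_to F \<phi>) + \<eta> * ell2_norm V \<phi>)"
      using dual[OF \<phi>] mult_left_mono[of _ _ B] B by (meson less_imp_le order_trans)
    also have "\<dots> = B * (ell2_norm V (shifted lam \<phi>) + ell2_norm V (restrict_to F \<phi>)) + ell2_norm V \<phi> / 2"
      using c by (simp add: B_def \<eta>_def field_simps)
    finally show ?thesis
      by simp
  qed
  then show thesis
    using that[of "2 * B"] B by simp
qed

corollary not_in_essential: "lam \<notin> essential_spectrum V H"
proof -
  obtain C where "C > 0" "\<And>\<phi>. \<phi> \<in> ell2 V \<Longrightarrow>
    ell2_norm V \<phi> \<le> C * (ell2_norm V (shifted lam \<phi>) + ell2_norm V (restrict_to F \<phi>))"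
    using global_estimate by blast
  then show ?thesis
    by (rule not_in_essential_spectrum[OF F])
qed

end

section \<open>Limits of rooted graphs\<close>

lemma (in bounded_schroedinger) card_gball_le:
  assumes "v \<in> V"
  shows "card (gball G v r) \<le> Suc d ^ r"
proof (induction r)
  case 0
  then show ?case
    by (simp add: gball_0[OF connected assms])
next
  case (Suc r)
  have "card (gball G v (Suc r)) \<le> card (gball G v r) + card (\<Union>w\<in>gball G v r. nbrs G w)"
    unfolding gball_Suc[OF graph connected assms] by (rule card_Un_le)
  also have "card (\<Union>w\<in>gball G v r. nbrs G w) \<le> (\<Sum>w\<in>gball G v r. card (nbrs G w))"
    by (rule card_UN_le[OF finite_gball[OF assms]])
  also have "\<dots> \<le> (\<Sum>w\<in>gball G v r. d)"
    by (rule sum_mono) (rule card_nbrs)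
  finally show ?case
    using mult_le_mono2[OF Suc, of "Suc d"] by (simp add: algebra_simps)
qed

text \<open>Labels are ranks in an order that refines the distance from the root, so that the balls
  around the root are labelled within bounds that do not depend on the root.\<close>

lemma (in bounded_schroedinger) labelling:
  assumes v: "v \<in> V"
  obtains L :: "'v \<Rightarrow> nat"
  where "inj_on L V" "L v = 0" "\<And>r. L ` gball G v r \<subseteq> {..<Suc d ^ r}"
proof -
  obtain i :: "'v \<Rightarrow> nat" where i: "inj_on i V"
    using countable_verts by (auto simp: countable_def)
  define P where "P w u \<longleftrightarrow> gdist G w v < gdist G u v \<or> gdist G w v = gdist G u v \<and> i w < i u" for w u
  define L where "L u = card {w \<in> V. P w u}" for u
  have sub: "{w \<in> V. P w u} \<subseteq> gball G v r - {u}" if "u \<in> gball G v r" for u r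
    using that by (auto simp: P_def gball_def)
  have fin: "finite {w \<in> V. P w u}" if "u \<in> V" for u
  proof -
    have "u \<in> gball G v (gdist G u v)"
      using that by (simp add: gball_def)
    from finite_subset[OF sub[OF this]] show ?thesis
      using finite_gball[OF v] by simp
  qed
  have less: "L u < L u'" if "P u u'" "u \<in> V" "u' \<in> V" for u u'
    unfolding L_def
  proof (rule psubset_card_mono[OF fin[OF that(3)]])
    show "{w \<in> V. P w u} \<subset> {w \<in> V. P w u'}"
      using that by (auto simp: P_def)
  qed
  have inj: "inj_on L V"
  proof (rule inj_onI, rule ccontr)
    fix u u' assume u: "u \<in> V" "u' \<in> V" "L u = L u'" "u \<noteq> u'"
    then have "i u \<noteq> i u'"
      using i by (auto simp: inj_on_def)
    then have "P u u' \<or> P u' u"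
      by (auto simp: P_def)
    then show False
      using less[of u u'] less[of u' u] u by auto
  qed
  have bound: "L ` gball G v r \<subseteq> {..<Suc d ^ r}" for r
  proof safe
    fix u assume u: "u \<in> gball G v r"
    have "L u < card (gball G v r)"
      unfolding L_def
    proof (rule psubset_card_mono[OF finite_gball[OF v]])
      show "{w \<in> V. P w u} \<subset> gball G v r"
        using sub[OF u] u by blast
    qed
    also have "\<dots> \<le> Suc d ^ r"
      by (rule card_gball_le[OF v])
    finally show "L u < Suc d ^ r" .
  qed
  have "L v = 0"
    using bound[of 0] gball_center[OF v, of 0] by auto
  then show thesis
    using that inj bound by blast
qed

lemma adj_induced: "adj (induced G S) u v \<longleftrightarrow> adj G u v \<and> u \<in> S \<and> v \<in> S"
  by (auto simp: adj_def induced_def)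

lemma transport_bij:
  assumes "finite A" "inj_on f A"
  shows "a \<in> A \<Longrightarrow> transport A f \<psi> (f a) = \<psi> a"
    and "b \<notin> f ` A \<Longrightarrow> transport A f \<psi> b = 0"
proof -
  show "transport A f \<psi> (f a) = \<psi> a" if a: "a \<in> A"
  proof -
    have "transport A f \<psi> (f a) = (\<Sum>a'\<in>A. if a' = a then \<psi> a' else 0)"
      unfolding transport_def by (rule sum.cong) (use inj_onD[OF assms(2)] a in auto)
    then show ?thesis
      using assms(1) a by simp
  qed
  show "transport A f \<psi> b = 0" if "b \<notin> f ` A"
    unfolding transport_def by (rule sum.neutral) (use that in auto)
qed

text \<open>When the labelled neighbourhoods agree, the transported operator and its limit differ by
  a multiplication operator, so this case settles the norm convergence. The sum in place of the
  maximum is harmless because the limit ball is fixed and finite.\<close>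

lemma op_norm_bound:
  assumes "finite B" "\<And>\<psi> b. D \<psi> b = (if b \<in> B then of_real (w b) * \<psi> b else 0)"
  shows "\<bar>op_norm B D\<bar> \<le> (\<Sum>b\<in>B. \<bar>w b\<bar>)"
proof -
  define e where "e = (\<Sum>b\<in>B. \<bar>w b\<bar>)"
  have e: "0 \<le> e"
    by (simp add: e_def sum_nonneg)
  have le: "ell2_norm B (D \<psi>) \<le> e" if "\<psi> \<in> ell2 B" "ell2_norm B \<psi> \<le> 1" for \<psi>
  proof -
    have "ell2_norm B (D \<psi>) \<le> e * ell2_norm B \<psi>"
    proof (rule ell2_dominated(2)[OF that(1) _ e])
      show "D \<psi> \<in> functions_on B"
        by (simp add: functions_on_def assms(2))
      fix b assume "b \<in> B"
      then have "\<bar>w b\<bar> \<le> e"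
        unfolding e_def using assms(1) by (intro member_le_sum) auto
      then show "cmod (D \<psi> b) \<le> e * cmod (\<psi> b)"
        using \<open>b \<in> B\<close> by (simp add: assms(2) norm_mult mult_right_mono)
    qed
    also have "\<dots> \<le> e"
      using mult_left_mono[OF that(2) e] by simp
    finally show ?thesis .
  qed
  let ?X = "{ell2_norm B (D \<psi>) | \<psi>. \<psi> \<in> ell2 B \<and> ell2_norm B \<psi> \<le> 1}"
  \<comment> \<open>\<open>op_norm\<close> is a supremum of reals, so the set has to be
    nonempty.\<close>
  have zero: "ell2_norm B (D (\<lambda>v. 0)) \<in> ?X"
    by (rule CollectI, rule exI[of _ "\<lambda>v. 0"]) simp
  have "op_norm B D \<le> e"
    unfolding op_norm_def by (rule cSup_least) (use zero le in auto)
  moreover have "0 \<le> op_norm B D"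
  proof -
    have "ell2_norm B (D (\<lambda>v. 0)) \<le> op_norm B D"
      unfolding op_norm_def by (rule cSup_upper[OF zero], rule bdd_aboveI[of _ e]) (use le in auto)
    then show ?thesis
      using ell2_norm_nonneg order_trans by blast
  qed
  ultimately show ?thesis
    by (simp add: e_def)
qed

locale graph_limit = bounded_schroedinger G W d M
  for G :: "'v ugraph" and W d M +
  fixes x :: "nat \<Rightarrow> 'v" and L :: "nat \<Rightarrow> 'v \<Rightarrow> nat" and T :: "nat \<Rightarrow> nat set"
    and E' :: "nat \<Rightarrow> nat \<Rightarrow> bool" and W' :: "nat \<Rightarrow> real"
  assumes root: "\<And>n. x n \<in> V" and inj: "\<And>n. inj_on (L n) V" and L_root: "\<And>n. L n (x n) = 0"
    and finite_T: "\<And>r. finite (T r)" and L_ball: "\<And>n r. L n ` gball G (x n) r \<subseteq> T r"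
    and edge_lim: "\<And>a b. \<forall>\<^sub>F n in sequentially. (\<exists>u w. L n u = a \<and> L n w = b \<and> adj G u w) = E' a b"
    and W_lim: "\<And>a. (\<lambda>n. if a \<in> L n ` V then W (inv_into V (L n) a) else 0) \<longlonglongrightarrow> W' a"
begin

text \<open>Reachability from the label of the root makes the limit connected, even if
  \<open>E'\<close> also relates labels of vertices that drift away from the roots.\<close>

definition "V' = {a. E'\<^sup>*\<^sup>* 0 a}"

definition "G' = \<lparr>verts = V', edges = {{a, b} | a b. a \<in> V' \<and> b \<in> V' \<and> E' a b}\<rparr>"

text \<open>A statement free of n that holds eventually is true, as \<open>sequentially\<close> is
  not the trivial filter; in this way \<open>E'\<close> inherits the properties of
  adjacency.\<close>

lemma E'_commute: "E' a b \<longleftrightarrow> E' b a"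
proof -
  have "\<forall>\<^sub>F n in sequentially. E' a b = E' b a"
    using edge_lim[of a b] edge_lim[of b a] by eventually_elim (use adj_commute in metis)
  then show ?thesis
    by simp
qed

lemma E'_irrefl: "\<not> E' a a"
proof -
  have "\<forall>\<^sub>F n in sequentially. \<not> E' a a"
    using edge_lim[of a a]
  proof eventually_elim
    case (elim n)
    have "\<not> (L n u = a \<and> L n w = a \<and> adj G u w)" for u w
    proof
      assume *: "L n u = a \<and> L n w = a \<and> adj G u w"
      then have "u = w"
        using inj_onD[OF inj, of n u w] adj_verts[OF graph, of u w] by simp
      then have "{u} \<in> edges G"
        using * by (simp add: adj_def)
      then obtain u' w' where "u' \<noteq> w'" "{u} = {u', w'}"
        using graph unfolding graph_def by blast
      then show False
        by (metis insertI1 insert_commute singletonD)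
    qed
    then show ?case
      using elim by blast
  qed
  then show ?thesis
    by simp
qed

lemma verts_G' [simp]: "verts G' = V'"
  by (simp add: G'_def)

lemma adj_G': "adj G' a b \<longleftrightarrow> a \<in> V' \<and> b \<in> V' \<and> E' a b"
  using E'_commute by (auto simp: adj_def G'_def doubleton_eq_iff)

lemma zero_in_V': "0 \<in> V'"
  by (simp add: V'_def)

lemma V'_step: "a \<in> V' \<Longrightarrow> E' a b \<Longrightarrow> b \<in> V'"
  by (auto simp: V'_def)

lemma nbrs_G': "a \<in> V' \<Longrightarrow> nbrs G' a = {b. E' a b}"
  using E'_commute V'_step by (auto simp: nbrs_def adj_G')

lemma graph_G': "graph G'"
  unfolding graph_def using E'_irrefl by (auto simp: G'_def) metis

lemma connected_G': "connected_graph G'"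
proof -
  have reach: "(adj G')\<^sup>*\<^sup>* 0 a" if "a \<in> V'" for a
  proof -
    have "E'\<^sup>*\<^sup>* 0 a"
      using that by (simp add: V'_def)
    then show ?thesis
    proof (induction rule: rtranclp_induct)
      case (step a b)
      then have "adj G' a b"
        by (auto simp: adj_G' V'_def)
      with step.IH show ?case
        by (rule rtranclp.rtrancl_into_rtrancl)
    qed simp
  qed
  have "symp (adj G')"
    by (simp add: symp_def adj_commute)
  then have "symp (adj G')\<^sup>*\<^sup>*"
    by (rule symp_rtranclp)
  then show ?thesis
    unfolding connected_graph_def using reach by (metis sympD rtranclp_trans verts_G')
qed

lemma E_iff_image_nbrs:
  assumes "u \<in> V"
  shows "(\<exists>u' w. L n u' = L n u \<and> L n w = b \<and> adj G u' w) \<longleftrightarrow> b \<in> L n ` nbrs G u"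
proof
  assume "\<exists>u' w. L n u' = L n u \<and> L n w = b \<and> adj G u' w"
  then obtain u' w where *: "L n u' = L n u" "L n w = b" "adj G u' w"
    by blast
  then have "u' = u"
    using inj_onD[OF inj *(1)] assms adj_verts(1)[OF graph] by blast
  then show "b \<in> L n ` nbrs G u"
    using * by (auto simp: nbrs_def adj_commute)
next
  assume "b \<in> L n ` nbrs G u"
  then obtain w where "L n w = b" "adj G u w"
    using adj_commute[of G] by (auto simp: nbrs_def)
  then show "\<exists>u' w. L n u' = L n u \<and> L n w = b \<and> adj G u' w"
    by blast
qed

text \<open>\<open>edge_lim\<close> concerns one pair of labels at a time. It becomes uniform on a
  ball because only the finitely many pairs from \<open>T r\<close> and \<open>T (Suc r)\<close>
  matter. The hypothesis on balls is supplied by the induction in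
  \<open>eventually_gball\<close>.\<close>

lemma eventually_nbrs:
  assumes balls: "\<forall>\<^sub>F n in sequentially. L n ` gball G (x n) r = gball G' 0 r"
  shows "\<forall>\<^sub>F n in sequentially. \<forall>u\<in>gball G (x n) r. L n ` nbrs G u = nbrs G' (L n u)"
proof -
  \<comment> \<open>This excludes that a neighbour in the limit graph carries a label outside
    \<open>T (Suc r)\<close>, where the edges have not been compared.\<close>
  have step_T: "b \<in> T (Suc r)" if a: "a \<in> gball G' 0 r" and "E' a b" for a b
  proof -
    have "\<forall>\<^sub>F n in sequentially. b \<in> T (Suc r)"
      using balls edge_lim[of a b]
    proof eventually_elim
      case (elim n)
      then obtain u where u: "u \<in> gball G (x n) r" "a = L n u"
        using a by blast
      then have "u \<in> V"
        by (simp add: gball_def)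
      then have "b \<in> L n ` nbrs G u"
        using elim(2) \<open>E' a b\<close> E_iff_image_nbrs u(2) by metis
      also have "\<dots> \<subseteq> L n ` gball G (x n) (Suc r)"
        using u(1) by (auto simp: gball_Suc[OF graph connected root])
      finally show ?case
        using L_ball by blast
    qed
    then show ?thesis
      by simp
  qed
  have "\<forall>\<^sub>F n in sequentially. \<forall>a\<in>T r. \<forall>b\<in>T (Suc r).
      (\<exists>u w. L n u = a \<and> L n w = b \<and> adj G u w) = E' a b"
    by (intro eventually_ball_finite finite_T ballI edge_lim)
  then show ?thesis
    using balls
  proof eventually_elim
    case (elim n)
    show ?case
    proof
      fix u assume u: "u \<in> gball G (x n) r"
      then have uV: "u \<in> V"
        by (simp add: gball_def)
      have Lu: "L n u \<in> gball G' 0 r" "L n u \<in> T r"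
        using elim(2) u L_ball by blast+
      then have "nbrs G' (L n u) = {b. E' (L n u) b}"
        by (intro nbrs_G') (simp add: gball_def)
      moreover have "L n ` nbrs G u \<subseteq> T (Suc r)"
      proof -
        have "L n ` nbrs G u \<subseteq> L n ` gball G (x n) (Suc r)"
          using u by (auto simp: gball_Suc[OF graph connected root])
        then show ?thesis
          using L_ball by blast
      qed
      moreover have "b \<in> L n ` nbrs G u \<longleftrightarrow> E' (L n u) b" if "b \<in> T (Suc r)" for b
        unfolding E_iff_image_nbrs[OF uV, symmetric] using elim(1) Lu(2) that by simp
      ultimately show "L n ` nbrs G u = nbrs G' (L n u)"
        using step_T[OF Lu(1)] by (auto simp only: subset_iff mem_Collect_eq set_eq_iff)
    qed
  qed
qed

lemma eventually_gball: "\<forall>\<^sub>F n in sequentially. L n ` gball G (x n) r = gball G' 0 r"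
proof (induction r)
  case 0
  show ?case
    using zero_in_V' by (simp add: gball_0[OF connected root] gball_0[OF connected_G'] L_root)
next
  case (Suc r)
  from Suc eventually_nbrs[OF Suc] show ?case
  proof eventually_elim
    case (elim n)
    have "L n ` gball G (x n) (Suc r) = L n ` gball G (x n) r \<union> (\<Union>u\<in>gball G (x n) r. L n ` nbrs G u)"
      by (auto simp: gball_Suc[OF graph connected root])
    also have "\<dots> = L n ` gball G (x n) r \<union> (\<Union>a\<in>L n ` gball G (x n) r. nbrs G' a)"
      using elim(2) by auto
    also have "\<dots> = gball G' 0 (Suc r)"
      unfolding elim(1) using zero_in_V' by (simp add: gball_Suc[OF graph_G' connected_G'])
    finally show ?case .
  qed
qed

lemmas eventually_nbrs_image = eventually_nbrs[OF eventually_gball]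

lemma V'_gball: "a \<in> V' \<Longrightarrow> a \<in> gball G' 0 (gdist G' a 0)"
  by (simp add: gball_def)

text \<open>Pointwise statements pass to the limit through this lemma: a fixed limit vertex is in
  the long run the label of an actual vertex at bounded distance from the root, with the right
  neighbours.\<close>

lemma eventually_label:
  assumes "a \<in> V'"
  shows "\<forall>\<^sub>F n in sequentially. \<exists>u\<in>gball G (x n) (gdist G' a 0). a = L n u \<and> inv_into V (L n) a = u
    \<and> L n ` nbrs G u = nbrs G' a"
  using eventually_gball[of "gdist G' a 0"] eventually_nbrs_image[of "gdist G' a 0"]
proof eventually_elim
  case (elim n)
  then obtain u where u: "u \<in> gball G (x n) (gdist G' a 0)" "a = L n u"
    using V'_gball[OF assms] by blast
  then have "inv_into V (L n) a = u"
    using inv_into_f_f[OF inj] by (simp add: gball_def)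
  moreover have "L n ` nbrs G u = nbrs G' a"
    using elim(2) u by simp
  ultimately show ?case
    using u by blast
qed

lemma W_lim': "a \<in> V' \<Longrightarrow> (\<lambda>n. W (inv_into V (L n) a)) \<longlonglongrightarrow> W' a"
  by (rule Lim_transform_eventually[OF W_lim])
    (use eventually_label in \<open>force elim!: eventually_mono simp: gball_def\<close>)

lemma degree_G': "degree_le d G'"
  unfolding degree_le_def
proof
  fix a assume "a \<in> verts G'"
  then have "a \<in> V'"
    by simp
  have "\<forall>\<^sub>F n in sequentially. finite (nbrs G' a) \<and> card (nbrs G' a) \<le> d"
    using eventually_label[OF \<open>a \<in> V'\<close>]
  proof (rule eventually_mono)
    fix n assume "\<exists>u\<in>gball G (x n) (gdist G' a 0). a = L n u \<and> inv_into V (L n) a = u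
      \<and> L n ` nbrs G u = nbrs G' a"
    then obtain u where u: "nbrs G' a = L n ` nbrs G u"
      by metis
    show "finite (nbrs G' a) \<and> card (nbrs G' a) \<le> d"
      unfolding u using finite_nbrs card_nbrs[of u] card_image_le[OF finite_nbrs, of "L n" u] by simp
  qed
  then show "finite (nbrs G' a) \<and> card (nbrs G' a) \<le> d"
    by simp
qed

lemma W'_bound:
  assumes "a \<in> V'"
  shows "\<bar>W' a\<bar> \<le> M"
proof (rule tendsto_upperbound)
  show "(\<lambda>n. \<bar>W (inv_into V (L n) a)\<bar>) \<longlonglongrightarrow> \<bar>W' a\<bar>"
    by (rule tendsto_rabs[OF W_lim'[OF assms]])
  show "\<forall>\<^sub>F n in sequentially. \<bar>W (inv_into V (L n) a)\<bar> \<le> M"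
    using eventually_label[OF assms]
    by (rule eventually_mono) (auto simp: gball_def intro: W_bound)
qed simp

sublocale lim: bounded_schroedinger G' W' d M
  using graph_G' connected_G' degree_G' W'_bound by unfold_locales auto

lemma schroedinger_operator_limit: "schroedinger_operator G' lim.H"
  unfolding schroedinger_operator_def
  using graph_G' connected_G' degree_G' W'_bound by (auto simp: bounded_iff)

text \<open>Outside the balls on which the labels are right, the map is constant; it does not depend
  on the radius \<open>r\<close>.\<close>

definition iso :: "nat \<Rightarrow> nat \<Rightarrow> 'v \<Rightarrow> nat" where
  "iso n r u = (if L n u \<in> V' \<and> gdist G' (L n u) 0 \<le> gdist G u (x n) then L n u else 0)"

lemma coherent_iso: "coherent (iso n) G (x n) G' 0"
  unfolding coherent_def using zero_in_V' by (auto simp: iso_def gball_def)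

lemma eventually_iso:
  "\<forall>\<^sub>F n in sequentially. L n ` gball G (x n) r = gball G' 0 r
    \<and> (\<forall>u\<in>gball G (x n) r. L n ` nbrs G u = nbrs G' (L n u))
    \<and> (\<forall>u\<in>gball G (x n) r. iso n r u = L n u)"
proof -
  \<comment> \<open>\<open>iso\<close> compares the distances of u and of its label, so the balls of
    all radii up to r have to match.\<close>
  have "\<forall>\<^sub>F n in sequentially. \<forall>j\<in>{..r}. L n ` gball G (x n) j = gball G' 0 j"
    by (intro eventually_ball_finite ballI eventually_gball) auto
  then show ?thesis
    using eventually_nbrs_image[of r]
  proof eventually_elim
    case (elim n)
    have "iso n r u = L n u" if u: "u \<in> gball G (x n) r" for u
    proof -
      have "u \<in> gball G (x n) (gdist G u (x n))" "gdist G u (x n) \<le> r"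
        using u by (auto simp: gball_def)
      then have "L n u \<in> gball G' 0 (gdist G u (x n))"
        using elim(1) by blast
      then show ?thesis
        by (simp add: iso_def gball_def)
    qed
    then show ?case
      using elim by blast
  qed
qed

lemma eventually_graph_iso:
  "\<forall>\<^sub>F n in sequentially. graph_iso (iso n r) (induced G (gball G (x n) r)) (induced G' (gball G' 0 r))"
  using eventually_iso[of r]
proof eventually_elim
  case (elim n)
  let ?B = "gball G (x n) r" and ?B' = "gball G' 0 r"
  have verts: "verts (induced G ?B) = ?B" "verts (induced G' ?B') = ?B'"
    by (auto simp: induced_def gball_def)
  have inj_B: "inj_on (L n) ?B"
    using inj by (rule inj_on_subset) (rule gball_subset)
  then have "bij_betw (L n) ?B ?B'"
    using elim by (simp add: bij_betw_def)
  then have "bij_betw (iso n r) ?B ?B'"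
    using elim by (subst bij_betw_cong[where g="L n"]) auto
  moreover have "adj G u v \<longleftrightarrow> adj G' (L n u) (L n v)" if "u \<in> ?B" "v \<in> ?B" for u v
  proof -
    have "adj G' (L n u) (L n v) \<longleftrightarrow> L n u \<in> L n ` nbrs G v"
      using elim that(2) by (simp add: mem_nbrs_iff)
    also have "\<dots> \<longleftrightarrow> u \<in> nbrs G v"
      using inj_on_image_mem_iff[OF inj _ nbrs_subset, of u n v] that(1) by (simp add: gball_def)
    finally show ?thesis
      by (simp add: mem_nbrs_iff)
  qed
  moreover have "L n u \<in> ?B'" if "u \<in> ?B" for u
    using elim that by blast
  ultimately show ?case
    unfolding graph_iso_def verts using elim by (simp add: adj_induced)
qed

text \<open>Whole neighbourhoods correspond, also for boundary vertices of the ball. So the sums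
  over neighbours, which involve the degrees in the full graphs, cancel, and only the potentials
  differ.\<close>

lemma eventually_difference:
  "\<forall>\<^sub>F n in sequentially. \<forall>\<psi> b.
     transport (gball G (x n) r) (iso n r)
       (ball_operator H G (x n) r (transport (gball G' 0 r) (inv_into (gball G (x n) r) (iso n r)) \<psi>)) b
     - ball_operator lim.H G' 0 r \<psi> b
     = (if b \<in> gball G' 0 r then of_real (W (inv_into V (L n) b) - W' b) * \<psi> b else 0)"
  using eventually_iso[of r]
proof (eventually_elim, intro allI)
  fix n \<psi> b
  let ?B = "gball G (x n) r" and ?B' = "gball G' 0 r"
  assume elim: "L n ` ?B = ?B' \<and> (\<forall>u\<in>?B. L n ` nbrs G u = nbrs G' (L n u)) \<and> (\<forall>u\<in>?B. iso n r u = L n u)"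
  define f where "f = iso n r"
  have f: "f u = L n u" if "u \<in> ?B" for u
    using elim that by (simp add: f_def)
  have inj_f: "inj_on f ?B"
    using inj_on_subset[OF inj gball_subset] f by (metis inj_on_cong)
  have im_f: "f ` ?B = ?B'"
    using elim f by (metis image_cong)
  have fin: "finite ?B" "finite ?B'"
    using finite_gball[OF root] im_f by (auto simp flip: im_f)
  have inj_g: "inj_on (inv_into ?B f) ?B'"
    using inj_on_inv_into[of ?B' f ?B] im_f by simp
  have im_g: "inv_into ?B f ` ?B' = ?B"
    using inj_f im_f by (metis inv_into_image_cancel subset_refl)
  define \<xi> where "\<xi> = transport ?B' (inv_into ?B f) \<psi>"
  have xi_in: "\<xi> u = \<psi> (L n u)" if "u \<in> ?B" for u
  proof -
    have "inv_into ?B f (f u) = u"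
      using inj_f that by (rule inv_into_f_f)
    then show ?thesis
      using transport_bij(1)[OF fin(2) inj_g, of "f u" \<psi>] im_f f that by (force simp: \<xi>_def)
  qed
  have xi_out: "\<xi> u = 0" if "u \<notin> ?B" for u
    unfolding \<xi>_def by (rule transport_bij(2)[OF fin(2) inj_g]) (use that im_g in blast)
  \<comment> \<open>Cutting \<psi> off at the limit ball lets \<open>xi\<close> hold on all of V,
    hence also at neighbours outside the ball.\<close>
  define \<psi>' where "\<psi>' = restrict_to ?B' \<psi>"
  have xi: "\<xi> w = \<psi>' (L n w)" if "w \<in> V" for w
  proof (cases "w \<in> ?B")
    case True
    then have "L n w \<in> ?B'"
      using elim by blast
    then show ?thesis
      using xi_in[OF True] by (simp add: \<psi>'_def restrict_to_def)
  next
    case False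
    then have "L n w \<notin> L n ` ?B"
      using inj_on_image_mem_iff[OF inj that gball_subset] by blast
    then show ?thesis
      using xi_out[OF False] elim by (simp add: \<psi>'_def restrict_to_def)
  qed
  have restrict: "restrict_to ?B \<xi> = \<xi>"
    using xi_out by (auto simp: restrict_to_def)
  show "transport ?B (iso n r) (ball_operator H G (x n) r (transport ?B' (inv_into ?B (iso n r)) \<psi>)) b
     - ball_operator lim.H G' 0 r \<psi> b
     = (if b \<in> ?B' then of_real (W (inv_into V (L n) b) - W' b) * \<psi> b else 0)"
  proof (cases "b \<in> ?B'")
    case False
    then show ?thesis
      unfolding f_def[symmetric] using transport_bij(2)[OF fin(1) inj_f] im_f
      by (simp add: ball_operator_def restrict_to_def)
  next
    case True
    then obtain u where u: "u \<in> ?B" "b = L n u"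
      using elim by blast
    then have uV: "u \<in> V"
      by (simp add: gball_def)
    have bV: "b \<in> V'"
      using True by (simp add: gball_def)
    have "transport ?B f (ball_operator H G (x n) r \<xi>) b = ball_operator H G (x n) r \<xi> u"
      using transport_bij(1)[OF fin(1) inj_f u(1)] f[OF u(1)] u(2) by metis
    also have "\<dots> = H \<xi> u"
      using u(1) by (simp add: ball_operator_def restrict restrict_to_def[of _ "H \<xi>"])
    also have "\<dots> = (\<Sum>w\<in>nbrs G u. \<psi>' (L n w) - \<psi>' b) + of_real (W u) * \<psi> b"
      unfolding schroedinger_def using uV nbrs_subset xi xi_in[OF u(1)] u(2)
      by (simp add: subset_iff)
    also have "(\<Sum>w\<in>nbrs G u. \<psi>' (L n w) - \<psi>' b) = (\<Sum>c\<in>nbrs G' b. \<psi>' c - \<psi>' b)"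
    proof -
      have "nbrs G' b = L n ` nbrs G u"
        using elim u by simp
      then show ?thesis
        by (simp add: sum.reindex[OF inj_on_subset[OF inj nbrs_subset]])
    qed
    finally have "transport ?B f (ball_operator H G (x n) r \<xi>) b
        = (\<Sum>c\<in>nbrs G' b. \<psi>' c - \<psi>' b) + of_real (W u) * \<psi> b" .
    moreover have "ball_operator lim.H G' 0 r \<psi> b
        = (\<Sum>c\<in>nbrs G' b. \<psi>' c - \<psi>' b) + of_real (W' b) * \<psi> b"
    proof -
      have "ball_operator lim.H G' 0 r \<psi> b = lim.H \<psi>' b"
        using True by (simp add: ball_operator_def \<psi>'_def restrict_to_def[of _ "lim.H _"])
      also have "\<psi>' b = \<psi> b"
        using True by (simp add: \<psi>'_def restrict_to_def)
      ultimately show ?thesis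
        using bV by (simp add: schroedinger_def)
    qed
    moreover have "inv_into V (L n) b = u"
      using u(2) inv_into_f_f[OF inj uV] by simp
    ultimately show ?thesis
      unfolding f_def[symmetric] \<xi>_def[symmetric] using True by (simp add: algebra_simps)
  qed
qed

theorem converges: "converges_to (\<lambda>n. H) (\<lambda>n. G) x lim.H G' 0"
  unfolding converges_to_def
proof (intro conjI allI exI[of _ iso])
  show "\<exists>d. \<forall>n. rooted_bounded_graph d G (x n)"
    using graph root degree by (auto simp: rooted_bounded_graph_def)
  show "schroedinger_operator G H" for n :: nat
    unfolding schroedinger_operator_def using graph connected degree W_bound
    by (auto simp: bounded_iff)
  show "0 \<in> verts G'"
    using zero_in_V' by simp
  show "schroedinger_operator G' lim.H"
    by (rule schroedinger_operator_limit)
  show "coherent (iso n) G (x n) G' 0" for n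
    by (rule coherent_iso)
  show "\<exists>N. \<forall>n\<ge>N. graph_iso (iso n r) (induced G (gball G (x n) r)) (induced G' (gball G' 0 r))" for r
    using eventually_graph_iso[of r] by (simp add: eventually_sequentially)
  fix r
  have fin: "finite (gball G' 0 r)"
    by (rule lim.finite_gball) (simp add: zero_in_V')
  show "(\<lambda>n. let B = gball G (x n) r; B' = gball G' 0 r in
      op_norm B' (\<lambda>\<psi> b. transport B (iso n r)
        (ball_operator H G (x n) r (transport B' (inv_into B (iso n r)) \<psi>)) b
        - ball_operator lim.H G' 0 r \<psi> b)) \<longlonglongrightarrow> 0"
    unfolding Let_def
  proof (rule Lim_null_comparison)
    have "(\<lambda>n. \<Sum>b\<in>gball G' 0 r. \<bar>W (inv_into V (L n) b) - W' b\<bar>)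
        \<longlonglongrightarrow> (\<Sum>b\<in>gball G' 0 r. \<bar>W' b - W' b\<bar>)"
      by (intro tendsto_intros W_lim') (simp add: gball_def)
    then show "(\<lambda>n. \<Sum>b\<in>gball G' 0 r. \<bar>W (inv_into V (L n) b) - W' b\<bar>) \<longlonglongrightarrow> 0"
      by simp
    show "\<forall>\<^sub>F n in sequentially. norm (op_norm (gball G' 0 r) (\<lambda>\<psi> b. transport (gball G (x n) r) (iso n r)
        (ball_operator H G (x n) r (transport (gball G' 0 r) (inv_into (gball G (x n) r) (iso n r)) \<psi>)) b
        - ball_operator lim.H G' 0 r \<psi> b)) \<le> (\<Sum>b\<in>gball G' 0 r. \<bar>W (inv_into V (L n) b) - W' b\<bar>)"
      using eventually_difference[of r]
      by (rule eventually_mono) (unfold real_norm_def, rule op_norm_bound[OF fin], blast)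
  qed
qed

text \<open>The cutoff at radius k n \<ge> n is in the long run invisible from any fixed label, so
  boundedness and the equation pass to the limit. The lower bound at the roots, which all have the
  label 0, keeps the limit from vanishing.\<close>

lemma eigenfunction_limit:
  assumes k: "\<And>n. n \<le> k n" and \<phi>: "\<And>n u. u \<in> gball G (x n) (k n) \<Longrightarrow> cmod (\<phi> n u) \<le> 1"
    and approx: "\<And>n u. u \<in> gball G (x n) (k n) \<Longrightarrow> cmod (H (\<phi> n) u - lam * \<phi> n u) \<le> inverse (real (Suc n))"
    and large: "\<And>n. 1 / 2 < cmod (\<phi> n (x n))"
    and lim: "\<And>a. (\<lambda>n. if a \<in> L n ` gball G (x n) (k n) then \<phi> n (inv_into V (L n) a) else 0) \<longlonglongrightarrow> \<phi>' a"
  shows "lam \<in> sigma_infty V' lim.H"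
proof -
  define \<psi> where "\<psi> = restrict_to V' \<phi>'"
  have in_ball: "\<forall>\<^sub>F n in sequentially. inv_into V (L n) a \<in> gball G (x n) (k n) \<and> a \<in> L n ` gball G (x n) (k n)"
    if "a \<in> V'" for a
    using eventually_label[OF that] eventually_ge_at_top[of "gdist G' a 0"]
  proof eventually_elim
    case (elim n)
    then obtain u where u: "u \<in> gball G (x n) (gdist G' a 0)" "a = L n u" "inv_into V (L n) a = u"
      by metis
    then have "u \<in> gball G (x n) (k n)"
      using elim(2) order_trans[OF _ k[of n]] by (auto simp: gball_def)
    then show ?case
      unfolding u(3) using u(2) by blast
  qed
  have psi_lim: "(\<lambda>n. \<phi> n (inv_into V (L n) a)) \<longlonglongrightarrow> \<psi> a" if "a \<in> V'" for a
  proof -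
    have "(\<lambda>n. \<phi> n (inv_into V (L n) a)) \<longlonglongrightarrow> \<phi>' a"
      by (rule Lim_transform_eventually[OF lim]) (use in_ball[OF that] in \<open>auto elim: eventually_mono\<close>)
    then show ?thesis
      using that by (simp add: \<psi>_def restrict_to_def)
  qed
  have bound: "cmod (\<psi> a) \<le> 1" if "a \<in> V'" for a
    by (rule tendsto_upperbound[OF tendsto_norm[OF psi_lim[OF that]]])
       (use in_ball[OF that] \<phi> in \<open>auto elim: eventually_mono\<close>)
  have "1 / 2 \<le> cmod (\<psi> 0)"
  proof (rule tendsto_lowerbound[OF tendsto_norm[OF psi_lim[OF zero_in_V']]])
    have "inv_into V (L n) 0 = x n" for n
      using inv_into_f_f[OF inj root, of n n] L_root[of n] by simp
    then show "\<forall>\<^sub>F n in sequentially. 1 / 2 \<le> cmod (\<phi> n (inv_into V (L n) 0))"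
      using large by (simp add: less_imp_le)
  qed simp
  then have nonzero: "\<psi> \<noteq> (\<lambda>v. 0)"
    by auto
  have eig: "lim.H \<psi> a = lam * \<psi> a" if a: "a \<in> V'" for a
  proof (rule LIMSEQ_unique)
    have nbrs': "nbrs G' a \<subseteq> V'"
      using lim.nbrs_subset by simp
    let ?p = "\<lambda>n b. \<phi> n (inv_into V (L n) b)"
    \<comment> \<open>For large n this is \<open>H (\<phi> n)\<close> at the vertex labelled a,
      written over the neighbours of a in the limit graph so that the index set does not depend on
      n.\<close>
    let ?h = "\<lambda>n. (\<Sum>b\<in>nbrs G' a. ?p n b - ?p n a) + of_real (W (inv_into V (L n) a)) * ?p n a"
    show h: "?h \<longlonglongrightarrow> lim.H \<psi> a"
      unfolding schroedinger_def using a nbrs'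
      by (auto intro!: tendsto_intros psi_lim W_lim')
    have "(\<lambda>n. ?h n - lam * ?p n a) \<longlonglongrightarrow> 0"
    proof (rule Lim_null_comparison[OF _ LIMSEQ_inverse_real_of_nat])
      show "\<forall>\<^sub>F n in sequentially. cmod (?h n - lam * ?p n a) \<le> inverse (real (Suc n))"
        using eventually_label[OF a] in_ball[OF a]
      proof eventually_elim
        case (elim n)
        then obtain u where u: "u \<in> gball G (x n) (k n)" "a = L n u" "inv_into V (L n) a = u"
          "L n ` nbrs G u = nbrs G' a"
          by metis
        then have uV: "u \<in> V"
          by (simp add: gball_def)
        have "(\<Sum>b\<in>nbrs G' a. ?p n b - ?p n a) = (\<Sum>w\<in>nbrs G u. ?p n (L n w) - ?p n a)"
          unfolding u(4)[symmetric] by (simp add: sum.reindex[OF inj_on_subset[OF inj nbrs_subset]])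
        also have "\<dots> = (\<Sum>w\<in>nbrs G u. \<phi> n w - \<phi> n u)"
          using inv_into_f_f[OF inj] nbrs_subset u(3) by (intro sum.cong) (auto simp: subset_iff)
        finally have "?h n - lam * ?p n a = H (\<phi> n) u - lam * \<phi> n u"
          using uV u(3) by (simp add: schroedinger_def)
        then show ?case
          using approx[OF u(1)] by simp
      qed
    qed
    from tendsto_add[OF this tendsto_mult_left[OF psi_lim[OF a], of lam]]
    show "?h \<longlonglongrightarrow> lam * \<psi> a"
      by simp
  qed
  have "\<psi> \<in> ell_infty V'"
    using bound by (auto simp: ell_infty_def functions_on_def \<psi>_def restrict_to_def bounded_iff)
  moreover have "generalized_eigenfunction V' lim.H lam \<psi>"
    using nonzero eig by (auto simp: generalized_eigenfunction_def functions_on_def \<psi>_def restrict_to_def)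
  ultimately show ?thesis
    unfolding sigma_infty_def by blast
qed

end

section \<open>Extraction of a limit operator with an eigenfunction\<close>

lemma tendsto_of_bool_eventually:
  assumes "(\<lambda>n. of_bool (P n) :: complex) \<longlonglongrightarrow> l"
  obtains q where "\<forall>\<^sub>F n in sequentially. P n = q"
proof -
  obtain m where m: "\<forall>i\<ge>m. \<forall>j\<ge>m. cmod (of_bool (P i) - of_bool (P j)) < 1"
    using CauchyD[OF LIMSEQ_imp_Cauchy[OF assms], of 1] by auto
  have "P n = P m" if "n \<ge> m" for n
    using m[rule_format, OF that order_refl] by (cases "P n"; cases "P m") auto
  then have "\<forall>\<^sub>F n in sequentially. P n = P m"
    unfolding eventually_sequentially by blast
  then show thesis
    by (rule that)
qed

theorem (in bounded_schroedinger) R_limit_eigenfunction: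
  assumes v0: "v\<^sub>0 \<in> V"
    and ex: "\<And>k. \<exists>v \<phi>. v \<in> V \<and> k < gdist G v v\<^sub>0
      \<and> (\<forall>u\<in>gball G v k. cmod (\<phi> u) \<le> 1 \<and> cmod (H \<phi> u - lam * \<phi> u) \<le> inverse (real (Suc k)))
      \<and> 1 / 2 < cmod (\<phi> v)"
  shows "\<exists>(G', H') \<in> R_limits G v\<^sub>0 H. lam \<in> sigma_infty (verts G') H'"
proof -
  from choice[OF allI[OF ex]] obtain y where "\<forall>k. \<exists>\<phi>. y k \<in> V \<and> k < gdist G (y k) v\<^sub>0
      \<and> (\<forall>u\<in>gball G (y k) k. cmod (\<phi> u) \<le> 1 \<and> cmod (H \<phi> u - lam * \<phi> u) \<le> inverse (real (Suc k)))
      \<and> 1 / 2 < cmod (\<phi> (y k))" ..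
  from choice[OF this] obtain \<psi> where y: "\<And>k. y k \<in> V" "\<And>k. k < gdist G (y k) v\<^sub>0"
    and \<psi>: "\<And>k u. u \<in> gball G (y k) k \<Longrightarrow> cmod (\<psi> k u) \<le> 1"
      "\<And>k u. u \<in> gball G (y k) k \<Longrightarrow> cmod (H (\<psi> k) u - lam * \<psi> k u) \<le> inverse (real (Suc k))"
      "\<And>k. 1 / 2 < cmod (\<psi> k (y k))"
    by blast
  \<comment> \<open>The next index is the distance of the current vertex from the root, which
    exceeds the current index. So the distances increase strictly, as the definition of an R-limit
    demands a monotone sequence.\<close>
  define s where "s = rec_nat 0 (\<lambda>_ k. gdist G (y k) v\<^sub>0)"
  have s_Suc: "s (Suc n) = gdist G (y (s n)) v\<^sub>0" for n
    by (simp add: s_def)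
  have s: "strict_mono s"
    unfolding strict_mono_Suc_iff using y(2) by (simp add: s_Suc)
  define x where "x n = y (s n)" for n
  have x: "x n \<in> V" for n
    by (simp add: x_def y)
  have "\<exists>L. inj_on L V \<and> L (x n) = 0 \<and> (\<forall>r. L ` gball G (x n) r \<subseteq> {..<Suc d ^ r})" for n
    using labelling[OF x[of n]] by metis
  then obtain L :: "nat \<Rightarrow> 'v \<Rightarrow> nat" where L: "\<And>n. inj_on (L n) V" "\<And>n. L n (x n) = 0"
    "\<And>n r. L n ` gball G (x n) r \<subseteq> {..<Suc d ^ r}"
    by metis
  \<comment> \<open>Edges are coded by 0 and 1 so that a single diagonal argument for bounded
    complex functions on a countable index set yields the limits of edges, potentials and
    eigenfunctions along one subsequence.\<close>
  define A :: "nat \<Rightarrow> nat \<times> nat \<Rightarrow> complex" where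
    "A n = (\<lambda>(a, b). of_bool (\<exists>u w. L n u = a \<and> L n w = b \<and> adj G u w))" for n
  define P :: "nat \<Rightarrow> nat \<Rightarrow> complex" where
    "P n a = (if a \<in> L n ` V then of_real (W (inv_into V (L n) a)) else 0)" for n a
  \<comment> \<open>The functions are controlled only on their balls; cutting them off makes them
    uniformly bounded, and the radius n, which is at most \<open>s n\<close>, still exhausts the
    limit graph.\<close>
  define \<Phi> :: "nat \<Rightarrow> nat \<Rightarrow> complex" where
    "\<Phi> n a = (if a \<in> L n ` gball G (x n) n then \<psi> (s n) (inv_into V (L n) a) else 0)" for n a
  define Z where "Z n = case_sum (A n) (case_sum (P n) (\<Phi> n))" for n
  have inv: "inv_into V (L n) (L n u) = u" if "u \<in> V" for n u
    using inv_into_f_f[OF L(1) that] .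
  have ball_s: "u \<in> gball G (y (s n)) (s n)" if "u \<in> gball G (x n) n" for u n
    using that seq_suble[OF s, of n] by (auto simp: x_def gball_def)
  have "cmod (A n e) \<le> 1" for n e
    by (simp add: A_def split: prod.split)
  moreover have "cmod (P n a) \<le> \<bar>M\<bar>" for n a
    using W_bound inv by (force simp: P_def)
  moreover have "cmod (\<Phi> n a) \<le> 1" for n a
    using \<psi>(1)[OF ball_s] inv by (auto simp: \<Phi>_def gball_def)
  ultimately have "cmod (Z n i) \<le> max 1 \<bar>M\<bar>" for n i
    by (auto simp: Z_def max.coboundedI1 max.coboundedI2 split: sum.split)
  then obtain r where r: "strict_mono (r :: nat \<Rightarrow> nat)" and conv: "\<And>i. \<exists>l. (\<lambda>n. Z (r n) i) \<longlonglongrightarrow> l"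
    by - (rule function_convergent_subsequence[of UNIV Z "max 1 \<bar>M\<bar>"], simp, simp, blast)
  obtain l where l: "\<And>i. (\<lambda>n. Z (r n) i) \<longlonglongrightarrow> l i"
    using conv by metis
  have ex_edge: "\<exists>q. \<forall>\<^sub>F n in sequentially. (\<exists>u w. L (r n) u = a \<and> L (r n) w = b \<and> adj G u w) = q" for a b
  proof -
    have "(\<lambda>n. of_bool (\<exists>u w. L (r n) u = a \<and> L (r n) w = b \<and> adj G u w)) \<longlonglongrightarrow> l (Inl (a, b))"
      using l[of "Inl (a, b)"] by (simp add: Z_def A_def)
    then show ?thesis
      by (rule tendsto_of_bool_eventually) (rule exI)
  qed
  define E' where "E' a b = (SOME q. \<forall>\<^sub>F n in sequentially.
    (\<exists>u w. L (r n) u = a \<and> L (r n) w = b \<and> adj G u w) = q)" for a b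
  have E': "\<forall>\<^sub>F n in sequentially. (\<exists>u w. L (r n) u = a \<and> L (r n) w = b \<and> adj G u w) = E' a b" for a b
    unfolding E'_def by (rule someI_ex[OF ex_edge])
  have W': "(\<lambda>n. if a \<in> L (r n) ` V then W (inv_into V (L (r n)) a) else 0) \<longlonglongrightarrow> Re (l (Inr (Inl a)))" for a
    using tendsto_Re[OF l[of "Inr (Inl a)"]] by (simp add: Z_def P_def if_distrib[of Re] cong: if_cong)
  interpret graph_limit G W d M "\<lambda>n. x (r n)" "\<lambda>n. L (r n)" "\<lambda>k. {..<Suc d ^ k}" E' "\<lambda>a. Re (l (Inr (Inl a)))"
    by unfold_locales (use x L E' W' in auto)
  have n_le: "n \<le> s (r n)" for n
    using seq_suble[OF r, of n] seq_suble[OF s, of "r n"] by simp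
  have "lam \<in> sigma_infty V' lim.H"
  proof (rule eigenfunction_limit[where k=r and \<phi>="\<lambda>n. \<psi> (s (r n))"])
    show "n \<le> r n" for n
      by (rule seq_suble[OF r])
    show "cmod (\<psi> (s (r n)) u) \<le> 1" if "u \<in> gball G (x (r n)) (r n)" for n u
      by (rule \<psi>(1)[OF ball_s[OF that]])
    show "cmod (H (\<psi> (s (r n))) u - lam * \<psi> (s (r n)) u) \<le> inverse (real (Suc n))"
      if "u \<in> gball G (x (r n)) (r n)" for n u
    proof -
      have "inverse (real (Suc (s (r n)))) \<le> inverse (real (Suc n))"
        using n_le by (intro le_imp_inverse_le) auto
      then show ?thesis
        using \<psi>(2)[OF ball_s[OF that]] by linarith
    qed
    show "1 / 2 < cmod (\<psi> (s (r n)) (x (r n)))" for n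
      unfolding x_def by (rule \<psi>(3))
    show "(\<lambda>n. if a \<in> L (r n) ` gball G (x (r n)) (r n) then \<psi> (s (r n)) (inv_into V (L (r n)) a) else 0)
        \<longlonglongrightarrow> l (Inr (Inr a))" for a
      using l[of "Inr (Inr a)"] by (simp add: Z_def \<Phi>_def)
  qed
  moreover have "R_limit G v\<^sub>0 H G' lim.H"
    unfolding R_limit_def
  proof (intro conjI bexI exI)
    show "schroedinger_operator G' lim.H"
      by (rule schroedinger_operator_limit)
    show "0 \<in> verts G'"
      by (simp add: zero_in_V')
    show "\<forall>n. x (r n) \<in> V"
      using x by simp
    have D: "gdist G v\<^sub>0 (x (r n)) = s (Suc (r n))" for n
      by (simp add: s_Suc x_def gdist_commute)
    have "strict_mono (\<lambda>n. s (Suc (r n)))"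
      using s r by (simp add: strict_mono_def)
    then have "strict_mono (\<lambda>n. gdist G v\<^sub>0 (x (r n)))"
      unfolding D .
    then show "mono (\<lambda>n. gdist G v\<^sub>0 (x (r n)))" "filterlim (\<lambda>n. gdist G v\<^sub>0 (x (r n))) at_top sequentially"
      by (rule strict_mono_mono, rule filterlim_subseq)
    show "converges_to (\<lambda>n. H) (\<lambda>n. G) (\<lambda>n. x (r n)) lim.H G' 0"
      by (rule converges)
  qed
  ultimately show ?thesis
    unfolding R_limits_def by (intro bexI[of _ "(G', lim.H)"]) auto
qed

theorem theorem2p2:
  fixes d :: nat and G :: "'v ugraph" and v\<^sub>0 :: 'v and H :: "'v operator"
  assumes "rooted_bounded_graph d G v\<^sub>0"
    and "infinite (verts G)"
    and "connected_graph G"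
    and "subexponential_growth G v\<^sub>0"
    and "schroedinger_operator G H"
  shows "essential_spectrum (verts G) H
    \<subseteq> (\<Union>(G', H') \<in> R_limits G v\<^sub>0 H. sigma_infty (verts G') H')"
proof
  fix lam assume lam: "lam \<in> essential_spectrum (verts G) H"
  obtain W M where H: "H = schroedinger G W" and M: "\<And>v. v \<in> verts G \<Longrightarrow> \<bar>W v\<bar> \<le> M"
    using assms(5) unfolding schroedinger_operator_def bounded_iff by auto
  have v0: "v\<^sub>0 \<in> verts G"
    using assms(1) by (simp add: rooted_bounded_graph_def)
  interpret bounded_schroedinger G W d M
    using assms(1,3) M by unfold_locales (auto simp: rooted_bounded_graph_def)
  have real: "Im lam = 0"
    using lam spectrum_real by (auto simp: essential_spectrum_def H)
  have "\<exists>v \<phi>. v \<in> verts G \<and> k < gdist G v v\<^sub>0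
      \<and> (\<forall>u\<in>gball G v k. cmod (\<phi> u) \<le> 1
        \<and> cmod (schroedinger G W \<phi> u - lam * \<phi> u) \<le> inverse (real (Suc k)))
      \<and> 1 / 2 < cmod (\<phi> v)" for k
  proof (rule ccontr)
    assume not_ex: "\<not> ?thesis"
    \<comment> \<open>The absence of a witness for k is exactly \<open>local_bound\<close> with
      threshold and radius k and tolerance \<open>inverse (real (Suc k))\<close>.\<close>
    have "local_estimate G W d M v\<^sub>0 lam k k (inverse (real (Suc k)))"
    proof unfold_locales
      fix v \<phi>
      assume "v \<in> verts G" "k < gdist G v v\<^sub>0"
        "\<And>u. u \<in> gball G v k \<Longrightarrow> cmod (\<phi> u) \<le> 1 \<and> cmod (shifted lam \<phi> u) \<le> inverse (real (Suc k))"
      then show "cmod (\<phi> v) \<le> 1 / 2"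
        using not_ex unfolding shifted_def by (meson not_less)
    qed (use v0 assms(4) real in auto)
    then show False
      using lam unfolding H by (simp add: local_estimate.not_in_essential)
  qed
  from R_limit_eigenfunction[OF v0 this]
  show "lam \<in> (\<Union>(G', H') \<in> R_limits G v\<^sub>0 H. sigma_infty (verts G') H')"
    unfolding H by auto
qed

end
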